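(* Let $C:f=0$ be a reduced plane curve of degree $d$ in $\mathbb{P}^2$ over $\mathbb{C}$, let $r=mdr(f)$ be the minimal degree of a non-zero syzygy in $AR(f)$, and assume $d/2\leq r\leq d-1$. Then $\tau(C)\leq\tau(d,r)_{max}$, where $$\tau(d,r)_{max}=(d-1)(d-r-1)+r^2-\binom{2r-d+2}{2}.$$ If equality $\tau(C)=\tau(d,r)_{max}$ holds, then, setting $m=2r-d+3$, the minimal graded free resolution of the graded $S$-module $AR(f)$ has the form $$0\to S(-r-1)^{m-2}\to S(-r)^m\to AR(f)\to 0.$$ In particular, $AR(f)$ is minimally generated by $m$ elements and the exponents of $C$ are $d_1=d_2=\cdots=d_m=r$. Conversely, if $C:f=0$ is a reduced plane curve of degree $d$ such that, for some integer $r$ with $d/2\leq r\leq d-1$, a minimal set of homogeneous generators of $AR(f)$ consists of exactly $m=2r-d+3$ elements and the exponents of $C$ are $d_1=d_2=\cdots=d_m=r$, then $C$ is a maximal Tjurina curve of type $(d,r)$, that is, $mdr(f)=r$ and $\tau(C)=\tau(d,r)_{max}$.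
   Context: Let $S=\mathbb{C}[x,y,z]$ with its standard grading, and let $C:f=0$ be a reduced curve of degree $d$ in the complex projective plane $\mathbb{P}^2$, with $f\in S$ homogeneous of degree $d$ and partial derivatives $f_x,f_y,f_z$. The graded $S$-module of Jacobian syzygies is $$AR(f)=\{(a,b,c)\in S^3 : af_x+bf_y+cf_z=0\},$$ where a syzygy $(a,b,c)$ with $a,b,c$ homogeneous of degree $k$ has degree $k$; $mdr(f)$ is the minimal degree of a non-zero homogeneous element of $AR(f)$. The exponents of $C$ are the degrees $d_1\leq d_2\leq\cdots\leq d_m$ of the elements of a minimal set of homogeneous generators of $AR(f)$ (with $m$ elements). Let $J_f=(f_x,f_y,f_z)\subset S$ be the Jacobian ideal. The global Tjurina number $\tau(C)$ is the degree of $J_f$ (i.e. of the scheme it defines in $\mathbb{P}^2$, equivalently $\dim_{\mathbb{C}}(S/J_f)_k$ for large $k$); it equals the sum of the Tjurina numbers of all singular points of $C$. For $d/2\leq r\leq d-1$, $C:f=0$ is called a maximal Tjurina curve of type $(d,r)$ if $\deg f=d$, $mdr(f)=r$ and $\tau(C)=\tau(d,r)_{max}$. *)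

theory Defs
  imports
    "HOL-Computational_Algebra.Computational_Algebra"
    "HOL-Library.Product_Plus"
begin

(* S = C[x,y,z], realised as C[x][y][z]: the innermost variable is x, the outermost is z. *)
type_synonym poly3 = "complex poly poly poly"

definition coeff3 :: "poly3 \<Rightarrow> nat \<Rightarrow> nat \<Rightarrow> nat \<Rightarrow> complex" where
  "coeff3 f i j k = coeff (coeff (coeff f k) j) i"  (* coefficient of x^i y^j z^k *)

definition homogeneous :: "nat \<Rightarrow> poly3 \<Rightarrow> bool" where
  "homogeneous n f \<longleftrightarrow> (\<forall>i j k. coeff3 f i j k \<noteq> 0 \<longrightarrow> i + j + k = n)"

definition dx :: "poly3 \<Rightarrow> poly3" where
  "dx f = map_poly (map_poly pderiv) f"

definition dy :: "poly3 \<Rightarrow> poly3" where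
  "dy f = map_poly pderiv f"

definition dz :: "poly3 \<Rightarrow> poly3" where
  "dz f = pderiv f"

lemma coeff3_dx: "coeff3 (dx f) i j k = of_nat (Suc i) * coeff3 f (Suc i) j k"
  by (simp add: coeff3_def dx_def coeff_map_poly coeff_pderiv)

lemma coeff3_dy: "coeff3 (dy f) i j k = of_nat (Suc j) * coeff3 f i (Suc j) k"
  by (simp add: coeff3_def dy_def coeff_map_poly coeff_pderiv flip: of_nat_Suc)
    (simp only: of_nat_poly mult_pCons_left coeff_add coeff_smult coeff_pCons_0, simp)

lemma coeff3_dz: "coeff3 (dz f) i j k = of_nat (Suc k) * coeff3 f i j (Suc k)"
  by (simp add: coeff3_def dz_def coeff_pderiv flip: of_nat_Suc)
    (simp only: of_nat_poly mult_pCons_left coeff_add coeff_smult coeff_pCons_0, simp)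

(* C : f = 0 is reduced iff f has no multiple factor; squarefreeness forces f to be nonzero. *)
definition reduced_plane_curve :: "nat \<Rightarrow> poly3 \<Rightarrow> bool" where
  "reduced_plane_curve d f \<longleftrightarrow> d \<ge> 1 \<and> homogeneous d f \<and> squarefree f"

type_synonym triple = "poly3 \<times> poly3 \<times> poly3"

definition scale3 :: "poly3 \<Rightarrow> triple \<Rightarrow> triple" where
  "scale3 s v = (case v of (a, b, c) \<Rightarrow> (s * a, s * b, s * c))"

global_interpretation S3: module scale3
  by unfold_locales (auto simp: scale3_def algebra_simps)

definition homogeneous_triple :: "nat \<Rightarrow> triple \<Rightarrow> bool" where
  "homogeneous_triple n v \<longleftrightarrow>
     (case v of (a, b, c) \<Rightarrow> homogeneous n a \<and> homogeneous n b \<and> homogeneous n c)"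

definition AR :: "poly3 \<Rightarrow> triple set" where
  "AR f = {(a, b, c). a * dx f + b * dy f + c * dz f = 0}"

definition mdr :: "poly3 \<Rightarrow> nat" where
  "mdr f = (LEAST n. \<exists>v \<in> AR f. v \<noteq> 0 \<and> homogeneous_triple n v)"

(* Minimality is with respect to inclusion. *)
definition minimal_homogeneous_generators :: "triple set \<Rightarrow> triple set \<Rightarrow> bool" where
  "minimal_homogeneous_generators M G \<longleftrightarrow>
     (\<forall>g \<in> G. \<exists>n. homogeneous_triple n g) \<and> S3.span G = M \<and> (\<forall>H. H \<subset> G \<longrightarrow> S3.span H \<noteq> M)"

(* ds is the sorted list d_1 \<le> ... \<le> d_m of the degrees of a minimal set of homogeneous
   generators.  The elements of such a set are nonzero, so each has exactly one degree. *)
definition exponents :: "poly3 \<Rightarrow> nat list \<Rightarrow> bool" where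
  "exponents f ds \<longleftrightarrow> sorted ds \<and>
     (\<exists>gs. distinct gs \<and> minimal_homogeneous_generators (AR f) (set gs) \<and>
           list_all2 homogeneous_triple ds gs)"

definition jacobian_ideal :: "poly3 \<Rightarrow> poly3 set" where
  "jacobian_ideal f = {a * dx f + b * dy f + c * dz f | a b c. True}"

definition cscale :: "complex \<Rightarrow> poly3 \<Rightarrow> poly3" where
  "cscale t f = smult [:[:t:]:] f"

global_interpretation P3: vector_space cscale
  by unfold_locales (simp_all add: cscale_def smult_add_right smult_add_left[symmetric] flip: one_pCons)

(* B represents a basis of the quotient vector space V / W, for a subspace W of V. *)
definition quotient_basis :: "poly3 set \<Rightarrow> poly3 set \<Rightarrow> poly3 set \<Rightarrow> bool" where
  "quotient_basis V W B \<longleftrightarrow>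
     B \<subseteq> V \<and> V \<subseteq> P3.span (W \<union> B) \<and> (\<forall>b \<in> B. b \<notin> P3.span (W \<union> (B - {b})))"

definition quotient_dim :: "poly3 set \<Rightarrow> poly3 set \<Rightarrow> nat" where
  "quotient_dim V W = card (SOME B. quotient_basis V W B)"

(* dim (S / J_f)_k *)
definition milnor_hilbert :: "poly3 \<Rightarrow> nat \<Rightarrow> nat" where
  "milnor_hilbert f k =
     quotient_dim {p. homogeneous k p} {p. homogeneous k p \<and> p \<in> jacobian_ideal f}"

definition tjurina :: "poly3 \<Rightarrow> nat" where
  "tjurina f = (THE t. \<forall>\<^sub>F k in sequentially. milnor_hilbert f k = t)"

(* Only meant for d \<le> 2 * r, so that the subtraction in the binomial coefficient is exact. *)
definition tau_max :: "nat \<Rightarrow> nat \<Rightarrow> int" where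
  "tau_max d r = (int d - 1) * (int d - int r - 1) + (int r)^2 - int ((2 * r + 2 - d) choose 2)"

definition maximal_tjurina_curve :: "nat \<Rightarrow> nat \<Rightarrow> poly3 \<Rightarrow> bool" where
  "maximal_tjurina_curve d r f \<longleftrightarrow>
     d \<le> 2 * r \<and> r \<le> d - 1 \<and> reduced_plane_curve d f \<and>
     mdr f = r \<and> int (tjurina f) = tau_max d r"

(* An exact sequence of graded S-modules
     0 \<rightarrow> \<Oplus>_{j < n} S(- bs ! j) \<rightarrow> \<Oplus>_{i < m} S(- as ! i) \<rightarrow> M \<rightarrow> 0,
   with m = length as and n = length bs.  The i-th basis element of the middle module is sent to
   g i, the map on the left is the m x n matrix N, and elements of the free modules are the
   values of functions nat \<Rightarrow> S below m resp. n.  Both maps preserve degrees, where the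
   i-th basis element of the middle module has degree as ! i and the j-th one on the left has
   degree bs ! j. *)
definition graded_free_resolution ::
  "triple set \<Rightarrow> nat list \<Rightarrow> nat list \<Rightarrow> (nat \<Rightarrow> triple) \<Rightarrow> (nat \<Rightarrow> nat \<Rightarrow> poly3) \<Rightarrow> bool" where
  "graded_free_resolution M as bs g N \<longleftrightarrow>
     (\<forall>i < length as. homogeneous_triple (as ! i) (g i)) \<and>
     (\<forall>i < length as. \<forall>j < length bs.
        if as ! i \<le> bs ! j then homogeneous (bs ! j - as ! i) (N i j) else N i j = 0) \<and>
     range (\<lambda>u. \<Sum>i < length as. scale3 (u i) (g i)) = M \<and>
     (\<forall>u. (\<Sum>i < length as. scale3 (u i) (g i)) = 0 \<longleftrightarrow>
          (\<exists>v. \<forall>i < length as. u i = (\<Sum>j < length bs. N i j * v j))) \<and>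
     (\<forall>v. (\<forall>i < length as. (\<Sum>j < length bs. N i j * v j) = 0) \<longrightarrow> (\<forall>j < length bs. v j = 0))"

(* Minimal: the image of the left map lies in (x, y, z) times the middle module. *)
definition minimal_graded_free_resolution ::
  "triple set \<Rightarrow> nat list \<Rightarrow> nat list \<Rightarrow> (nat \<Rightarrow> triple) \<Rightarrow> (nat \<Rightarrow> nat \<Rightarrow> poly3) \<Rightarrow> bool" where
  "minimal_graded_free_resolution M as bs g N \<longleftrightarrow>
     graded_free_resolution M as bs g N \<and>
     (\<forall>i < length as. \<forall>j < length bs. coeff3 (N i j) 0 0 0 = 0)"

end

theory Submission
  imports Defs "HOL-Library.Function_Algebras" "HOL-Computational_Algebra.Field_as_Ring"
begin

text \<open>Write \<open>e = d - 1\<close> and \<open>S = \<complex>[x,y,z]\<close>. Counting dimensions, \<open>\<tau>(d,r)\<^sub>m\<^sub>a\<^sub>x\<close> is \<open>dim (S/J)\<^sub>k\<close> for \<open>k = r + e - 1\<close>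
  as soon as there are no syzygies in degree \<open>r - 1\<close>, so the bound says \<open>\<tau> \<le> dim (S/J)\<^sub>k\<close>.
  In general coordinates, two combinations \<open>P, Q\<close> of the partial derivatives and \<open>z\<close> form a regular
  sequence, and \<open>S/(P,Q)\<close> carries the residue pairing, which is perfect over \<open>\<complex>[z]\<close>. Multiplication
  by the third generator \<open>T\<close> of \<open>J\<close> is self-adjoint: its kernel, which has dimension \<open>\<tau>\<close> in high degrees,
  is orthogonal to its image. As the kernel consists of the last entries of syzygies, it vanishes
  in degrees below \<open>r\<close>, whence it pairs nondegenerately with \<open>(S/J)\<^sub>k\<close> for all \<open>k \<ge> 2e - 2 - r\<close>.

  If equality holds, \<open>S/(J,z)\<close> vanishes from degree \<open>r + e - 1\<close> on. All Hilbert functions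
  are then known, and modulo \<open>z\<close> the relation \<open>dim (xV + yV) \<ge> 2 dim V - dim V'\<close> with
  \<open>V' = {w. xw, yw \<in> V}\<close> shows that \<open>AR(f)\<close>, and in turn its first syzygy module, is generated in its lowest
  degree. Conversely, if \<open>AR(f)\<close> is generated in degree \<open>r\<close> by \<open>2r - d + 3\<close> elements, its Hilbert function
  modulo \<open>z\<close> grows by at least \<open>2\<close> in each degree, which bounds \<open>\<tau>\<close> from below.\<close>

section \<open>Complex vector spaces as a type class\<close>

text \<open>Everything is a dimension count in fixed degrees; singular points never appear.
  Squarefreeness enters through Euler's relation: the partial derivatives have no common factor, and
  general position starts from that. The thresholds come from C[x,y]/(p,q) with p, q the
  restrictions of P, Q to z = 0: its socle sits in degree 2e - 2, so a class of degree i is paired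
  with degree 2e - 2 - i, and i \<ge> r turns this into 2e - 2 - r. As d \<le> 2r, both r + e - 1
  and r + e - 2 reach the threshold; the second one serves the case of equality. With r = 0 the same
  pairing shows that the Hilbert function of S/J becomes constant. A change of coordinates alters
  AR(f). Only the dimensions of its graded pieces, and whether new generators are needed in a given
  degree, are carried back. This suffices: for the second syzygies z only has to be a
  non-zero-divisor, so the resolution is built in the original coordinates.\<close>

class cvec = ab_group_add +
  fixes csc :: "complex \<Rightarrow> 'a \<Rightarrow> 'a"
  assumes csc_add_right: "csc t (v + w) = csc t v + csc t w"
    and csc_add_left: "csc (s + t) v = csc s v + csc t v"
    and csc_csc: "csc s (csc t v) = csc (s * t) v"
    and csc_1 [simp]: "csc 1 v = v"

text \<open>A type class lets one polymorphic dimension theory serve forms, triples and tuples of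
  forms, and functionals, with linear maps between these types.\<close>

global_interpretation CV: vector_space "csc :: complex \<Rightarrow> 'a \<Rightarrow> 'a::cvec"
  by unfold_locales (simp_all add: csc_add_right csc_add_left csc_csc)

global_interpretation CVP: vector_space_pair
  "csc :: complex \<Rightarrow> 'a \<Rightarrow> 'a::cvec" "csc :: complex \<Rightarrow> 'b \<Rightarrow> 'b::cvec"
  by unfold_locales

instantiation complex :: cvec
begin
definition csc_complex :: "complex \<Rightarrow> complex \<Rightarrow> complex" where "csc_complex = (*)"
instance by standard (simp_all add: csc_complex_def algebra_simps)
end

instantiation poly :: (cvec) cvec
begin
definition csc_poly :: "complex \<Rightarrow> 'a poly \<Rightarrow> 'a poly" where "csc_poly t = map_poly (csc t)"
instance
  by standard (simp_all add: csc_poly_def poly_eq_iff coeff_map_poly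
      csc_add_right csc_add_left csc_csc)
end

instantiation prod :: (cvec, cvec) cvec
begin
definition csc_prod :: "complex \<Rightarrow> 'a \<times> 'b \<Rightarrow> 'a \<times> 'b" where
  "csc_prod t v = (csc t (fst v), csc t (snd v))"
instance
  by standard (simp_all add: csc_prod_def csc_add_right csc_add_left csc_csc prod_eq_iff)
end

instantiation "fun" :: (type, cvec) cvec
begin
definition csc_fun :: "complex \<Rightarrow> ('a \<Rightarrow> 'b) \<Rightarrow> 'a \<Rightarrow> 'b" where
  "csc_fun t v = (\<lambda>i. csc t (v i))"
instance
  by standard (simp_all add: csc_fun_def csc_add_right csc_add_left csc_csc fun_eq_iff)
end

abbreviation clinear :: "('a::cvec \<Rightarrow> 'b::cvec) \<Rightarrow> bool" where
  "clinear \<equiv> Vector_Spaces.linear csc csc"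

lemma clinearI:
  assumes "\<And>v w. f (v + w) = f v + f w" "\<And>t v. f (csc t v) = csc t (f v)"
  shows "clinear f"
  using assms by unfold_locales auto

lemma clinearD:
  assumes "clinear f"
  shows "f (v + w) = f v + f w" "f (csc t v) = csc t (f v)" "f 0 = 0" "f (v - w) = f v - f w"
    "f (- v) = - f v"
proof -
  interpret Vector_Spaces.linear csc csc f by fact
  show "f (v + w) = f v + f w" "f (csc t v) = csc t (f v)" "f 0 = 0" "f (v - w) = f v - f w"
    "f (- v) = - f v"
    by (auto simp: add scale diff neg)
qed

section \<open>Dimensions of finite-dimensional subspaces\<close>

text \<open>\<open>CV.dim\<close> has a junk value on subspaces that are not finite-dimensional.\<close>

definition fd :: "'a::cvec set \<Rightarrow> bool" where
  "fd V \<longleftrightarrow> CV.subspace V \<and> (\<exists>B. finite B \<and> V \<subseteq> CV.span B)"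

abbreviation dm :: "'a::cvec set \<Rightarrow> int" where "dm V \<equiv> int (CV.dim V)"

lemma fd_subspace: "fd V \<Longrightarrow> CV.subspace V"
  by (simp add: fd_def)

lemma fd_subset: "CV.subspace V \<Longrightarrow> fd W \<Longrightarrow> V \<subseteq> W \<Longrightarrow> fd V"
  unfolding fd_def by blast

lemma fd_0: "fd {0}"
  unfolding fd_def using CV.subspace_single_0 by (metis CV.span_empty finite.emptyI order_refl)

lemma fd_finite_independent:
  assumes "fd V" "B \<subseteq> V" "CV.independent B"
  shows "finite B"
  using assms CV.independent_span_bound unfolding fd_def by (meson dual_order.trans)

lemma fd_basis:
  assumes "fd V"
  obtains B where "B \<subseteq> V" "finite B" "CV.independent B" "CV.span B = V" "card B = CV.dim V"
proof -
  obtain B where B: "B \<subseteq> V" "CV.independent B" "V \<subseteq> CV.span B" "card B = CV.dim V"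
    using CV.basis_exists by blast
  moreover have "CV.span B = V"
    using B fd_subspace[OF assms] by (meson CV.span_minimal subset_antisym)
  ultimately show ?thesis using that fd_finite_independent[OF assms] by blast
qed

lemma fd_dim_mono:
  assumes "fd W" "V \<subseteq> W"
  shows "CV.dim V \<le> CV.dim W"
  proof -
  obtain B where "finite B" "CV.span B = W" "card B = CV.dim W" by (rule fd_basis[OF assms(1)]) simp
  then show ?thesis using CV.dim_le_card[of V B] assms(2) by simp
qed

lemma fd_dim_eq:
  assumes "fd W" "CV.subspace V" "V \<subseteq> W" "CV.dim W \<le> CV.dim V"
  shows "V = W"
proof -
  have fV: "fd V" using assms fd_subset by blast
  obtain B where B: "B \<subseteq> V" "finite B" "CV.independent B" "CV.span B = V" "card B = CV.dim V"
    by (rule fd_basis[OF fV]) simp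
  have "W \<subseteq> V"
  proof
    fix w assume w: "w \<in> W"
    show "w \<in> V"
    proof (rule ccontr)
      assume "w \<notin> V"
      then have "CV.independent (insert w B)" "w \<notin> B"
        using B CV.independent_insertI by auto
      moreover have "insert w B \<subseteq> W" using w B assms by auto
      moreover obtain C where C: "finite C" "CV.span C = W" "card C = CV.dim W"
        by (rule fd_basis[OF assms(1)]) simp
      ultimately have "card (insert w B) \<le> CV.dim W"
        using CV.independent_span_bound[of C "insert w B"]
        by (simp del: card_insert_disjoint)
      then show False using B \<open>w \<notin> B\<close> assms(4) by simp
    qed
  qed
  then show ?thesis using assms by blast
qed

lemma clinear_subspace_image: "clinear f \<Longrightarrow> CV.subspace V \<Longrightarrow> CV.subspace (f ` V)"
  by (rule CVP.linear_subspace_image)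

lemma fd_image:
  assumes "clinear f" "fd V"
  shows "fd (f ` V)"
proof -
  obtain B where B: "finite B" "CV.span B = V" by (rule fd_basis[OF assms(2)]) simp
  have "f ` V = CV.span (f ` B)" using B CVP.linear_span_image[OF assms(1)] by blast
  then show ?thesis
    using B fd_subspace[OF assms(2)] assms(1) clinear_subspace_image unfolding fd_def by blast
qed

lemma subspace_ker: "clinear f \<Longrightarrow> CV.subspace V \<Longrightarrow> CV.subspace {v \<in> V. f v = 0}"
  by (auto simp: CV.subspace_def clinearD)

lemma subspace_vimage: "clinear f \<Longrightarrow> CV.subspace V \<Longrightarrow> CV.subspace W \<Longrightarrow> CV.subspace {v \<in> V. f v \<in> W}"
  by (auto simp: CV.subspace_def clinearD)

lemma fd_extend_basis:
  assumes "fd W" "CV.subspace V" "V \<subseteq> W"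
  obtains B C where "finite B" "finite C" "B \<inter> C = {}" "CV.independent (B \<union> C)"
    "CV.span B = V" "CV.span (B \<union> C) = W" "card B = CV.dim V" "card C = CV.dim W - CV.dim V"
    "C \<subseteq> W"
proof -
  have fV: "fd V" using assms fd_subset by blast
  obtain B where B: "B \<subseteq> V" "finite B" "CV.independent B" "CV.span B = V" "card B = CV.dim V"
    by (rule fd_basis[OF fV]) simp
  have "B \<subseteq> W" using B(1) assms(3) by blast
  then obtain D where D: "B \<subseteq> D" "D \<subseteq> W" "CV.independent D" "W \<subseteq> CV.span D"
    using CV.maximal_independent_subset_extend[OF _ B(3)] by blast
  have fD: "finite D" using fd_finite_independent D assms(1) by blast
  have cD: "card D = CV.dim W" using CV.basis_card_eq_dim D by blast
  have sD: "CV.span D = W"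
    using D fd_subspace[OF assms(1)] by (meson CV.span_minimal subset_antisym)
  have D': "B \<union> (D - B) = D" using D(1) by blast
  have "card (D - B) = CV.dim W - CV.dim V"
    using fD D(1) B by (simp add: card_Diff_subset cD)
  then show ?thesis using that[of B "D - B"] B D fD sD D' by auto
qed

lemma rank_nullity:
  assumes "clinear f" "fd V"
  shows "dm V = dm {v \<in> V. f v = 0} + dm (f ` V)"
proof -
  interpret Vector_Spaces.linear csc csc f by fact
  let ?K = "{v \<in> V. f v = 0}"
  have sK: "CV.subspace ?K" using subspace_ker assms fd_subspace by blast
  obtain B C where BC: "finite B" "finite C" "B \<inter> C = {}" "CV.independent (B \<union> C)"
    "CV.span B = ?K" "CV.span (B \<union> C) = V" "card B = CV.dim ?K" "card C = CV.dim V - CV.dim ?K"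
    "C \<subseteq> V"
    by (rule fd_extend_basis[OF assms(2) sK]) auto
  have kerC: "v = 0" if v: "v \<in> CV.span C" "f v = 0" for v
  proof -
    have "v \<in> V" using v(1) BC(6) CV.span_mono[of C "B \<union> C"] by blast
    then have "v \<in> CV.span B" using v(2) BC(5) by simp
    then obtain b where b: "v = (\<Sum>w\<in>B. csc (b w) w)"
      using CV.span_finite[OF BC(1)] by auto
    obtain c where c: "v = (\<Sum>w\<in>C. csc (c w) w)"
      using v(1) CV.span_finite[OF BC(2)] by auto
    define u where "u w = (if w \<in> B then b w else - c w)" for w
    have "(\<Sum>w\<in>C. csc (u w) w) = - v"
      unfolding c sum_negf[symmetric] using BC(3) by (intro sum.cong) (auto simp: u_def)
    moreover have "(\<Sum>w\<in>B. csc (u w) w) = v"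
      unfolding b by (intro sum.cong) (auto simp: u_def)
    ultimately have "(\<Sum>w\<in>B \<union> C. csc (u w) w) = 0"
      using BC(1-3) by (simp add: sum.union_disjoint)
    then have "u w = 0" if "w \<in> C" for w
      using CV.independentD[OF BC(4)] that BC(1,2) by blast
    then show ?thesis
      using \<open>(\<Sum>w\<in>C. csc (u w) w) = - v\<close> by simp
  qed
  have inj: "inj_on f (CV.span C)"
  proof (rule inj_onI)
    fix x y assume "x \<in> CV.span C" "y \<in> CV.span C" "f x = f y"
    then show "x = y" using kerC[of "x - y"] by (simp add: CV.span_diff diff)
  qed
  have indC: "CV.independent C" using BC(4) CV.independent_mono by blast
  have "CV.independent (f ` C)"
    using CVP.linear_independent_injective_image[OF assms(1) indC inj] .
  moreover have "f ` V = CV.span (f ` C)"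
  proof -
    have "f ` V = CV.span (f ` B \<union> f ` C)"
      using BC(6) CVP.linear_span_image[OF assms(1), of "B \<union> C"] by (simp add: image_Un)
    also have "\<dots> = CV.span (f ` C)"
    proof (rule subset_antisym)
      have "f ` B \<subseteq> {0}" using BC(5) CV.span_base[of _ B] by auto
      then have "f ` B \<union> f ` C \<subseteq> CV.span (f ` C)"
        using CV.span_zero CV.span_superset by fastforce
      then show "CV.span (f ` B \<union> f ` C) \<subseteq> CV.span (f ` C)"
        by (rule CV.span_minimal) (rule CV.subspace_span)
      show "CV.span (f ` C) \<subseteq> CV.span (f ` B \<union> f ` C)"
        by (rule CV.span_mono) simp
    qed
    finally show ?thesis .
  qed
  ultimately have "CV.dim (f ` V) = card (f ` C)"
    using CV.dim_span_eq_card_independent by metis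
  also have "\<dots> = card C"
    using inj by (meson CV.span_superset card_image inj_on_subset)
  finally show ?thesis using BC(8) fd_dim_mono[OF assms(2), of ?K] by auto
qed

lemma dim_0 [simp]: "CV.dim {0 :: 'a::cvec} = 0"
  by (metis CV.dim_eq_card_independent CV.dim_span CV.independent_empty CV.span_empty card.empty)

lemma dim_inj_image:
  assumes "clinear f" "fd V" "\<And>v. v \<in> V \<Longrightarrow> f v = 0 \<Longrightarrow> v = 0"
  shows "dm (f ` V) = dm V"
proof -
  have "{v \<in> V. f v = 0} = {0}"
    using assms CV.subspace_0[OF fd_subspace[OF assms(2)]] by (auto simp: clinearD)
  then show ?thesis using rank_nullity[OF assms(1,2)] by simp
qed

lemma clinear_pairs [intro]:
  "clinear (\<lambda>v. (v, 0))" "clinear (\<lambda>v. (0, v))" "clinear fst" "clinear snd"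
  by (auto intro!: clinearI simp: csc_prod_def)

lemma clinear_compose: "clinear f \<Longrightarrow> clinear g \<Longrightarrow> clinear (\<lambda>v. f (g v))"
  by (auto intro!: clinearI simp: clinearD)

lemma clinear_add: "clinear f \<Longrightarrow> clinear g \<Longrightarrow> clinear (\<lambda>v. f v + g v)"
  by (auto intro!: clinearI simp: clinearD csc_add_right)

definition ssum :: "'a::cvec set \<Rightarrow> 'a set \<Rightarrow> 'a set" where
  "ssum V W = {v + w | v w. v \<in> V \<and> w \<in> W}"

lemma ssum_image: "ssum V W = (\<lambda>x. fst x + snd x) ` (V \<times> W)"
  unfolding ssum_def by force

lemma clinear_plus: "clinear (\<lambda>x. fst x + snd x)"
  by (auto intro!: clinearI simp: csc_prod_def csc_add_right)

lemma subspace_Times: "CV.subspace V \<Longrightarrow> CV.subspace W \<Longrightarrow> CV.subspace (V \<times> W)"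
  by (auto simp: CV.subspace_def csc_prod_def zero_prod_def)

lemma fd_Times:
  assumes "fd V" "fd W"
  shows "fd (V \<times> W)"
proof -
  obtain B where B: "finite B" "CV.span B = V" by (rule fd_basis[OF assms(1)]) simp
  obtain C where C: "finite C" "CV.span C = W" by (rule fd_basis[OF assms(2)]) simp
  let ?D = "(\<lambda>v. (v, 0)) ` B \<union> (\<lambda>v. (0, v)) ` C"
  have "V \<times> W \<subseteq> CV.span ?D"
  proof
    fix x assume x: "x \<in> V \<times> W"
    then have "(fst x, 0) \<in> (\<lambda>v. (v, 0)) ` CV.span B" "(0, snd x) \<in> (\<lambda>v. (0, v)) ` CV.span C"
      using B C by auto
    then have "(fst x, 0) \<in> CV.span ((\<lambda>v. (v, 0)) ` B)" "(0, snd x) \<in> CV.span ((\<lambda>v. (0, v)) ` C)"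
      using CVP.linear_span_image[OF clinear_pairs(1), of B] CVP.linear_span_image[OF clinear_pairs(2), of C]
      by blast+
    then have "(fst x, 0) + (0, snd x) \<in> CV.span ?D"
      by (intro CV.span_add) (auto intro: CV.span_mono[THEN subsetD, rotated])
    then show "x \<in> CV.span ?D" by simp
  qed
  moreover have "CV.subspace (V \<times> W)"
    by (rule subspace_Times[OF assms[THEN fd_subspace]])
  moreover have "finite ?D" using B(1) C(1) by simp
  ultimately show ?thesis unfolding fd_def by (intro conjI exI[of _ ?D])
qed

lemma dim_Times:
  assumes "fd V" "fd W"
  shows "dm (V \<times> W) = dm V + dm W"
proof -
  have z: "0 \<in> V" "0 \<in> W" by (rule CV.subspace_0[OF fd_subspace], rule assms)+
  have k: "{x \<in> V \<times> W. fst x = 0} = (\<lambda>v. (0, v)) ` W" using z by auto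
  have "fst ` (V \<times> W) = V" using z by force
  moreover have "dm ((\<lambda>v. (0 :: 'a, v)) ` W) = dm W"
    by (rule dim_inj_image) (auto simp: assms zero_prod_def)
  ultimately show ?thesis
    using rank_nullity[OF clinear_pairs(3) fd_Times[OF assms]] k by simp
qed

lemma fd_ssum: "fd V \<Longrightarrow> fd W \<Longrightarrow> fd (ssum V W)"
  unfolding ssum_image by (intro fd_image clinear_plus fd_Times)

lemma dim_ssum:
  assumes "fd V" "fd W"
  shows "dm (ssum V W) = dm V + dm W - dm (V \<inter> W)"
proof -
  note sV = fd_subspace[OF assms(1)] and sW = fd_subspace[OF assms(2)]
  have f: "fd (V \<inter> W)" by (rule fd_subset[OF CV.subspace_inter[OF sV sW] assms(1)]) simp
  have "{x \<in> V \<times> W. fst x + snd x = 0} = (\<lambda>v. (v, - v)) ` (V \<inter> W)"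
    using CV.subspace_neg[OF sW] by (force simp: add_eq_0_iff)
  moreover have "dm ((\<lambda>v. (v, - v)) ` (V \<inter> W)) = dm (V \<inter> W)"
    by (rule dim_inj_image[OF _ f]) (auto intro!: clinearI simp: csc_prod_def zero_prod_def)
  ultimately show ?thesis
    using rank_nullity[OF clinear_plus fd_Times[OF assms]] dim_Times[OF assms] by (simp add: ssum_image)
qed

lemma ssum_superset: "fd V \<Longrightarrow> fd W \<Longrightarrow> V \<subseteq> ssum V W \<and> W \<subseteq> ssum V W"
  unfolding ssum_def using fd_subspace CV.subspace_0 by force

text \<open>Zeros from index \<open>m\<close> on give each element of the m-fold product exactly one
  representative, as a dimension count requires.\<close>

definition tuples :: "nat \<Rightarrow> 'a::cvec set \<Rightarrow> (nat \<Rightarrow> 'a) set" where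
  "tuples m V = {u. (\<forall>i<m. u i \<in> V) \<and> (\<forall>i\<ge>m. u i = 0)}"

lemma dim_tuples:
  assumes "fd V"
  shows "fd (tuples m V) \<and> dm (tuples m V) = int m * dm V"
proof (induction m)
  case 0
  have "tuples 0 V = {0}" by (auto simp: tuples_def fun_eq_iff)
  then show ?case using fd_0 by simp
next
  case (Suc m)
  let ?f = "\<lambda>x. fst x + (\<lambda>i. if i = m then snd x else 0)"
  have cl: "clinear ?f"
    by (auto intro!: clinearI simp: csc_prod_def csc_fun_def fun_eq_iff csc_add_right)
  have im: "tuples (Suc m) V = ?f ` (tuples m V \<times> V)"
  proof (intro subset_antisym subsetI)
    fix u assume "u \<in> tuples (Suc m) V"
    then have "(u(m := 0), u m) \<in> tuples m V \<times> V" "u = ?f (u(m := 0), u m)"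
      by (auto simp: tuples_def fun_eq_iff)
    then show "u \<in> ?f ` (tuples m V \<times> V)" by (rule rev_image_eqI)
  qed (auto simp: tuples_def less_Suc_eq CV.subspace_0[OF fd_subspace[OF assms]])
  have "dm (?f ` (tuples m V \<times> V)) = dm (tuples m V \<times> V)"
  proof (rule dim_inj_image[OF cl])
    fix x assume x: "x \<in> tuples m V \<times> V" "?f x = 0"
    then have "fst x i + (if i = m then snd x else 0) = 0" for i by (simp add: fun_eq_iff)
    from this[of m] x have "snd x = 0" by (auto simp: tuples_def)
    moreover have "fst x = 0"
      by (rule ext) (use x(2) \<open>snd x = 0\<close> in \<open>auto simp: fun_eq_iff dest: spec split: if_splits\<close>)
    ultimately show "x = 0" by (simp add: prod_eq_iff)
  qed (use Suc assms fd_Times in blast)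
  moreover have "dm (tuples m V \<times> V) = int (Suc m) * dm V"
    using dim_Times[of "tuples m V" V] Suc assms by (simp add: algebra_simps)
  moreover have "fd (?f ` (tuples m V \<times> V))"
    by (intro fd_image[OF cl] fd_Times) (simp_all add: Suc assms)
  ultimately show ?case unfolding im by simp
qed

lemma exists_functional:
  assumes "CV.subspace W" "v \<notin> W"
  obtains \<phi> :: "'a::cvec \<Rightarrow> complex" where "clinear \<phi>" "\<phi> v = 1" "\<And>w. w \<in> W \<Longrightarrow> \<phi> w = 0"
proof -
  obtain B where B: "B \<subseteq> W" "CV.independent B" "W \<subseteq> CV.span B"
    by (rule CV.basis_exists[of W]) simp
  have sB: "CV.span B = W" using B CV.span_minimal[OF B(1) assms(1)] by blast
  have ind: "CV.independent (insert v B)"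
    using B(2) assms(2) sB CV.independent_insertI[of v B] by simp
  have "\<exists>\<phi> :: 'a \<Rightarrow> complex. clinear \<phi> \<and> (\<forall>x\<in>insert v B. \<phi> x = (if x = v then 1 else 0))"
    by (rule CVP.linear_independent_extend[OF ind])
  then obtain \<phi> :: "'a \<Rightarrow> complex" where \<phi>: "clinear \<phi>" "\<forall>x\<in>insert v B. \<phi> x = (if x = v then 1 else 0)"
    by auto
  have "\<phi> w = 0" if "w \<in> W" for w
    by (rule CVP.linear_eq_0_on_span[OF \<phi>(1), of B]) (use \<phi> B sB that assms(2) in auto)
  then show ?thesis using that \<phi> by simp
qed

text \<open>Each \<open>u\<close> induces a functional on \<open>V\<close> that kills
  \<open>V0\<close>, and it is zero only for \<open>u\<close> in \<open>U0\<close>. So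
  \<open>U\<close> modulo the part orthogonal to \<open>V\<close> embeds into the dual of V/V0.
  Nondegeneracy is asked on one side only.\<close>

lemma pairing_dim:
  fixes \<beta> :: "'a::cvec \<Rightarrow> 'b::cvec \<Rightarrow> complex"
  assumes "fd V" "fd U" "CV.subspace V0" "V0 \<subseteq> V"
    and l: "\<And>u. clinear (\<lambda>v. \<beta> v u)" and r: "\<And>v. clinear (\<beta> v)"
    and V0: "\<And>v u. v \<in> V0 \<Longrightarrow> u \<in> U \<Longrightarrow> \<beta> v u = 0"
    and U0: "\<And>u. u \<in> U \<Longrightarrow> (\<And>v. v \<in> V \<Longrightarrow> \<beta> v u = 0) \<Longrightarrow> u \<in> U0" and "fd U0"
  shows "dm U - dm U0 \<le> dm V - dm V0"
proof -
  obtain B C where BC: "finite B" "finite C" "B \<inter> C = {}" "CV.independent (B \<union> C)"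
    "CV.span B = V0" "CV.span (B \<union> C) = V" "card B = CV.dim V0" "card C = CV.dim V - CV.dim V0"
    "C \<subseteq> V"
    by (rule fd_extend_basis[OF assms(1,3,4)]) auto
  \<comment> \<open>The dual of V/V0 is realised by the values on the complementary basis
    \<open>C\<close>.\<close>
  define \<Psi> where "\<Psi> u = (\<lambda>c. if c \<in> C then \<beta> c u else 0)" for u
  have cl: "clinear \<Psi>"
    by (rule clinearI) (auto simp: \<Psi>_def fun_eq_iff csc_fun_def clinearD[OF r])
  have "{u \<in> U. \<Psi> u = 0} \<subseteq> U0"
  proof safe
    fix u assume u: "u \<in> U" "\<Psi> u = 0"
    show "u \<in> U0"
    proof (rule U0[OF u(1)])
      fix v assume v: "v \<in> V"
      show "\<beta> v u = 0"
      proof (rule CVP.linear_eq_0_on_span[OF l, of "B \<union> C"])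
        fix x assume "x \<in> B \<union> C"
        then show "\<beta> x u = 0"
          using V0[OF _ u(1), of x] BC(5) CV.span_base[of x B] fun_cong[OF u(2), of x]
          by (auto simp: \<Psi>_def)
      qed (use v BC in simp)
    qed
  qed
  then have 1: "dm {u \<in> U. \<Psi> u = 0} \<le> dm U0" using fd_dim_mono[OF \<open>fd U0\<close>] by simp
  let ?e = "\<lambda>c :: 'a. (\<lambda>x. if x = c then 1 else 0) :: 'a \<Rightarrow> complex"
  have "\<Psi> ` U \<subseteq> CV.span (?e ` C)"
  proof safe
    fix u
    have "\<Psi> u = (\<Sum>c\<in>C. csc (\<beta> c u) (?e c))"
    proof
      fix x
      have "(\<Sum>c\<in>C. csc (\<beta> c u) (?e c)) x = (\<Sum>c\<in>C. if x = c then \<beta> c u else 0)"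
        using \<open>finite C\<close> by (induction C) (auto simp: csc_fun_def csc_complex_def)
      then show "\<Psi> u x = (\<Sum>c\<in>C. csc (\<beta> c u) (?e c)) x"
        using \<open>finite C\<close> by (simp add: \<Psi>_def)
    qed
    also have "\<dots> \<in> CV.span (?e ` C)"
      by (intro CV.span_sum CV.span_scale CV.span_base) auto
    finally show "\<Psi> u \<in> CV.span (?e ` C)" .
  qed
  then have "CV.dim (\<Psi> ` U) \<le> card (?e ` C)" using BC CV.dim_le_card by blast
  also have "\<dots> \<le> card C" using BC card_image_le by blast
  finally have "dm (\<Psi> ` U) \<le> dm V - dm V0"
    using BC(8) fd_dim_mono[OF assms(1,4)] by linarith
  then show ?thesis using rank_nullity[OF cl assms(2)] 1 by linarith
qed

section \<open>Forms in three variables\<close>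

definition rhom :: "('a::comm_ring_1 \<Rightarrow> 'b::comm_ring_1) \<Rightarrow> bool" where
  "rhom h \<longleftrightarrow> h 1 = 1 \<and> (\<forall>x y. h (x + y) = h x + h y) \<and> (\<forall>x y. h (x * y) = h x * h y)"

lemma rhomD:
  assumes "rhom h"
  shows "h 1 = 1" "h (x + y) = h x + h y" "h (x * y) = h x * h y" "h 0 = 0" "h (- x) = - h x"
    "h (x - y) = h x - h y" "h (x ^ n) = h x ^ n"
proof -
  show 1: "h 1 = 1" and add: "h (x + y) = h x + h y" and m: "h (x * y) = h x * h y" for x y
    using assms by (auto simp: rhom_def)
  have "h 0 + h 0 = h 0" using add[of 0 0] by simp
  then show 0: "h 0 = 0" by (metis add_cancel_right_right)
  show neg: "h (- x) = - h x" for x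
    using add[of x "- x"] 0 by (simp add: eq_neg_iff_add_eq_0 add.commute)
  show "h (x - y) = h x - h y" using add[of x "- y"] neg by simp
  show "h (x ^ n) = h x ^ n" by (induction n) (simp_all add: 1 m)
qed

lemma rhom_compose: "rhom g \<Longrightarrow> rhom h \<Longrightarrow> rhom (\<lambda>x. g (h x))"
  by (simp add: rhom_def)

lemma rhom_id: "rhom (\<lambda>x. x)"
  by (simp add: rhom_def)

lemma rhom_dvd: "rhom h \<Longrightarrow> a dvd b \<Longrightarrow> h a dvd h b"
  by (auto simp: dvd_def rhomD)

definition heval :: "('a::comm_ring_1 \<Rightarrow> 'b::comm_ring_1) \<Rightarrow> 'b \<Rightarrow> 'a poly \<Rightarrow> 'b" where
  "heval h x p = poly (map_poly h p) x"

lemma heval_pCons: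
  assumes "rhom h"
  shows "heval h x (pCons a p) = h a + x * heval h x p"
  using assms by (cases "pCons a p = 0") (auto simp: heval_def map_poly_pCons rhomD)

lemma heval_0 [simp]: "heval h x 0 = 0"
  by (simp add: heval_def)

lemma heval_const: "rhom h \<Longrightarrow> heval h x [:a:] = h a"
  and heval_var: "rhom h \<Longrightarrow> heval h x [:0, 1:] = x"
  by (simp_all add: heval_pCons rhomD)

lemma rhom_heval:
  assumes "rhom h"
  shows "rhom (heval h x)"
proof -
  have add: "heval h x (p + q) = heval h x p + heval h x q" for p q
    by (induction p q rule: poly_induct2) (simp_all add: heval_pCons assms rhomD algebra_simps)
  have sm: "heval h x (smult a p) = h a * heval h x p" for a p
    by (induction p) (simp_all add: heval_pCons assms rhomD algebra_simps)
  have "heval h x (p * q) = heval h x p * heval h x q" for p q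
    by (induction p) (simp_all add: heval_pCons assms add sm rhomD algebra_simps)
  moreover have "heval h x 1 = 1"
    using heval_const[OF assms, of x 1] assms by (simp add: rhomD flip: one_pCons)
  ultimately show ?thesis by (simp add: rhom_def add)
qed

lemma rhom_ext:
  assumes "rhom g" "rhom h" "\<And>a. g [:a:] = h [:a:]" "g [:0, 1:] = h [:0, 1:]"
  shows "g p = h p"
proof (induction p)
  case (pCons a p)
  have *: "pCons a p = [:a:] + [:0, 1:] * p" by simp
  show ?case unfolding * rhomD[OF assms(1)] rhomD[OF assms(2)] using assms pCons by simp
qed (simp add: assms rhomD)

definition X :: poly3 where "X = [:[:[:0, 1:]:]:]"
definition Y :: poly3 where "Y = [:[:0, 1:]:]"
definition Z :: poly3 where "Z = [:0, 1:]"
definition C3 :: "complex \<Rightarrow> poly3" where "C3 t = [:[:[:t:]:]:]"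

lemmas xyz_defs = X_def Y_def Z_def C3_def

definition ev3 :: "(complex \<Rightarrow> 'a) \<Rightarrow> 'a \<Rightarrow> 'a \<Rightarrow> 'a \<Rightarrow> poly3 \<Rightarrow> 'a::comm_ring_1" where
  "ev3 h x y z = heval (heval (heval h x) y) z"

lemma ev3:
  assumes "rhom h"
  shows "rhom (ev3 h x y z)" "ev3 h x y z (C3 t) = h t" "ev3 h x y z X = x" "ev3 h x y z Y = y"
    "ev3 h x y z Z = z"
  by (simp_all add: ev3_def rhom_heval heval_const heval_var assms xyz_defs)

text \<open>Uniqueness in the universal property of C[x,y,z]: identities between composed
  substitutions reduce to constants and the three variables.\<close>

lemma rhom_ext3:
  assumes "rhom g" "rhom h" "\<And>t. g (C3 t) = h (C3 t)" "g X = h X" "g Y = h Y" "g Z = h Z"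
  shows "g p = h p"
proof -
  have c: "rhom (\<lambda>p. [:p:] :: 'c::comm_ring_1 poly)" by (simp add: rhom_def flip: one_pCons)
  have 1: "g [:[:p:]:] = h [:[:p:]:]" for p
    by (rule rhom_ext[of "\<lambda>p. g [:[:p:]:]" "\<lambda>p. h [:[:p:]:]"])
      (rule rhom_compose[OF assms(1) rhom_compose[OF c c]] rhom_compose[OF assms(2) rhom_compose[OF c c]]
        | use assms in \<open>simp add: xyz_defs\<close>)+
  have 2: "g [:p:] = h [:p:]" for p
    by (rule rhom_ext[of "\<lambda>p. g [:p:]" "\<lambda>p. h [:p:]"])
      (rule rhom_compose[OF assms(1) c] rhom_compose[OF assms(2) c] | use assms 1 in \<open>simp add: xyz_defs\<close>)+
  show ?thesis
    by (rule rhom_ext) (use assms 2 in \<open>auto simp: xyz_defs\<close>)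
qed

lemma poly3_eqI: "(\<And>i j k. coeff3 f i j k = coeff3 g i j k) \<Longrightarrow> f = g"
  by (simp add: coeff3_def poly_eq_iff)

lemma csc_poly3: "csc t f = C3 t * (f :: poly3)"
  by (simp add: csc_poly_def csc_complex_def poly_eq_iff coeff_map_poly C3_def)

lemma cscale_eq_csc: "cscale = csc"
  by (simp add: fun_eq_iff csc_poly3 cscale_def C3_def)

lemma csc_mult_left: "csc t f * g = csc t (f * g :: poly3)"
  and csc_mult_right: "f * csc t g = csc t (f * g :: poly3)"
  by (simp_all only: csc_poly3 ac_simps)

lemma coeff3_simps [simp]:
  "coeff3 0 i j k = 0" "coeff3 (f + g) i j k = coeff3 f i j k + coeff3 g i j k"
  "coeff3 (- f) i j k = - coeff3 f i j k"
  "coeff3 (f - g) i j k = coeff3 f i j k - coeff3 g i j k"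
  "coeff3 (csc t f) i j k = t * coeff3 f i j k"
  by (simp_all add: coeff3_def csc_poly3 C3_def)

lemma coeff3_sum: "coeff3 (sum f A) i j k = (\<Sum>a\<in>A. coeff3 (f a) i j k)"
  by (induction A rule: infinite_finite_induct) auto

lemma coeff3_X: "coeff3 (X * f) i j k = (case i of 0 \<Rightarrow> 0 | Suc n \<Rightarrow> coeff3 f n j k)"
  and coeff3_Y: "coeff3 (Y * f) i j k = (case j of 0 \<Rightarrow> 0 | Suc n \<Rightarrow> coeff3 f i n k)"
  and coeff3_Z: "coeff3 (Z * f) i j k = (case k of 0 \<Rightarrow> 0 | Suc n \<Rightarrow> coeff3 f i j n)"
  by (auto simp: coeff3_def coeff_pCons xyz_defs split: nat.split)

lemma coeff3_C3: "coeff3 (C3 t) i j k = (if i = 0 \<and> j = 0 \<and> k = 0 then t else 0)"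
  by (auto simp: coeff3_def coeff_pCons xyz_defs split: nat.split)

text \<open>The degree is an integer so that shifts such as k - 2e need no side conditions: in
  negative degrees the space is zero.\<close>

definition Hm :: "int \<Rightarrow> poly3 set" where
  "Hm n = {f. \<forall>i j k. coeff3 f i j k \<noteq> 0 \<longrightarrow> int (i + j + k) = n}"

lemma homogeneous_iff: "homogeneous n f \<longleftrightarrow> f \<in> Hm (int n)"
  unfolding homogeneous_def Hm_def mem_Collect_eq of_nat_eq_iff ..

lemma Hm_neg: "n < 0 \<Longrightarrow> Hm n = {0}"
  by (auto simp: Hm_def intro!: poly3_eqI)

lemma subspace_Hm: "CV.subspace (Hm n)"
  by (auto simp: CV.subspace_def Hm_def) (metis add.right_neutral)+

lemma C3_Hm: "C3 t \<in> Hm 0" and X_Hm: "X \<in> Hm 1" and Y_Hm: "Y \<in> Hm 1" and Z_Hm: "Z \<in> Hm 1"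
  by (auto simp: Hm_def coeff3_def coeff_pCons xyz_defs split: nat.splits)

text \<open>The substitution \<open>x, y, z \<mapsto> xt, yt, zt\<close>; the coefficients of powers of \<open>t\<close> are the
  homogeneous components.\<close>

definition grd :: "poly3 \<Rightarrow> poly3 poly" where
  "grd = ev3 (\<lambda>t. [:C3 t:]) (monom X (Suc 0)) (monom Y (Suc 0)) (monom Z (Suc 0))"

lemma rhom_C: "rhom (\<lambda>t. [:C3 t:])" "rhom C3"
  by (simp_all add: rhom_def C3_def flip: one_pCons)

lemma rhom_grd: "rhom grd"
  unfolding grd_def by (intro ev3 rhom_C)

lemma coeff3_coeff_grd:
  "coeff3 (coeff (grd f) n) i j k = (if i + j + k = n then coeff3 f i j k else 0)"
proof -
  have m: "coeff (monom h (Suc 0) * q) n = (case n of 0 \<Rightarrow> 0 | Suc m \<Rightarrow> h * coeff q m)" for h :: poly3 and q n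
    by (auto simp: coeff_monom_mult split: nat.split)
  note h1 = rhom_C(1) and h2 = rhom_heval[OF rhom_C(1), of "monom X (Suc 0)"]
  note h3 = rhom_heval[OF h2, of "monom Y (Suc 0)"]
  have 1: "coeff3 (coeff (heval (\<lambda>t. [:C3 t:]) (monom X (Suc 0)) p) n) i j k
     = (if i = n \<and> j = 0 \<and> k = 0 then coeff p i else 0)" for p n i j k
    by (induction p arbitrary: n i)
      (auto simp: heval_pCons[OF h1] m coeff3_X coeff3_C3 coeff_pCons rhomD[OF h2] split: nat.splits)
  have 2: "coeff3 (coeff (heval (heval (\<lambda>t. [:C3 t:]) (monom X (Suc 0))) (monom Y (Suc 0)) p) n) i j k
     = (if i + j = n \<and> k = 0 then coeff (coeff p j) i else 0)" for p n i j k
    by (induction p arbitrary: n j)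
      (auto simp: heval_pCons[OF h2] 1 m coeff3_Y coeff_pCons rhomD[OF h3] split: nat.splits)
  have "coeff3 (coeff (heval (heval (heval (\<lambda>t. [:C3 t:]) (monom X (Suc 0))) (monom Y (Suc 0))) (monom Z (Suc 0)) f) n) i j k
     = (if i + j + k = n then coeff (coeff (coeff f k) j) i else 0)"
    by (induction f arbitrary: n k)
      (auto simp: heval_pCons[OF h3] 2 m coeff3_Z coeff_pCons rhomD[OF rhom_heval[OF h3]] split: nat.splits)
  then show ?thesis by (simp add: grd_def ev3_def coeff3_def)
qed

definition cmp :: "nat \<Rightarrow> poly3 \<Rightarrow> poly3" where "cmp n f = coeff (grd f) n"

lemma coeff3_cmp: "coeff3 (cmp n f) i j k = (if i + j + k = n then coeff3 f i j k else 0)"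
  by (simp add: cmp_def coeff3_coeff_grd)

lemma cmp_Hm: "cmp n f \<in> Hm (int n)"
  by (auto simp: Hm_def coeff3_cmp)

lemma cmp_of_Hm: "f \<in> Hm m \<Longrightarrow> cmp n f = (if int n = m then f else 0)"
  unfolding Hm_def by (intro poly3_eqI) (fastforce simp: coeff3_cmp)

lemma cmp_linear: "cmp n (f + g) = cmp n f + cmp n g" "cmp n 0 = 0" "cmp n (csc t f) = csc t (cmp n f)"
  "cmp n (sum h A) = (\<Sum>a\<in>A. cmp n (h a))" "cmp n (f - g) = cmp n f - cmp n g"
  by (rule poly3_eqI, simp add: coeff3_cmp coeff3_sum)+

text \<open>Homogeneity becomes an identity for the homomorphism \<open>grd\<close>, so products of
  forms are computed with monomials in place of convolutions of coefficients.\<close>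

lemma Hm_iff_grd: "f \<in> Hm (int n) \<longleftrightarrow> grd f = monom f n"
proof
  assume f: "f \<in> Hm (int n)"
  show "grd f = monom f n"
    by (rule poly_eqI) (use cmp_of_Hm[OF f] in \<open>simp add: cmp_def\<close>)
next
  assume "grd f = monom f n"
  then have "f = cmp n f" by (simp add: cmp_def)
  then show "f \<in> Hm (int n)" using cmp_Hm by metis
qed

lemma sum_cmp:
  obtains N where "\<And>M. M \<ge> N \<Longrightarrow> f = (\<Sum>n\<le>M. cmp n f)" "\<And>n. n > N \<Longrightarrow> cmp n f = 0"
proof
  let ?N = "degree (grd f)"
  show 0: "cmp n f = 0" if "n > ?N" for n
    using that by (simp add: cmp_def coeff_eq_0)
  show "f = (\<Sum>n\<le>M. cmp n f)" if "M \<ge> ?N" for M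
  proof (rule poly3_eqI)
    fix i j k
    have "coeff3 f i j k = coeff3 (cmp (i + j + k) f) i j k" by (simp add: coeff3_cmp)
    also have "\<dots> = 0" if "i + j + k > M" using 0 that \<open>M \<ge> ?N\<close> by simp
    finally show "coeff3 f i j k = coeff3 (\<Sum>n\<le>M. cmp n f) i j k"
      by (auto simp: coeff3_sum coeff3_cmp not_le)
  qed
qed

lemma Hm_mult:
  assumes "f \<in> Hm a" "g \<in> Hm b"
  shows "f * g \<in> Hm (a + b)"
proof (cases "a < 0 \<or> b < 0")
  case True
  then have "f * g = 0" using assms Hm_neg by auto
  then show ?thesis using CV.subspace_0[OF subspace_Hm[of "a + b"]] by metis
next
  case False
  then obtain m n where mn: "a = int m" "b = int n" by (metis nat_int_comparison(2) not_less int_nat_eq)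
  then have "grd (f * g) = monom (f * g) (m + n)"
    using assms by (simp add: rhomD[OF rhom_grd] Hm_iff_grd mult_monom)
  then show ?thesis using Hm_iff_grd[of "f * g" "m + n"] mn by simp
qed

lemma cmp_mult:
  assumes "g \<in> Hm (int e)"
  shows "cmp n (f * g) = (if e \<le> n then cmp (n - e) f * g else 0)"
proof -
  have "grd (f * g) = monom g e * grd f"
    using assms by (simp add: rhomD[OF rhom_grd] Hm_iff_grd mult.commute)
  then show ?thesis unfolding cmp_def by (simp add: coeff_monom_mult mult.commute[of g])
qed

lemma Hm_cancel:
  assumes "f * g \<in> Hm a" "g \<in> Hm b" "g \<noteq> 0"
  shows "f \<in> Hm (a - b)"
proof -
  have "b \<ge> 0" using assms Hm_neg[of b] by force
  then obtain e where e: "b = int e" by (metis nonneg_int_cases)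
  have "cmp n f = 0" if "int n \<noteq> a - b" for n
    using cmp_mult[of g e "n + e" f] cmp_of_Hm[OF assms(1), of "n + e"] that assms e by (auto split: if_splits)
  then have "coeff3 f i j k = 0" if "int (i + j + k) \<noteq> a - b" for i j k
    using coeff3_cmp[of "i + j + k" f i j k] that by simp
  then show ?thesis unfolding Hm_def by blast
qed

lemmas Hm_add = CV.subspace_add[OF subspace_Hm]
  and Hm_diff = CV.subspace_diff[OF subspace_Hm]
  and Hm_uminus = CV.subspace_neg[OF subspace_Hm]
  and Hm_0 [simp] = CV.subspace_0[OF subspace_Hm]
  and Hm_csc = CV.subspace_scale[OF subspace_Hm]

lemma clinear_mult: "clinear (\<lambda>f. g * f :: poly3)" "clinear (\<lambda>f. f * g :: poly3)"
  by (auto intro!: clinearI simp: csc_mult_left csc_mult_right algebra_simps)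

subsection \<open>Dimensions of spaces of forms\<close>

text \<open>Prescribing the exponents covers at once all forms of a degree and the forms in y and z
  alone; both dimensions are numbers of exponents.\<close>

definition supp_in :: "(nat \<times> nat \<times> nat) set \<Rightarrow> poly3 set" where
  "supp_in I = {f. \<forall>i j k. coeff3 f i j k \<noteq> 0 \<longrightarrow> (i, j, k) \<in> I}"

definition mono3 :: "nat \<Rightarrow> nat \<Rightarrow> nat \<Rightarrow> poly3" where
  "mono3 i j k = monom (monom (monom 1 i) j) k"

lemma coeff3_mono3: "coeff3 (mono3 i j k) i' j' k' = (if i = i' \<and> j = j' \<and> k = k' then 1 else 0)"
  by (simp add: mono3_def coeff3_def)

lemma clinear_coeff3: "clinear (\<lambda>f. coeff3 f i j k)"
  by (rule clinearI) (simp_all add: csc_complex_def)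

lemma dim_complex: "CV.dim (UNIV :: complex set) = 1"
proof -
  have "CV.span {1 :: complex} = UNIV"
    unfolding CV.span_singleton by (auto simp: csc_complex_def)
  then show ?thesis using CV.dim_eq_card[of "{1 :: complex}" UNIV] by simp
qed

lemma dim_supp_in:
  assumes "finite I"
  shows "fd (supp_in I) \<and> CV.dim (supp_in I) = card I"
  using assms
proof (induction I)
  case empty
  have "supp_in {} = {0}" by (auto simp: supp_in_def intro!: poly3_eqI)
  then show ?case using fd_0 by simp
next
  case (insert a I)
  obtain i j k where a: "a = (i, j, k)" by (metis prod.exhaust)
  have s: "CV.subspace (supp_in I)" for I
    by (auto simp: CV.subspace_def supp_in_def) (metis add.right_neutral)
  let ?m = "mono3 i j k"
  have fs: "fd (CV.span {?m})" unfolding fd_def by (intro conjI exI[of _ "{?m}"]) auto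
  have "supp_in (insert a I) \<subseteq> ssum (supp_in I) (CV.span {?m})"
  proof
    fix f assume f: "f \<in> supp_in (insert a I)"
    let ?c = "csc (coeff3 f i j k) ?m"
    have "f - ?c \<in> supp_in I" using f by (auto simp: supp_in_def a coeff3_mono3 split: if_splits)
    moreover have "?c \<in> CV.span {?m}" by (intro CV.span_scale CV.span_base) simp
    ultimately show "f \<in> ssum (supp_in I) (CV.span {?m})"
      unfolding ssum_def by (metis (mono_tags, lifting) diff_add_cancel mem_Collect_eq)
  qed
  then have f: "fd (supp_in (insert a I))"
    using fd_subset[OF s fd_ssum] insert.IH fs by blast
  have "{f \<in> supp_in (insert a I). coeff3 f i j k = 0} = supp_in I"
    using insert(2) by (auto simp: supp_in_def a)
  moreover have "(\<lambda>f. coeff3 f i j k) ` supp_in (insert a I) = UNIV"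
  proof -
    have "t = coeff3 (csc t ?m) i j k \<and> csc t ?m \<in> supp_in (insert a I)" for t
      by (auto simp: coeff3_mono3 supp_in_def a)
    then show ?thesis by (metis (no_types, lifting) UNIV_eq_I image_eqI)
  qed
  ultimately show ?case
    using f rank_nullity[OF clinear_coeff3 f, of i j k] insert dim_complex by simp
qed

lemma finite_triples: "finite {(i, j, k). i + j + k = (n::nat)}"
  by (rule finite_subset[of _ "{..n} \<times> {..n} \<times> {..n}"]) auto

lemma Hm_supp_in: "Hm (int n) = supp_in {(i, j, k). i + j + k = n}"
  unfolding Hm_def supp_in_def mem_Collect_eq split_conv of_nat_eq_iff ..

lemma fd_Hm: "fd (Hm n)"
proof (cases "n < 0")
  case False
  then show ?thesis using Hm_supp_in[of "nat n"] dim_supp_in[OF finite_triples] by simp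
qed (simp add: Hm_neg fd_0)

text \<open>Doubling avoids division. The formula persists in degrees -1 and -2, where the product
  is 0; the bounds 2e - 2 below rely on reaching -2.\<close>

lemma dim_Hm: "n \<ge> -2 \<Longrightarrow> 2 * dm (Hm n) = (n + 1) * (n + 2)"
proof (cases "n < 0")
  case True
  assume "n \<ge> -2"
  with True have "n = -1 \<or> n = -2" by auto
  then show ?thesis by (auto simp: Hm_neg)
next
  case False
  define m where "m = nat n"
  let ?T = "\<lambda>m. {(i, j, k). i + j + k = (m::nat)}"
  have "2 * card (?T m) = (m + 1) * (m + 2)"
  proof (induction m)
    case 0
    have "?T 0 = {(0, 0, 0)}" by auto
    then show ?case by simp
  next
    case (Suc m)
    have "?T (Suc m) = (\<lambda>(i, j, k). (i, j, Suc k)) ` ?T m \<union> (\<lambda>i. (i, Suc m - i, 0)) ` {..Suc m}"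
      (is "_ = ?A \<union> ?B")
    proof (intro subset_antisym subsetI)
      fix x assume x: "x \<in> ?T (Suc m)"
      obtain i j k where [simp]: "x = (i, j, k)" by (metis prod.exhaust)
      show "x \<in> ?A \<union> ?B"
      proof (cases k)
        case 0
        then show ?thesis using x by (auto simp: image_iff)
      next
        case (Suc l)
        then show ?thesis using x by (force simp: image_iff)
      qed
    qed auto
    moreover have "card ?A = card (?T m)" by (rule card_image) (auto simp: inj_on_def)
    moreover have "card ?B = m + 2" by (subst card_image) (auto simp: inj_on_def)
    moreover have "?A \<inter> ?B = {}" by auto
    ultimately have "card (?T (Suc m)) = card (?T m) + (m + 2)"
      using finite_triples[of m] by (simp add: card_Un_disjoint)
    then show ?case using Suc by (simp add: algebra_simps)
  qed
  then have "int (2 * card (?T m)) = int ((m + 1) * (m + 2))" by presburger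
  then have "2 * dm (Hm (int m)) = (int m + 1) * (int m + 2)"
    using dim_supp_in[OF finite_triples, of m] Hm_supp_in[of m] by (simp add: algebra_simps)
  then show ?thesis using False by (simp add: m_def)
qed

subsection \<open>Restriction to the line \<open>z = 0\<close>\<close>

text \<open>Setting z = 0 is an idempotent endomorphism of \<open>poly3\<close>. Its fixed points
  play the part of C[x,y], which thus needs no type of its own.\<close>

definition rho :: "poly3 \<Rightarrow> poly3" where "rho f = [:coeff f 0:]"

lemma rhom_rho: "rhom rho"
  by (simp add: rhom_def rho_def coeff_mult one_pCons)

lemma coeff3_rho: "coeff3 (rho f) i j k = (if k = 0 then coeff3 f i j 0 else 0)"
  by (simp add: rho_def coeff3_def coeff_pCons split: nat.split)

lemma clinear_rho: "clinear rho"
  by (rule clinearI) (auto intro!: poly3_eqI simp: coeff3_rho)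

lemma rho_rho [simp]: "rho (rho f) = rho f"
  by (simp add: rho_def)

lemma rho_Hm: "f \<in> Hm n \<Longrightarrow> rho f \<in> Hm n"
proof -
  have "coeff3 (rho f) i j k \<noteq> 0 \<Longrightarrow> coeff3 f i j k \<noteq> 0" for i j k
    by (simp add: coeff3_rho split: if_splits)
  then show "f \<in> Hm n \<Longrightarrow> rho f \<in> Hm n" unfolding Hm_def by blast
qed

lemma rho_X [simp]: "rho X = X" and rho_Y [simp]: "rho Y = Y" and rho_Z [simp]: "rho Z = 0"
  by (simp_all add: rho_def xyz_defs)

lemma rho_eq_0_iff: "rho f = 0 \<longleftrightarrow> (\<exists>g. f = Z * g)"
  by (cases f) (auto simp: rho_def Z_def)

lemma XYZ_neq_0 [simp]: "X \<noteq> 0" "Y \<noteq> 0" "Z \<noteq> 0"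
  by (simp_all add: xyz_defs)

lemma rho_eq_0_Hm:
  assumes "f \<in> Hm n" "rho f = 0"
  obtains g where "g \<in> Hm (n - 1)" "f = Z * g"
proof -
  obtain g where g: "f = Z * g" using assms rho_eq_0_iff by blast
  then have "g * Z \<in> Hm n" using assms by (simp add: mult.commute)
  then have "g \<in> Hm (n - 1)" by (rule Hm_cancel[OF _ Z_Hm]) simp
  with g that show ?thesis by blast
qed

definition Rm :: "int \<Rightarrow> poly3 set" where "Rm n = {f \<in> Hm n. rho f = f}"

lemma rho_Rm: "f \<in> Hm n \<Longrightarrow> rho f \<in> Rm n"
  by (simp add: Rm_def rho_Hm)

lemma rho_image_Hm: "rho ` Hm n = Rm n"
  using rho_Rm by (force simp: Rm_def)

lemma subspace_Rm: "CV.subspace (Rm n)"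
  using clinear_subspace_image[OF clinear_rho subspace_Hm] rho_image_Hm by metis

lemma fd_Rm: "fd (Rm n)"
  using fd_image[OF clinear_rho fd_Hm] rho_image_Hm by metis

lemma Rm_Hm: "f \<in> Rm n \<Longrightarrow> f \<in> Hm n" and Rm_rho: "f \<in> Rm n \<Longrightarrow> rho f = f"
  by (auto simp: Rm_def)

lemma rho_ker: "{f \<in> Hm n. rho f = 0} = (*) Z ` Hm (n - 1)"
proof (intro subset_antisym subsetI)
  fix f assume f: "f \<in> (*) Z ` Hm (n - 1)"
  then obtain g where "f = Z * g" "g \<in> Hm (n - 1)" by blast
  then show "f \<in> {f \<in> Hm n. rho f = 0}"
    using Hm_mult[OF Z_Hm, of g "n - 1"] by (simp add: rhomD[OF rhom_rho])
qed (auto elim: rho_eq_0_Hm)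

lemma dim_mult_image: "g \<noteq> 0 \<Longrightarrow> fd V \<Longrightarrow> dm ((*) g ` V) = dm (V :: poly3 set)"
  by (rule dim_inj_image[OF clinear_mult(1)]) auto

lemma dim_Rm: "n \<ge> -1 \<Longrightarrow> dm (Rm n) = n + 1"
  using rank_nullity[OF clinear_rho fd_Hm, of n] dim_mult_image[of Z, OF _ fd_Hm, of "n - 1"]
    dim_Hm[of n] dim_Hm[of "n - 1"]
  by (simp add: rho_ker rho_image_Hm algebra_simps)

section \<open>Complete intersections\<close>

lemma unit_Hm_0: "is_unit (f :: poly3) \<Longrightarrow> f \<in> Hm 0"
  using C3_Hm by (auto simp: is_unit_poly_iff C3_def)

lemma Hm_disjoint: "f \<in> Hm a \<Longrightarrow> f \<in> Hm b \<Longrightarrow> a \<noteq> b \<Longrightarrow> f = 0"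
  by (rule poly3_eqI) (auto simp: Hm_def)

lemma unit_not_Hm: "f \<in> Hm e \<Longrightarrow> e \<ge> 1 \<Longrightarrow> \<not> is_unit f"
  using Hm_disjoint[of f e 0] unit_Hm_0[of f] by auto

text \<open>In a factorial domain coprime elements form a regular sequence: every relation is a
  multiple of the Koszul relation.\<close>

lemma coprime_relation:
  fixes p q :: poly3
  assumes "coprime p q" "q \<noteq> 0" "a * p + b * q = 0"
  obtains c where "a = c * q" "b = - (c * p)"
proof -
  have "q dvd a * p" using assms(3) by (metis dvd_add_times_triv_right_iff dvd_0_right)
  then have "q dvd a"
    using coprime_dvd_mult_left_iff[of q p a] assms(1) by (simp add: coprime_commute)
  then obtain c where c: "a = c * q" by (metis dvd_div_mult_self)
  have "q * (c * p + b) = 0" using assms(3) c by (simp add: algebra_simps)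
  then have "b = - (c * p)" using assms(2) by (simp add: add_eq_0_iff)
  with c that show ?thesis by blast
qed

text \<open>\<open>V\<close> is the family of graded pieces of the ambient ring: \<open>Hm\<close>, or its subring \<open>Rm\<close> of forms
  in \<open>x, y\<close>.\<close>

definition ci :: "(int \<Rightarrow> poly3 set) \<Rightarrow> int \<Rightarrow> poly3 \<Rightarrow> poly3 \<Rightarrow> int \<Rightarrow> poly3 set" where
  "ci V e p q k = {a * p + b * q | a b. a \<in> V (k - e) \<and> b \<in> V (k - e)}"

lemma ci_image: "ci V e p q k = (\<lambda>x. fst x * p + snd x * q) ` (V (k - e) \<times> V (k - e))"
  unfolding ci_def by force

lemma clinear_comb2: "clinear (\<lambda>x. fst x * p + snd x * q :: poly3)"
  by (intro clinear_add clinear_compose[OF clinear_mult(2)] clinear_pairs)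

lemma fd_ci: "fd (V (k - e)) \<Longrightarrow> fd (ci V e p q k)"
  unfolding ci_image by (intro fd_image clinear_comb2 fd_Times)

text \<open>Koszul exactness: the pairs \<open>(c * q, - (c * p))\<close> form the kernel of the map
  from two copies of \<open>V (k - e)\<close> onto the ideal. \<open>mult\<close> and
  \<open>canc\<close> are what \<open>Hm\<close> and \<open>Rm\<close> have in common.\<close>

lemma dim_ci:
  assumes fd: "\<And>n. fd (V n)" and cop: "coprime p q" and nz: "p \<noteq> 0" "q \<noteq> 0"
    and mult: "\<And>n c. c \<in> V n \<Longrightarrow> c * p \<in> V (n + e) \<and> c * q \<in> V (n + e)"
    and canc: "\<And>n c. c * q \<in> V n \<Longrightarrow> c \<in> V (n - e)"
  shows "dm {x \<in> V n \<times> V n. fst x * p + snd x * q = 0} = dm (V (n - e))"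
    and "dm (ci V e p q k) = 2 * dm (V (k - e)) - dm (V (k - 2 * e))"
proof -
  have ker: "{x \<in> V n \<times> V n. fst x * p + snd x * q = 0} = (\<lambda>c. (c * q, - (c * p))) ` V (n - e)" for n
  proof (intro subset_antisym subsetI)
    fix x assume x: "x \<in> {x \<in> V n \<times> V n. fst x * p + snd x * q = 0}"
    then have "fst x * p + snd x * q = 0" by simp
    then obtain c where c: "fst x = c * q" "snd x = - (c * p)"
      by (rule coprime_relation[OF cop nz(2)])
    then have "c \<in> V (n - e)" using canc[of c n] x by auto
    then show "x \<in> (\<lambda>c. (c * q, - (c * p))) ` V (n - e)" using c by (intro image_eqI[of _ _ c]) (simp_all add: prod_eq_iff)
  next
    fix x assume "x \<in> (\<lambda>c. (c * q, - (c * p))) ` V (n - e)"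
    then obtain c where c: "c \<in> V (n - e)" "x = (c * q, - (c * p))" by blast
    have "- (c * p) \<in> V n" "c * q \<in> V n"
      using mult[OF c(1)] CV.subspace_neg[OF fd_subspace[OF fd]] by simp_all
    then show "x \<in> {x \<in> V n \<times> V n. fst x * p + snd x * q = 0}" using c by (simp add: algebra_simps)
  qed
  have cl: "clinear (\<lambda>c. (c * q, - (c * p)))"
    by (rule clinearI) (simp_all add: csc_prod_def csc_mult_left distrib_right)
  have d: "dm ((\<lambda>c. (c * q, - (c * p))) ` V (n - e)) = dm (V (n - e))" for n
    by (rule dim_inj_image[OF cl fd]) (use nz in \<open>auto simp: zero_prod_def\<close>)
  show "dm {x \<in> V n \<times> V n. fst x * p + snd x * q = 0} = dm (V (n - e))"
    using ker d by simp
  have "k - e - e = k - 2 * e" by simp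
  then show "dm (ci V e p q k) = 2 * dm (V (k - e)) - dm (V (k - 2 * e))"
    using rank_nullity[OF clinear_comb2[of p q] fd_Times[OF fd fd], of "k - e" "k - e"] dim_Times[OF fd fd, of "k - e" "k - e"]
      ker[of "k - e"] d[of "k - e"] by (simp add: ci_image)
qed

lemma Rm_mult: "f \<in> Rm a \<Longrightarrow> g \<in> Rm b \<Longrightarrow> f * g \<in> Rm (a + b)"
  by (simp add: Rm_def Hm_mult rhomD[OF rhom_rho])

lemma Rm_cancel:
  assumes "f * g \<in> Rm a" "g \<in> Rm b" "g \<noteq> 0"
  shows "f \<in> Rm (a - b)"
proof -
  have "rho f * g = f * g" using assms by (simp add: Rm_def rhomD[OF rhom_rho])
  then show ?thesis using assms Hm_cancel[of f g a b] by (simp add: Rm_def)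
qed

lemma X_Rm: "X \<in> Rm 1" and Y_Rm: "Y \<in> Rm 1"
  by (simp_all add: Rm_def X_Hm Y_Hm)

lemma X_dvdI:
  assumes "\<And>j k. coeff3 a 0 j k = 0"
  obtains a' where "a = X * a'"
proof
  show "a = X * map_poly (map_poly (poly_shift 1)) a"
    by (rule poly3_eqI)
      (auto simp: coeff3_X assms split: nat.split, simp add: coeff3_def coeff_map_poly coeff_poly_shift)
qed

text \<open>\<open>X, Y\<close> is a regular sequence. Applied entrywise, this also describes the
  intersection of x V and y V for spaces of triples and tuples.\<close>

lemma XY_relation:
  assumes "Y * a = X * c"
  obtains w where "a = X * w" "c = Y * w"
proof -
  have "coeff3 a 0 j k = 0" for j k
    using arg_cong[OF assms, of "\<lambda>f. coeff3 f 0 (Suc j) k"] by (simp add: coeff3_X coeff3_Y)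
  then obtain w where w: "a = X * w" by (rule X_dvdI)
  then have "X * (Y * w) = X * c" using assms by (simp add: ac_simps)
  then have "c = Y * w" by simp
  with w that show ?thesis by blast
qed

text \<open>\<open>cop_rho\<close> says that P and Q have no common zero on the line z = 0. Hence P,
  Q, z is a regular sequence and the restricted pair has a finite-dimensional quotient of
  C[x,y].\<close>

locale plane_ci =
  fixes e :: int and P Q :: poly3
  assumes e: "e \<ge> 1" and PQ: "P \<in> Hm e" "Q \<in> Hm e"
    and cop: "coprime P Q" and cop_rho: "coprime (rho P) (rho Q)"
begin

abbreviation "p \<equiv> rho P"
abbreviation "q \<equiv> rho Q"
abbreviation "I \<equiv> ci Hm e P Q"
abbreviation "I\<^sub>0 \<equiv> ci Rm e p q"

lemma pq: "p \<in> Rm e" "q \<in> Rm e"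
  by (simp_all add: rho_Rm PQ)

lemma nz: "p \<noteq> 0" "q \<noteq> 0" "P \<noteq> 0" "Q \<noteq> 0"
proof -
  show "p \<noteq> 0" using cop_rho unit_not_Hm[OF Rm_Hm[OF pq(2)] e] by auto
  show "q \<noteq> 0" using cop_rho unit_not_Hm[OF Rm_Hm[OF pq(1)] e] by auto
  then show "P \<noteq> 0" "Q \<noteq> 0" using \<open>p \<noteq> 0\<close> by (auto simp: rhomD[OF rhom_rho])
qed

lemma fd_I: "fd (I k)" and fd_I0: "fd (I\<^sub>0 k)"
  by (simp_all add: fd_ci fd_Hm fd_Rm)

lemmas sub_I = fd_subspace[OF fd_I] and sub_I0 = fd_subspace[OF fd_I0]

lemma dim_I0: "dm (I\<^sub>0 k) = 2 * dm (Rm (k - e)) - dm (Rm (k - 2 * e))"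
  by (rule dim_ci(2)[OF fd_Rm cop_rho nz(1,2)]) (use Rm_mult pq Rm_cancel[OF _ pq(2) nz(2)] in auto)

lemma dim_I: "dm (I k) = 2 * dm (Hm (k - e)) - dm (Hm (k - 2 * e))"
  and dim_koszul: "dm {x \<in> Hm n \<times> Hm n. fst x * P + snd x * Q = 0} = dm (Hm (n - e))"
  by (rule dim_ci[OF fd_Hm cop nz(3,4)]; use Hm_mult PQ Hm_cancel[OF _ PQ(2) nz(4)] in auto)+

lemma I_Hm: "u \<in> I k \<Longrightarrow> u \<in> Hm k"
  using Hm_mult[OF _ PQ(1), of _ "k - e"] Hm_mult[OF _ PQ(2), of _ "k - e"] Hm_add by (auto simp: ci_def)

lemma I0_Rm: "u \<in> I\<^sub>0 k \<Longrightarrow> u \<in> Rm k"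
  using Rm_mult[OF _ pq(1), of _ "k - e"] Rm_mult[OF _ pq(2), of _ "k - e"] CV.subspace_add[OF subspace_Rm]
  by (auto simp: ci_def)

lemma I_mult: "u \<in> I k \<Longrightarrow> v \<in> Hm l \<Longrightarrow> u * v \<in> I (k + l)"
proof -
  assume u: "u \<in> I k" and v: "v \<in> Hm l"
  then obtain a b where ab: "u = a * P + b * Q" "a \<in> Hm (k - e)" "b \<in> Hm (k - e)" by (auto simp: ci_def)
  then have "a * v \<in> Hm (k + l - e)" "b * v \<in> Hm (k + l - e)"
    using Hm_mult[OF _ v, of _ "k - e"] by (simp_all add: algebra_simps)
  moreover have "u * v = a * v * P + b * v * Q" using ab by (simp add: algebra_simps)
  ultimately show ?thesis unfolding ci_def by blast
qed

lemma rho_I: "u \<in> I k \<Longrightarrow> rho u \<in> I\<^sub>0 k"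
  unfolding ci_def using rho_Rm by (fastforce simp: rhomD[OF rhom_rho])

section \<open>Duality on the line z = 0\<close>

lemma Rm_eq_I0:
  assumes "k \<ge> 2 * e - 1"
  shows "Rm k = I\<^sub>0 k"
proof -
  have "dm (Rm k) = dm (I\<^sub>0 k)" using dim_I0[of k] e assms by (simp add: dim_Rm)
  then show ?thesis using fd_dim_eq[OF fd_Rm sub_I0, of k k] I0_Rm by auto
qed

text \<open>The linear formula for the dimension of \<open>Rm (k - 2 * e)\<close> would give -1
  here, but the space is zero. The missing unit is the one-dimensional socle of
  C[x,y]/(p,q).\<close>

lemma dim_I0_top: "dm (I\<^sub>0 (2 * e - 2)) = 2 * e - 2"
proof -
  have "Rm (- 2) = {0}" by (auto simp: Rm_def Hm_neg rhomD[OF rhom_rho])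
  then show ?thesis using dim_I0[of "2 * e - 2"] e by (simp add: dim_Rm)
qed

text \<open>Writing \<open>Y * (X * u)\<close> in two ways gives a Koszul relation whose multiplier
  \<open>w\<close> has degree i + 2 - 2e, negative below the socle degree. So \<open>w\<close>
  vanishes and x cancels from both coefficients.\<close>

lemma socle:
  assumes u: "u \<in> Rm i" "i < 2 * e - 2" and XY: "X * u \<in> I\<^sub>0 (i + 1)" "Y * u \<in> I\<^sub>0 (i + 1)"
  shows "u \<in> I\<^sub>0 i"
proof -
  obtain a b where ab: "X * u = a * p + b * q" "a \<in> Rm (i + 1 - e)" "b \<in> Rm (i + 1 - e)"
    using XY(1) by (auto simp: ci_def)
  obtain c d where cd: "Y * u = c * p + d * q" "c \<in> Rm (i + 1 - e)" "d \<in> Rm (i + 1 - e)"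
    using XY(2) by (auto simp: ci_def)
  have "Y * (X * u) = X * (Y * u)" by (simp add: ac_simps)
  then have "(Y * a - X * c) * p + (Y * b - X * d) * q = 0"
    unfolding ab(1) cd(1) by (simp add: algebra_simps)
  then obtain w where w: "Y * a - X * c = w * q" "Y * b - X * d = - (w * p)"
    by (rule coprime_relation[OF cop_rho nz(2)])
  have "Y * a - X * c \<in> Rm (i + 2 - e)"
    using Rm_mult[OF Y_Rm ab(2)] Rm_mult[OF X_Rm cd(2)]
    by (intro CV.subspace_diff[OF subspace_Rm]) (simp_all add: algebra_simps)
  then have "w \<in> Rm (i + 2 - e - e)" using Rm_cancel[OF _ pq(2) nz(2)] w(1) by metis
  then have "w = 0" using u(2) Hm_neg[of "i + 2 - e - e"] by (auto simp: Rm_def)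
  with w have "Y * a = X * c" "Y * b = X * d" by simp_all
  then obtain a' b' where a': "a = X * a'" and b': "b = X * b'"
    by (metis XY_relation)
  have "a' \<in> Rm (i - e)" "b' \<in> Rm (i - e)"
    using Rm_cancel[OF _ X_Rm, of a' "i + 1 - e"] Rm_cancel[OF _ X_Rm, of b' "i + 1 - e"] ab(2,3) a' b'
    by (simp_all add: mult.commute)
  moreover have "X * u = X * (a' * p + b' * q)" using ab(1) a' b' by (simp add: algebra_simps)
  then have "u = a' * p + b' * q" by simp
  ultimately show ?thesis unfolding ci_def by blast
qed

text \<open>By \<open>socle\<close>, a nonzero class below degree 2e - 2 stays nonzero after
  multiplication by x or by y. Repeating this collects a multiplier that carries it into the
  socle.\<close>

lemma gorenstein:
  assumes "u \<in> Rm i" "u \<notin> I\<^sub>0 i"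
  shows "i \<le> 2 * e - 2 \<and> (\<exists>v \<in> Rm (2 * e - 2 - i). u * v \<notin> I\<^sub>0 (2 * e - 2))"
  using assms
proof (induction "nat (2 * e - 2 - i)" arbitrary: u i)
  case 0
  then have "i = 2 * e - 2" using Rm_eq_I0[of i] by fastforce
  moreover have "1 \<in> Rm 0"
    using C3_Hm[of 1] by (simp add: Rm_def rhomD[OF rhom_rho] C3_def flip: one_pCons)
  ultimately show ?case using 0 by (intro conjI bexI[of _ 1]) auto
next
  case (Suc n)
  then have i: "i < 2 * e - 2" "n = nat (2 * e - 2 - (i + 1))" by linarith+
  from socle[OF Suc(3) i(1)] Suc(4) have "X * u \<notin> I\<^sub>0 (i + 1) \<or> Y * u \<notin> I\<^sub>0 (i + 1)" by blast
  then obtain t where t: "t \<in> Rm 1" "t * u \<notin> I\<^sub>0 (i + 1)" using X_Rm Y_Rm by blast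
  have "t * u \<in> Rm (i + 1)" using Rm_mult[OF t(1) Suc(3)] by (simp add: add.commute)
  from Suc(1)[OF i(2) this t(2)] obtain v where v: "v \<in> Rm (2 * e - 2 - (i + 1))"
    "t * u * v \<notin> I\<^sub>0 (2 * e - 2)" by blast
  have "1 + (2 * e - 2 - (i + 1)) = 2 * e - 2 - i" by simp
  with Rm_mult[OF t(1) v(1)] have "t * v \<in> Rm (2 * e - 2 - i)" by metis
  moreover have "u * (t * v) \<notin> I\<^sub>0 (2 * e - 2)" using v(2) by (simp add: ac_simps)
  ultimately show ?case using i by auto
qed

text \<open>z is a non-zero-divisor modulo (P,Q). On the line the coefficients are a multiple of the
  Koszul relation of p, q; subtracting the same multiple of that of P, Q leaves coefficients
  divisible by z.\<close>

lemma I_cancel_Z: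
  assumes "Z * u \<in> I (k + 1)"
  shows "u \<in> I k"
proof -
  obtain a b where ab: "Z * u = a * P + b * Q" "a \<in> Hm (k + 1 - e)" "b \<in> Hm (k + 1 - e)"
    using assms by (auto simp: ci_def)
  have "rho a * p + rho b * q = rho (Z * u)"
    unfolding ab(1) by (simp add: rhomD[OF rhom_rho])
  then have "rho a * p + rho b * q = 0" by (simp add: rhomD[OF rhom_rho])
  then obtain c where c: "rho a = c * q" "rho b = - (c * p)"
    by (rule coprime_relation[OF cop_rho nz(2)])
  have cR: "c \<in> Rm (k + 1 - e - e)"
    using Rm_cancel[OF _ pq(2) nz(2), of c "k + 1 - e"] rho_Rm[OF ab(2)] c(1) by simp
  have "rho (a - c * Q) = 0" "rho (b + c * P) = 0"
    using c Rm_rho[OF cR] by (simp_all add: rhomD[OF rhom_rho])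
  moreover have "a - c * Q \<in> Hm (k + 1 - e)" "b + c * P \<in> Hm (k + 1 - e)"
    using Hm_mult[OF Rm_Hm[OF cR] PQ(1)] Hm_mult[OF Rm_Hm[OF cR] PQ(2)] ab(2,3)
    by (auto intro: Hm_diff Hm_add)
  ultimately obtain a' b' where a': "a' \<in> Hm (k + 1 - e - 1)" "a - c * Q = Z * a'"
    and b': "b' \<in> Hm (k + 1 - e - 1)" "b + c * P = Z * b'"
    by (metis rho_eq_0_Hm)
  have "Z * u = (a - c * Q) * P + (b + c * P) * Q" using ab(1) by (simp add: algebra_simps)
  also have "\<dots> = Z * (a' * P + b' * Q)" unfolding a'(2) b'(2) by (simp add: algebra_simps)
  finally have "u = a' * P + b' * Q" by simp
  moreover have "k + 1 - e - 1 = k - e" by simp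
  ultimately show ?thesis using a'(1) b'(1) unfolding ci_def by auto
qed

lemma I_cancel_Z_power: "Z ^ n * u \<in> I (k + int n) \<Longrightarrow> u \<in> I k"
proof (induction n)
  case (Suc n)
  then have "Z * (Z ^ n * u) \<in> I (k + int n + 1)" by (simp add: algebra_simps)
  then show ?case using I_cancel_Z Suc by blast
qed simp

lemma Z_power_Hm: "Z ^ n \<in> Hm (int n)"
proof (induction n)
  case (Suc n)
  show ?case using Hm_mult[OF Z_Hm Suc] by (simp add: add.commute)
qed (use C3_Hm[of 1] in \<open>simp add: C3_def flip: one_pCons\<close>)

lemma lift_I0:
  assumes "u \<in> Hm k" "rho u \<in> I\<^sub>0 k"
  obtains w u' where "w \<in> I k" "u' \<in> Hm (k - 1)" "u = w + Z * u'"
proof -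
  obtain a b where ab: "rho u = a * p + b * q" "a \<in> Rm (k - e)" "b \<in> Rm (k - e)"
    using assms(2) by (auto simp: ci_def)
  let ?w = "a * P + b * Q"
  have w: "?w \<in> I k" using ab(2,3) Rm_Hm unfolding ci_def by blast
  have "rho (u - ?w) = 0" using ab by (simp add: rhomD[OF rhom_rho] Rm_rho)
  moreover have "u - ?w \<in> Hm k" using assms(1) I_Hm[OF w] by (rule Hm_diff)
  ultimately obtain u' where "u' \<in> Hm (k - 1)" "u - ?w = Z * u'" by (metis rho_eq_0_Hm)
  then show ?thesis using that[OF w] by (simp add: algebra_simps)
qed

text \<open>Factors z are split off the class of \<open>u\<close> while its restriction to the line
  lies in (p,q). The degree drops each time, so this stops.\<close>

lemma Z_adic_order:
  assumes "u \<in> Hm j" "u \<notin> I j"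
  obtains a u' where "u' \<in> Hm (j - int a)" "rho u' \<notin> I\<^sub>0 (j - int a)" "u - Z ^ a * u' \<in> I j"
proof -
  have "\<exists>a u'. u' \<in> Hm (j - int a) \<and> rho u' \<notin> I\<^sub>0 (j - int a) \<and> u - Z ^ a * u' \<in> I j"
    using assms
  proof (induction "nat (j + 1)" arbitrary: u j)
    case 0
    then have "u = 0" using Hm_neg[of j] by auto
    then show ?case using 0 CV.subspace_0[OF sub_I[of j]] by simp
  next
    case (Suc n)
    show ?case
    proof (cases "rho u \<in> I\<^sub>0 j")
      case True
      then obtain w u1 where w: "w \<in> I j" "u1 \<in> Hm (j - 1)" "u = w + Z * u1"
        using lift_I0[OF Suc(3)] by blast
      have "u1 \<notin> I (j - 1)"
      proof
        assume "u1 \<in> I (j - 1)"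
        from I_mult[OF this Z_Hm] have "Z * u1 \<in> I j" by (simp add: mult.commute)
        then have "u \<in> I j" using w CV.subspace_add[OF sub_I] by blast
        then show False using Suc by blast
      qed
      from Suc(1)[OF _ w(2) this] Suc(2) obtain a u' where a: "u' \<in> Hm (j - 1 - int a)"
        "rho u' \<notin> I\<^sub>0 (j - 1 - int a)" "u1 - Z ^ a * u' \<in> I (j - 1)" by force
      have "(u1 - Z ^ a * u') * Z \<in> I (j - 1 + 1)" by (rule I_mult[OF a(3) Z_Hm])
      then have "w + (u1 - Z ^ a * u') * Z \<in> I j" using w(1) CV.subspace_add[OF sub_I[of j]] by simp
      moreover have "u - Z ^ Suc a * u' = w + (u1 - Z ^ a * u') * Z" using w(3) by (simp add: algebra_simps)
      moreover have "j - 1 - int a = j - int (Suc a)" by simp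
      ultimately show ?thesis using a(1,2) by metis
    next
      case False
      then show ?thesis using Suc(3) CV.subspace_0[OF sub_I] by (intro exI[of _ 0] exI[of _ u]) simp
    qed
  qed
  then show ?thesis using that by blast
qed

text \<open>A residue functional: in degree \<open>2e - 2\<close> the ideal \<open>(P,Q,z)\<close> has codimension one, and
  multiplication by \<open>z\<close> transports this to all higher degrees.\<close>

lemma residue_functional:
  obtains \<phi> :: "poly3 \<Rightarrow> complex" where "clinear \<phi>"
    "\<And>u. u \<in> I (2 * e - 2 + int n) \<Longrightarrow> \<phi> u = 0"
    "\<And>w. w \<in> Hm (2 * e - 2) \<Longrightarrow> rho w \<notin> I\<^sub>0 (2 * e - 2) \<Longrightarrow> \<phi> (Z ^ n * w) \<noteq> 0"
proof -
  let ?t = "2 * e - 2"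
  let ?D = "?t + int n"
  have "I\<^sub>0 ?t \<noteq> Rm ?t" using dim_I0_top dim_Rm[of ?t] e by auto
  then obtain w0 where w0: "w0 \<in> Rm ?t" "w0 \<notin> I\<^sub>0 ?t" using I0_Rm by blast
  have fs: "fd (CV.span {w0})" unfolding fd_def by (intro conjI exI[of _ "{w0}"]) auto
  let ?U = "ssum (I\<^sub>0 ?t) (CV.span {w0})"
  have U: "?U = Rm ?t"
  proof (rule fd_dim_eq[OF fd_Rm])
    show sU: "CV.subspace ?U" by (rule fd_subspace[OF fd_ssum[OF fd_I0 fs]])
    show sub: "?U \<subseteq> Rm ?t"
      using CV.span_minimal[OF _ subspace_Rm, of "{w0}"] w0 I0_Rm CV.subspace_add[OF subspace_Rm]
      unfolding ssum_def by blast
    have "\<not> CV.dim ?U \<le> CV.dim (I\<^sub>0 ?t)"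
    proof
      assume "CV.dim ?U \<le> CV.dim (I\<^sub>0 ?t)"
      then have "I\<^sub>0 ?t = ?U"
        using fd_dim_eq[OF fd_ssum[OF fd_I0 fs] sub_I0] ssum_superset[OF fd_I0 fs] by blast
      then show False using w0 ssum_superset[OF fd_I0[of ?t] fs] CV.span_base[of w0 "{w0}"] by blast
    qed
    then show "CV.dim (Rm ?t) \<le> CV.dim ?U" using dim_I0_top dim_Rm[of ?t] e by simp
  qed
  \<comment> \<open>Besides the ideal, the functional has to kill what is divisible by one more
    power of z. Then its value at \<open>Z ^ n * w\<close> depends only on the class of
    \<open>rho w\<close>, and \<open>w0\<close> represents the surviving line.\<close>
  let ?W = "ssum (I ?D) ((*) (Z ^ Suc n) ` Hm (?t - 1))"
  have sW: "CV.subspace ?W"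
    by (intro fd_subspace fd_ssum fd_I fd_image clinear_mult fd_Hm)
  have IW: "I ?D \<subseteq> ?W"
    using ssum_superset[OF fd_I fd_image[OF clinear_mult(1) fd_Hm]] by blast
  have zW: "Z ^ Suc n * s \<in> ?W" if "s \<in> Hm (?t - 1)" for s
    using ssum_superset[OF fd_I[of ?D] fd_image[OF clinear_mult(1) fd_Hm], of "Z ^ Suc n" "?t - 1"] that by blast
  have claim1: "rho w \<in> I\<^sub>0 ?t" if w: "w \<in> Hm ?t" "Z ^ n * w \<in> ?W" for w
  proof -
    obtain i s where s: "Z ^ n * w = i + Z ^ Suc n * s" "i \<in> I ?D" "s \<in> Hm (?t - 1)"
      using w(2) by (auto simp: ssum_def)
    have "Z ^ n * (w - Z * s) \<in> I ?D" using s(1,2) by (simp add: algebra_simps)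
    then have "w - Z * s \<in> I ?t" by (rule I_cancel_Z_power)
    from rho_I[OF this] show ?thesis by (simp add: rhomD[OF rhom_rho])
  qed
  have claim2: "\<exists>t. Z ^ n * w - csc t (Z ^ n * w0) \<in> ?W" if w: "w \<in> Hm ?t" for w
  proof -
    have "rho w \<in> ?U" using U rho_Rm[OF w] by simp
    then obtain i t where it: "i \<in> I\<^sub>0 ?t" "rho w = i + csc t w0"
      unfolding ssum_def CV.span_singleton by auto
    have "rho (w - csc t w0) = i" using it w0(1) by (simp add: clinearD[OF clinear_rho] Rm_rho)
    moreover have "w - csc t w0 \<in> Hm ?t" using w w0(1) Rm_Hm Hm_diff Hm_csc by blast
    ultimately obtain v u' where v: "v \<in> I ?t" "u' \<in> Hm (?t - 1)" "w - csc t w0 = v + Z * u'"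
      using it(1) by (metis lift_I0)
    have "Z ^ n * w - csc t (Z ^ n * w0) = Z ^ n * (w - csc t w0)"
      by (simp add: right_diff_distrib csc_mult_right)
    also have "\<dots> = v * Z ^ n + Z ^ Suc n * u'" unfolding v(3) by (simp add: algebra_simps)
    finally have eq: "Z ^ n * w - csc t (Z ^ n * w0) = v * Z ^ n + Z ^ Suc n * u'" .
    have "v * Z ^ n \<in> ?W" using I_mult[OF v(1) Z_power_Hm, of n] IW by blast
    then show ?thesis unfolding eq[symmetric]
      using CV.subspace_add[OF sW _ zW[OF v(2)]] eq by (intro exI[of _ t]) simp
  qed
  have "Z ^ n * w0 \<notin> ?W" using claim1[of w0] w0 by (auto simp: Rm_Hm Rm_rho)
  from exists_functional[OF sW this] obtain \<phi> :: "poly3 \<Rightarrow> complex" where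
    \<phi>: "clinear \<phi>" "\<phi> (Z ^ n * w0) = 1" "\<And>w. w \<in> ?W \<Longrightarrow> \<phi> w = 0" by blast
  show ?thesis
  proof (rule that[OF \<phi>(1)])
    show "\<phi> u = 0" if "u \<in> I ?D" for u using \<phi>(3) IW that by blast
    show "\<phi> (Z ^ n * w) \<noteq> 0" if w: "w \<in> Hm ?t" "rho w \<notin> I\<^sub>0 ?t" for w
    proof
      assume 0: "\<phi> (Z ^ n * w) = 0"
      obtain t where t: "Z ^ n * w - csc t (Z ^ n * w0) \<in> ?W" using claim2[OF w(1)] by blast
      from \<phi>(3)[OF t] have "t = 0" using 0 \<phi>(2) by (simp add: clinearD[OF \<phi>(1)] csc_complex_def)
      then have "Z ^ n * w \<in> ?W" using t by simp
      then show False using claim1 w by blast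
    qed
  qed
qed

end

section \<open>Syzygies of three forms\<close>

definition lc :: "triple \<Rightarrow> triple \<Rightarrow> poly3" where
  "lc g v = fst v * fst g + fst (snd v) * fst (snd g) + snd (snd v) * snd (snd g)"

lemma clinear_lc: "clinear (lc g)"
  unfolding lc_def
  by (intro clinear_add clinear_compose[OF clinear_mult(2)] clinear_compose[OF clinear_pairs(3)]
      clinear_compose[OF clinear_pairs(4)] clinear_pairs)

definition H3 :: "int \<Rightarrow> triple set" where "H3 n = Hm n \<times> Hm n \<times> Hm n"

lemma fd_H3: "fd (H3 n)"
  unfolding H3_def by (intro fd_Times fd_Hm)

lemma dim_H3: "dm (H3 n) = 3 * dm (Hm n)"
  unfolding H3_def by (simp add: dim_Times fd_Times fd_Hm)

definition syz :: "triple \<Rightarrow> int \<Rightarrow> triple set" where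
  "syz g n = {v \<in> H3 n. lc g v = 0}"

lemma fd_syz: "fd (syz g n)"
  unfolding syz_def by (rule fd_subset[OF subspace_ker[OF clinear_lc fd_subspace[OF fd_H3]] fd_H3]) auto

lemmas sub_syz = fd_subspace[OF fd_syz]

lemma syz_neg: "i < 0 \<Longrightarrow> syz g i = {0}"
  by (auto simp: syz_def H3_def Hm_neg lc_def zero_prod_def)

definition jac :: "triple \<Rightarrow> int \<Rightarrow> int \<Rightarrow> poly3 set" where
  "jac g e k = lc g ` H3 (k - e)"

definition adim :: "triple \<Rightarrow> int \<Rightarrow> int \<Rightarrow> int" where
  "adim g e k = dm (Hm k) - dm (jac g e k)"

lemma fd_jac: "fd (jac g e k)"
  unfolding jac_def by (intro fd_image clinear_lc fd_H3)

lemmas sub_jac = fd_subspace[OF fd_jac]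

text \<open>Dimensions of syzygy spaces determine the Hilbert function of S/J; hence coordinate
  changes only have to keep track of syzygies.\<close>

lemma adim_syz: "adim g e k = dm (Hm k) - 3 * dm (Hm (k - e)) + dm (syz g (k - e))"
  using rank_nullity[OF clinear_lc[of g] fd_H3[of "k - e"]] by (simp add: adim_def jac_def syz_def dim_H3)

lemma scale3_eq: "scale3 s v = (s * fst v, s * fst (snd v), s * snd (snd v))"
  by (cases v) (auto simp: scale3_def)

lemma lc_scale3: "lc g (scale3 s v) = s * lc g v"
  by (simp add: lc_def scale3_eq algebra_simps)

lemma H3_scale3: "s \<in> Hm a \<Longrightarrow> v \<in> H3 b \<Longrightarrow> scale3 s v \<in> H3 (a + b)"
  by (simp add: H3_def scale3_eq mem_Times_iff Hm_mult)

lemma syz_scale3: "s \<in> Hm a \<Longrightarrow> v \<in> syz g b \<Longrightarrow> scale3 s v \<in> syz g (a + b)"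
  by (simp add: syz_def H3_scale3 lc_scale3)

lemma clinear_scale3: "clinear (scale3 s)"
  by (rule clinearI) (simp_all add: scale3_eq csc_prod_def csc_mult_right algebra_simps)

lemma scale3_eq_0: "scale3 s v = 0 \<longleftrightarrow> s = 0 \<or> v = 0"
  by (auto simp: scale3_eq prod_eq_iff)

lemma dim_scale3: "s \<noteq> 0 \<Longrightarrow> fd V \<Longrightarrow> dm (scale3 s ` V) = dm V"
  by (rule dim_inj_image[OF clinear_scale3]) (auto simp: scale3_eq_0)

definition rho3 :: "triple \<Rightarrow> triple" where
  "rho3 v = (rho (fst v), rho (fst (snd v)), rho (snd (snd v)))"

lemma clinear_rho3: "clinear rho3"
  by (rule clinearI) (simp_all add: rho3_def csc_prod_def clinearD[OF clinear_rho])

lemma rho3_scale3: "rho3 (scale3 s v) = scale3 (rho s) (rho3 v)"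
  by (simp add: rho3_def scale3_eq rhomD[OF rhom_rho])

lemma rho_lc: "rho (lc g v) = lc (rho3 g) (rho3 v)"
  by (simp add: lc_def rho3_def rhomD[OF rhom_rho])

text \<open>A syzygy vanishing on z = 0 is divisible by z entrywise, and the quotient is again a
  syzygy because S is a domain. This holds in any coordinates.\<close>

lemma ker_rho3: "{v \<in> syz g n. rho3 v = 0} = scale3 Z ` syz g (n - 1)"
proof (intro subset_antisym subsetI)
  fix v assume v: "v \<in> {v \<in> syz g n. rho3 v = 0}"
  then have r: "rho (fst v) = 0" "rho (fst (snd v)) = 0" "rho (snd (snd v)) = 0"
    by (simp_all add: rho3_def prod_eq_iff)
  from v have h: "fst v \<in> Hm n" "fst (snd v) \<in> Hm n" "snd (snd v) \<in> Hm n"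
    by (auto simp: syz_def H3_def)
  obtain a where a: "a \<in> Hm (n - 1)" "fst v = Z * a" by (rule rho_eq_0_Hm[OF h(1) r(1)])
  obtain b where b: "b \<in> Hm (n - 1)" "fst (snd v) = Z * b" by (rule rho_eq_0_Hm[OF h(2) r(2)])
  obtain c where c: "c \<in> Hm (n - 1)" "snd (snd v) = Z * c" by (rule rho_eq_0_Hm[OF h(3) r(3)])
  have eq: "v = scale3 Z (a, b, c)" by (simp add: scale3_eq prod_eq_iff a b c)
  have "Z * lc g (a, b, c) = 0" using v eq by (simp add: syz_def lc_scale3)
  then have "(a, b, c) \<in> syz g (n - 1)" using a b c by (simp add: syz_def H3_def)
  then show "v \<in> scale3 Z ` syz g (n - 1)" using eq by blast
next
  fix v assume "v \<in> scale3 Z ` syz g (n - 1)"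
  then obtain w where w: "w \<in> syz g (n - 1)" "v = scale3 Z w" by blast
  have "rho3 v = 0" by (simp add: w rho3_def scale3_eq rhomD[OF rhom_rho] zero_prod_def)
  then show "v \<in> {v \<in> syz g n. rho3 v = 0}" using syz_scale3[OF Z_Hm w(1)] w by simp
qed

lemma dim_rho3_syz: "dm (rho3 ` syz g n) = dm (syz g n) - dm (syz g (n - 1))"
  using rank_nullity[OF clinear_rho3 fd_syz[of g n]] dim_scale3[OF _ fd_syz[of g "n - 1"], of Z]
  by (simp add: ker_rho3)

text \<open>\<open>syz g (j + 1) \<subseteq> L3 (syz g j)\<close> expresses that the syzygy module
  needs no new generators in degree j + 1.\<close>

definition L3 :: "triple set \<Rightarrow> triple set" where
  "L3 V = {scale3 X u + scale3 Y v + scale3 Z w | u v w. u \<in> V \<and> v \<in> V \<and> w \<in> V}"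

lemma cmp_C3: "k > 0 \<Longrightarrow> cmp k (C3 t) = 0"
  by (simp add: cmp_of_Hm[OF C3_Hm])

lemma Hm_decomp:
  assumes "f \<in> Hm (k + 1)" "k \<ge> 0"
  obtains a b c where "a \<in> Hm k" "b \<in> Hm k" "c \<in> Hm k" "f = X * a + Y * b + Z * c"
proof -
  obtain f0 c where 1: "f = pCons f0 c" by (cases f)
  obtain f1 b where 2: "f0 = pCons f1 b" by (cases f0)
  obtain t a where 3: "f1 = pCons t a" by (cases f1)
  have f: "f = C3 t + X * [:[:a:]:] + Y * [:b:] + Z * c"
    by (simp add: 1 2 3 xyz_defs)
  obtain n where n: "k = int n" using assms(2) nonneg_int_cases by blast
  have "cmp (Suc n) (v * w) = v * cmp n w" if "v \<in> Hm 1" for v w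
    using cmp_mult[of v 1 "Suc n" w] that by (simp add: mult.commute)
  then have "cmp (Suc n) f = X * cmp n [:[:a:]:] + Y * cmp n [:b:] + Z * cmp n c"
    unfolding f by (simp add: cmp_linear cmp_C3 X_Hm Y_Hm Z_Hm del: mult_pCons_left mult_pCons_right)
  moreover have "cmp (Suc n) f = f" using cmp_of_Hm[OF assms(1)] n by simp
  ultimately show ?thesis using that[of "cmp n [:[:a:]:]" "cmp n [:b:]" "cmp n c"] cmp_Hm n by simp
qed

text \<open>A common element x u = y v of the two images is x y w with \<open>w\<close> in
  \<open>V'\<close>, so the intersection has at most the dimension of \<open>V'\<close>. The maps
  stay abstract to serve triples and tuples alike.\<close>

lemma dim_two_mult:
  fixes mx my :: "'a::cvec \<Rightarrow> 'a"
  assumes cl: "clinear mx" "clinear my" and inj: "\<And>v. mx v = 0 \<Longrightarrow> v = 0" "\<And>v. my v = 0 \<Longrightarrow> v = 0"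
    and fd: "fd V" "fd V'" and w: "\<And>u v. u \<in> V \<Longrightarrow> v \<in> V \<Longrightarrow> mx u = my v \<Longrightarrow> \<exists>w\<in>V'. u = my w"
  shows "dm (ssum (mx ` V) (my ` V)) \<ge> 2 * dm V - dm V'"
proof -
  have "mx ` V \<inter> my ` V \<subseteq> (\<lambda>w. mx (my w)) ` V'"
  proof
    fix x assume "x \<in> mx ` V \<inter> my ` V"
    then obtain u v where uv: "u \<in> V" "v \<in> V" "x = mx u" "x = my v" by blast
    then obtain w' where "w' \<in> V'" "u = my w'" using w[of u v] by auto
    then show "x \<in> (\<lambda>w. mx (my w)) ` V'" using uv(3) by blast
  qed
  then have "dm (mx ` V \<inter> my ` V) \<le> dm ((\<lambda>w. mx (my w)) ` V')"
    using fd_dim_mono fd_image[OF clinear_compose[OF cl] fd(2)] by simp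
  also have "\<dots> = dm V'"
    by (rule dim_inj_image[OF clinear_compose[OF cl] fd(2)]) (use inj in blast)
  finally have "dm (mx ` V \<inter> my ` V) \<le> dm V'" .
  moreover have "dm (mx ` V) = dm V" "dm (my ` V) = dm V"
    by (rule dim_inj_image[OF cl(1) fd(1) inj(1)], assumption, rule dim_inj_image[OF cl(2) fd(1) inj(2)])
  moreover note dim_ssum[OF fd_image[OF cl(1) fd(1)] fd_image[OF cl(2) fd(1)]]
  ultimately show ?thesis by linarith
qed

section \<open>Three generators and the pairing\<close>

locale plane_triple = plane_ci +
  fixes T :: poly3
  assumes T: "T \<in> Hm e"
begin

abbreviation "g \<equiv> (P, Q, T)"
abbreviation "h j \<equiv> dm (syz g j)"
abbreviation "A \<equiv> adim g e"
abbreviation "J \<equiv> jac g e"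

text \<open>The colon ideal of (P,Q) by T in degree j. It contains \<open>I j\<close>, and the
  quotient is the kernel of multiplication by T on S/(P,Q).\<close>

definition Kh :: "int \<Rightarrow> poly3 set" where
  "Kh j = {u \<in> Hm j. u * T \<in> I (j + e)}"

lemma fd_Kh: "fd (Kh j)"
  unfolding Kh_def by (rule fd_subset[OF subspace_vimage[OF clinear_mult(2) subspace_Hm sub_I] fd_Hm]) auto

lemma Kh_syz: "(\<lambda>v. snd (snd v)) ` syz g j = Kh j"
proof (intro subset_antisym subsetI)
  fix u assume "u \<in> (\<lambda>v. snd (snd v)) ` syz g j"
  then obtain a b where ab: "a \<in> Hm j" "b \<in> Hm j" "u \<in> Hm j" "a * P + b * Q + u * T = 0"
    by (auto simp: syz_def H3_def lc_def)
  have "u * T = (- a) * P + (- b) * Q" using ab(4) by (simp add: algebra_simps add_eq_0_iff)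
  moreover have "- a \<in> Hm (j + e - e)" "- b \<in> Hm (j + e - e)" using ab Hm_uminus by simp_all
  ultimately have "u * T \<in> I (j + e)" unfolding ci_def by blast
  then show "u \<in> Kh j" using ab(3) by (simp add: Kh_def)
next
  fix u assume "u \<in> Kh j"
  then obtain a b where ab: "a \<in> Hm j" "b \<in> Hm j" "u \<in> Hm j" "u * T = a * P + b * Q"
    by (auto simp: Kh_def ci_def)
  then have "(- a, - b, u) \<in> syz g j" using Hm_uminus by (simp add: syz_def H3_def lc_def)
  then show "u \<in> (\<lambda>v. snd (snd v)) ` syz g j" by (rule rev_image_eqI) simp
qed

text \<open>Syzygies with last entry 0 are relations between P and Q alone, hence Koszul; they
  contribute \<open>Hm (j - e)\<close>.\<close>

lemma dim_syz: "h j = dm (Kh j) + dm (Hm (j - e))"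
proof -
  have cl: "clinear (\<lambda>v :: triple. snd (snd v))"
    by (rule clinearI) (simp_all add: csc_prod_def)
  let ?K = "{x \<in> Hm j \<times> Hm j. fst x * P + snd x * Q = 0}"
  have "{v \<in> syz g j. snd (snd v) = 0} = (\<lambda>x. (fst x, snd x, 0)) ` ?K"
    by (force simp: syz_def H3_def lc_def image_iff)
  moreover have "dm ((\<lambda>x. (fst x, snd x, 0 :: poly3)) ` ?K) = dm ?K"
  proof (rule dim_inj_image)
    show "clinear (\<lambda>x :: poly3 \<times> poly3. (fst x, snd x, 0 :: poly3))"
      by (rule clinearI) (simp_all add: csc_prod_def)
    show "fd ?K"
      by (rule fd_subset[OF subspace_ker[OF clinear_comb2 fd_subspace[OF fd_Times[OF fd_Hm fd_Hm]]]
            fd_Times[OF fd_Hm fd_Hm]]) auto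
  qed (auto simp: zero_prod_def)
  ultimately show ?thesis
    using rank_nullity[OF cl fd_syz[of g j]] Kh_syz[of j] dim_koszul[of j] by simp
qed

text \<open>From degree 2e - 2 on, S/(P,Q) has constant dimension e^2, so multiplication by T has
  kernel and cokernel of equal dimension. The bound on \<open>j\<close> keeps j - 2e \<ge> -2, as
  \<open>dim_Hm\<close> requires.\<close>

lemma adim_Kh:
  assumes "j \<ge> 2 * e - 2"
  shows "A (j + e) = dm (Kh j) - dm (I j)"
proof -
  have 1: "2 * dm (Hm n) = n * n + 3 * n + 2" if "n \<ge> - 2" for n
    using dim_Hm[OF that] by (simp add: algebra_simps)
  have 2: "A (j + e) = dm (Hm (j + e)) - 3 * dm (Hm j) + dm (Kh j) + dm (Hm (j - e))"
    using adim_syz[of g e "j + e"] dim_syz[of j] by simp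
  have 3: "2 * dm (Hm (j + e)) - 6 * dm (Hm j) + 6 * dm (Hm (j - e)) - 2 * dm (Hm (j - 2 * e)) = 0"
    using 1[of "j + e"] 1[of j] 1[of "j - e"] 1[of "j - 2 * e"] assms e by (simp add: algebra_simps)
  show ?thesis using 2 3 dim_I[of j] by linarith
qed

lemma jac_Hm: "v \<in> J k \<Longrightarrow> v \<in> Hm k"
proof -
  assume "v \<in> J k"
  then obtain a b c where abc: "v = a * P + b * Q + c * T" "a \<in> Hm (k - e)" "b \<in> Hm (k - e)" "c \<in> Hm (k - e)"
    by (auto simp: jac_def H3_def lc_def)
  then show ?thesis
    using Hm_mult[OF abc(2) PQ(1)] Hm_mult[OF abc(3) PQ(2)] Hm_mult[OF abc(4) T] Hm_add by simp
qed

text \<open>The orthogonality behind the bound: multiples of P and Q stay in (P,Q), and multiples of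
  T are moved there by elements of \<open>Kh\<close>.\<close>

lemma jac_mult_Kh:
  assumes "v \<in> J k" "u \<in> Kh j"
  shows "v * u \<in> I (k + j)"
proof -
  obtain a b c where abc: "v = a * P + b * Q + c * T" "a \<in> Hm (k - e)" "b \<in> Hm (k - e)" "c \<in> Hm (k - e)"
    using assms(1) by (auto simp: jac_def H3_def lc_def)
  have "a * P + b * Q \<in> I k" using abc unfolding ci_def by blast
  moreover have u: "u \<in> Hm j" "u * T \<in> I (j + e)" using assms(2) by (auto simp: Kh_def)
  ultimately have "(a * P + b * Q) * u \<in> I (k + j)" by (intro I_mult)
  moreover have "u * T * c \<in> I (k + j)" using I_mult[OF u(2) abc(4)] by (simp add: add.commute)
  moreover have "v * u = (a * P + b * Q) * u + u * T * c" using abc(1) by (simp add: algebra_simps)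
  ultimately show ?thesis using CV.subspace_add[OF sub_I] by simp
qed

text \<open>Multiplication followed by the residue functional pairs \<open>Hm k\<close> with \<open>Kh j\<close>. Every \<open>u \<in> Kh j\<close>
  outside of \<open>I j\<close> is, up to \<open>I j\<close> and a power of \<open>z\<close>, the last entry of a syzygy, hence of degree
  at least \<open>r\<close>; so it pairs nontrivially with forms of degree \<open>k \<ge> 2e - 2 - r\<close>.\<close>

lemma adim_le:
  assumes r: "\<And>i. i < r \<Longrightarrow> syz g i = {0}" and j: "j \<ge> 2 * e - 2" and k: "k \<ge> 2 * e - 2 - r" "k \<ge> 0"
  shows "A (j + e) \<le> dm (Hm k) - dm {v \<in> Hm k. Z ^ c * v \<in> J (k + int c)}"
proof -
  \<comment> \<open>The pairing takes values in degree j + k + c, because a factor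
    \<open>Z ^ c\<close> is inserted; \<open>n\<close> is the excess over the socle degree. With
    this factor, \<open>v\<close> is orthogonal to \<open>Kh j\<close> as soon as
    \<open>Z ^ c * v\<close> lies in the ideal. The cases c = 0 and c = 1 are used later.\<close>
  define n where "n = nat (j + k + int c - (2 * e - 2))"
  have n: "2 * e - 2 + int n = j + k + int c" using j k e by (simp add: n_def)
  obtain \<phi> :: "poly3 \<Rightarrow> complex" where \<phi>: "clinear \<phi>"
    "\<And>u. u \<in> I (j + k + int c) \<Longrightarrow> \<phi> u = 0"
    "\<And>w. w \<in> Hm (2 * e - 2) \<Longrightarrow> rho w \<notin> I\<^sub>0 (2 * e - 2) \<Longrightarrow> \<phi> (Z ^ n * w) \<noteq> 0"
    using residue_functional[of n] unfolding n by blast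
  let ?V0 = "{v \<in> Hm k. Z ^ c * v \<in> J (k + int c)}"
  have "dm (Kh j) - dm (I j) \<le> dm (Hm k) - dm ?V0"
  proof (rule pairing_dim[where \<beta> = "\<lambda>v u. \<phi> (Z ^ c * v * u)"])
    show "CV.subspace ?V0" by (rule subspace_vimage[OF clinear_mult(1) subspace_Hm sub_jac])
    show "clinear (\<lambda>v. \<phi> (Z ^ c * v * u))" for u
      by (intro clinear_compose[OF \<phi>(1)] clinear_compose[OF clinear_mult(2)] clinear_mult)
    show "clinear (\<lambda>u. \<phi> (Z ^ c * v * u))" for v
      by (intro clinear_compose[OF \<phi>(1)] clinear_mult)
    show "\<phi> (Z ^ c * v * u) = 0" if "v \<in> ?V0" "u \<in> Kh j" for v u
      using jac_mult_Kh[of "Z ^ c * v" "k + int c" u j] that by (intro \<phi>(2)) (simp add: ac_simps)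
    show "u \<in> I j" if u: "u \<in> Kh j" and 0: "\<And>v. v \<in> Hm k \<Longrightarrow> \<phi> (Z ^ c * v * u) = 0" for u
    proof (rule ccontr)
      assume nI: "u \<notin> I j"
      have uH: "u \<in> Hm j" using u by (simp add: Kh_def)
      obtain a u' where u': "u' \<in> Hm (j - int a)" "rho u' \<notin> I\<^sub>0 (j - int a)" "u - Z ^ a * u' \<in> I j"
        by (rule Z_adic_order[OF uH nI])
      let ?i = "j - int a"
      have "u * T - (u - Z ^ a * u') * T \<in> I (j + e)"
        using u I_mult[OF u'(3) T] CV.subspace_diff[OF sub_I] by (simp add: Kh_def)
      then have "Z ^ a * (u' * T) \<in> I (?i + e + int a)" by (simp add: algebra_simps)
      then have "u' * T \<in> I (?i + e)" by (rule I_cancel_Z_power)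
      then have "u' \<in> Kh ?i" using u' by (simp add: Kh_def)
      then obtain s where s: "s \<in> syz g ?i" "u' = snd (snd s)" using Kh_syz[of ?i] by blast
      have "u' \<noteq> 0" using u'(2) CV.subspace_0[OF sub_I0] by (auto simp: rhomD[OF rhom_rho])
      then have ir: "?i \<ge> r" using s r[of ?i] by force
      obtain v where i: "?i \<le> 2 * e - 2" and v: "v \<in> Rm (2 * e - 2 - ?i)" "rho u' * v \<notin> I\<^sub>0 (2 * e - 2)"
        using gorenstein[OF rho_Rm[OF u'(1)] u'(2)] by blast
      \<comment> \<open>\<open>Z ^ b\<close> pads the dual element \<open>v\<close> to degree k. The
        exponent is nonnegative because \<open>?i\<close> \<ge> r and k \<ge> 2e - 2 - r; here the
        absence of syzygies below r is spent.\<close>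
      define b where "b = nat (k - (2 * e - 2 - ?i))"
      have b: "int b = k - (2 * e - 2 - ?i)" using ir k i by (simp add: b_def)
      have w: "u' * v \<in> Hm (2 * e - 2)" using Hm_mult[OF u'(1) Rm_Hm[OF v(1)]] by simp
      have "rho (u' * v) \<notin> I\<^sub>0 (2 * e - 2)" using v by (simp add: rhomD[OF rhom_rho] Rm_rho)
      then have nz: "\<phi> (Z ^ n * (u' * v)) \<noteq> 0" by (rule \<phi>(3)[OF w])
      have nabc: "n = a + b + c" using b n by simp
      have zv: "Z ^ b * v \<in> Hm k" using Hm_mult[OF Z_power_Hm[of b] Rm_Hm[OF v(1)]] b by simp
      have cb: "Z ^ c * (Z ^ b * v) \<in> Hm (int c + k)" by (rule Hm_mult[OF Z_power_Hm zv])
      have eq: "Z ^ c * (Z ^ b * v) * u = (u - Z ^ a * u') * (Z ^ c * (Z ^ b * v)) + Z ^ n * (u' * v)"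
        unfolding nabc by (simp add: algebra_simps power_add)
      have "\<phi> ((u - Z ^ a * u') * (Z ^ c * (Z ^ b * v))) = 0"
        using I_mult[OF u'(3) cb] by (intro \<phi>(2)) (simp add: algebra_simps)
      then have "\<phi> (Z ^ c * (Z ^ b * v) * u) = \<phi> (Z ^ n * (u' * v))"
        unfolding eq clinearD(1)[OF \<phi>(1)] by simp
      then show False using nz 0[OF zv] by simp
    qed
  qed (auto simp: fd_Hm fd_Kh fd_I)
  then show ?thesis using adim_Kh[OF j] by simp
qed

text \<open>3e - 2 is e above 2e - 2, hence the first degree covered by \<open>adim_Kh\<close>; the
  Hilbert function is already stable there.\<close>

definition tau :: int where "tau = A (3 * e - 2)"

lemma adim_le_adim:
  assumes "\<And>i. i < r \<Longrightarrow> syz g i = {0}" "j \<ge> 2 * e - 2" "k \<ge> 2 * e - 2 - r" "k \<ge> 0"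
  shows "A (j + e) \<le> A k"
proof -
  have "{v \<in> Hm k. v \<in> J k} = J k" using jac_Hm by blast
  then show ?thesis using adim_le[of r j k 0, OF assms] by (simp add: adim_def)
qed

text \<open>With r = 0 the hypothesis on syzygies concerns negative degrees only, and the estimate
  then holds in both directions between 3e - 2 and any larger degree.\<close>

lemma adim_eq_tau: "k \<ge> 3 * e - 2 \<Longrightarrow> A k = tau"
proof -
  assume k: "k \<ge> 3 * e - 2"
  have "A (2 * e - 2 + e) \<le> A k" using k e by (intro adim_le_adim[of 0] syz_neg) auto
  moreover have "A (k - e + e) \<le> A (3 * e - 2)" using k e by (intro adim_le_adim[of 0] syz_neg) auto
  ultimately show ?thesis by (simp add: tau_def)
qed

lemma tau_le:
  assumes "\<And>i. i < r \<Longrightarrow> syz g i = {0}" "k \<ge> 2 * e - 2 - r" "k \<ge> 0"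
  shows "tau \<le> A k"
  using adim_le_adim[OF assms(1), of r "2 * e - 2" k] assms(2,3) by (simp add: tau_def)

end

section \<open>Extremal dimensions and generation in one degree\<close>

lemma XY_relation3:
  assumes "scale3 X u = scale3 Y v"
  obtains w where "u = scale3 Y w" "v = scale3 X w"
proof -
  have eq: "Y * fst v = X * fst u" "Y * fst (snd v) = X * fst (snd u)" "Y * snd (snd v) = X * snd (snd u)"
    using assms by (simp_all add: scale3_eq)
  obtain a where a: "fst v = X * a" "fst u = Y * a" by (rule XY_relation[OF eq(1)])
  obtain b where b: "fst (snd v) = X * b" "fst (snd u) = Y * b" by (rule XY_relation[OF eq(2)])
  obtain c where c: "snd (snd v) = X * c" "snd (snd u) = Y * c" by (rule XY_relation[OF eq(3)])
  show ?thesis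
    by (rule that[of "(a, b, c)"]) (simp_all add: scale3_eq prod_eq_iff a b c)
qed

context plane_triple
begin

abbreviation "N j \<equiv> rho3 ` syz g j"

lemma fd_N: "fd (N j)"
  by (rule fd_image[OF clinear_rho3 fd_syz])

lemma adim_h: "A (j + e) = dm (Hm (j + e)) - 3 * dm (Hm j) + h j"
  using adim_syz[of g e "j + e"] by simp

lemma dim_Hm_diff: "n \<ge> -1 \<Longrightarrow> dm (Hm n) - dm (Hm (n - 1)) = n + 1"
  using dim_Hm[of n] dim_Hm[of "n - 1"] by (simp add: algebra_simps)

lemma jac_mult: "v \<in> J k \<Longrightarrow> s \<in> Hm n \<Longrightarrow> s * v \<in> J (k + n)"
proof -
  assume "v \<in> J k" and s: "s \<in> Hm n"
  then obtain w where w: "w \<in> H3 (k - e)" "v = lc g w" by (auto simp: jac_def)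
  have "scale3 s w \<in> H3 (k + n - e)" using H3_scale3[OF s w(1)] by (simp add: algebra_simps)
  then show ?thesis unfolding jac_def w(2) lc_scale3[symmetric] by blast
qed

context
  fixes r :: int
  assumes r: "\<And>i. i < r \<Longrightarrow> syz g i = {0}"
begin

text \<open>Applying the pairing argument to the classes that \<open>z\<close> sends to zero shows that the quotient
  in degree \<open>r + e - 1\<close> is \<open>z\<close> times the one before, as soon as its dimension is minimal.\<close>

lemma saturated_start:
  assumes er: "e + 1 \<le> 2 * r" and eq: "A (r + e - 1) = tau"
  shows "Hm (r + e - 1) = ssum (J (r + e - 1)) ((*) Z ` Hm (r + e - 2))"
proof -
  let ?k = "r + e - 1"
  let ?S = "ssum (J ?k) ((*) Z ` Hm (?k - 1))"
  let ?Jz = "{v \<in> Hm (?k - 1). Z ^ 1 * v \<in> J (?k - 1 + int 1)}"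
  have sub: "?S \<subseteq> Hm ?k"
  proof
    fix x assume "x \<in> ?S"
    then obtain v w where vw: "x = v + Z * w" "v \<in> J ?k" "w \<in> Hm (?k - 1)" by (auto simp: ssum_def)
    have "v \<in> Hm ?k" by (rule jac_Hm[OF vw(2)])
    moreover have "Z * w \<in> Hm ?k" using Hm_mult[OF Z_Hm vw(3)] by simp
    ultimately show "x \<in> Hm ?k" using vw(1) Hm_add by blast
  qed
  have "tau = A (2 * e - 2 + e)" by (simp add: tau_def)
  \<comment> \<open>The estimate with c = 1 in degree r + e - 2, which is at least 2e - 2 - r
    because e + 1 \<le> 2r.\<close>
  then have 1: "tau \<le> dm (Hm (?k - 1)) - dm ?Jz"
    using adim_le[of r "2 * e - 2" "?k - 1" 1] r er e by simp
  have "J ?k \<inter> (*) Z ` Hm (?k - 1) \<subseteq> (*) Z ` ?Jz" by auto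
  moreover have fJ: "fd ?Jz"
    by (rule fd_subset[OF subspace_vimage[OF clinear_mult(1) subspace_Hm sub_jac] fd_Hm]) auto
  ultimately have "dm (J ?k \<inter> (*) Z ` Hm (?k - 1)) \<le> dm ((*) Z ` ?Jz)"
    using fd_dim_mono[OF fd_image[OF clinear_mult(1) fJ]] by simp
  then have "dm (J ?k \<inter> (*) Z ` Hm (?k - 1)) \<le> dm ?Jz"
    using dim_mult_image[OF _ fJ, of Z] by simp
  \<comment> \<open>The ideal meets the multiples of z in dimension at most that of
    \<open>?Jz\<close>. So the sum has at least the dimension of \<open>J ?k\<close> plus
    \<open>tau\<close>, which by \<open>eq\<close> is that of \<open>Hm ?k\<close>.\<close>
  then have "dm (Hm ?k) \<le> dm ?S"
    using 1 eq dim_ssum[OF fd_jac fd_image[OF clinear_mult(1) fd_Hm], of g e ?k Z "?k - 1"]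
      dim_mult_image[OF _ fd_Hm, of Z "?k - 1"] by (simp add: adim_def)
  then have "?S = Hm ?k"
    by (intro fd_dim_eq[OF fd_Hm _ sub] fd_subspace[OF fd_ssum[OF fd_jac fd_image[OF clinear_mult(1) fd_Hm]]]) simp
  then show ?thesis by simp
qed

text \<open>S is generated in degree one, so once S/(J,z) vanishes in some degree it vanishes in all
  later ones.\<close>

lemma saturated:
  assumes er: "e + 1 \<le> 2 * r" and eq: "A (r + e - 1) = tau" and k: "k \<ge> r + e - 1"
  shows "Hm k \<subseteq> ssum (J k) ((*) Z ` Hm (k - 1))"
  using k
proof (induction k rule: int_ge_induct)
  case base
  then show ?case using saturated_start[OF er eq] by simp
next
  case (step k)
  show ?case
  proof
    fix f assume f: "f \<in> Hm (k + 1)"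
    have k0: "k \<ge> 0" using step(1) er e by simp
    obtain a b c where abc: "a \<in> Hm k" "b \<in> Hm k" "c \<in> Hm k" "f = X * a + Y * b + Z * c"
      by (rule Hm_decomp[OF f k0])
    have "a \<in> ssum (J k) ((*) Z ` Hm (k - 1))" "b \<in> ssum (J k) ((*) Z ` Hm (k - 1))"
      using step(2) abc(1,2) by blast+
    then obtain a1 a2 b1 b2 where a: "a = a1 + Z * a2" "a1 \<in> J k" "a2 \<in> Hm (k - 1)"
      and b: "b = b1 + Z * b2" "b1 \<in> J k" "b2 \<in> Hm (k - 1)"
      by (auto simp: ssum_def)
    have "X * a1 + Y * b1 \<in> J (k + 1)"
      using jac_mult[OF a(2) X_Hm] jac_mult[OF b(2) Y_Hm] CV.subspace_add[OF sub_jac] by blast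
    moreover have "X * a2 + Y * b2 + c \<in> Hm k"
      using Hm_mult[OF X_Hm a(3)] Hm_mult[OF Y_Hm b(3)] abc(3) Hm_add by simp
    moreover have "f = (X * a1 + Y * b1) + Z * (X * a2 + Y * b2 + c)"
      unfolding abc(4) a(1) b(1) by (simp add: algebra_simps)
    ultimately show "f \<in> ssum (J (k + 1)) ((*) Z ` Hm (k + 1 - 1))"
      unfolding ssum_def by auto
  qed
qed

text \<open>By saturation, multiplication by z maps each graded piece of S/J onto the next, so the
  dimensions cannot grow; \<open>tau_le\<close> keeps them from dropping.\<close>

lemma adim_const:
  assumes er: "e + 1 \<le> 2 * r" and eq: "A (r + e - 1) = tau" and k: "k \<ge> r + e - 1"
  shows "A k = tau"
  using k
proof (induction k rule: int_ge_induct)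
  case (step k)
  let ?Z = "(*) Z ` Hm k"
  have "(*) Z ` J k \<subseteq> J (k + 1) \<inter> ?Z"
  proof
    fix x assume "x \<in> (*) Z ` J k"
    then obtain v where v: "v \<in> J k" "x = Z * v" by blast
    have "v \<in> Hm k" by (rule jac_Hm[OF v(1)])
    then show "x \<in> J (k + 1) \<inter> ?Z" using jac_mult[OF v(1) Z_Hm] v by simp
  qed
  moreover have "fd (J (k + 1) \<inter> ?Z)"
    by (rule fd_subset[OF CV.subspace_inter[OF sub_jac fd_subspace[OF fd_image[OF clinear_mult(1) fd_Hm]]] fd_jac]) auto
  ultimately have "dm ((*) Z ` J k) \<le> dm (J (k + 1) \<inter> ?Z)"
    by (intro of_nat_mono fd_dim_mono)
  then have "dm (J k) \<le> dm (J (k + 1) \<inter> ?Z)"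
    using dim_mult_image[OF _ fd_jac, of Z g e k] by simp
  moreover have "dm (Hm (k + 1)) \<le> dm (ssum (J (k + 1)) ?Z)"
    using saturated[OF er eq, of "k + 1"] step(1)
      fd_dim_mono[OF fd_ssum[OF fd_jac fd_image[OF clinear_mult(1) fd_Hm]]] by simp
  ultimately have "A (k + 1) \<le> A k"
    using dim_ssum[OF fd_jac fd_image[OF clinear_mult(1) fd_Hm], of g e "k + 1" Z k]
      dim_mult_image[OF _ fd_Hm, of Z k] by (simp add: adim_def)
  moreover have "tau \<le> A (k + 1)" using tau_le[of r "k + 1"] r step(1) er e by simp
  ultimately show ?case using step(2) by simp
qed (rule eq)

lemma syz_dim_diff:
  assumes er: "e + 1 \<le> 2 * r" and eq: "A (r + e - 1) = tau" and j: "j \<ge> r"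
  shows "h j - h (j - 1) = 2 * j - e + 2"
  using adim_const[OF er eq, of "j + e"] adim_const[OF er eq, of "j - 1 + e"] j e er
    adim_h[of j] adim_h[of "j - 1"] dim_Hm_diff[of j] dim_Hm_diff[of "j + e"]
  by (simp add: algebra_simps)

text \<open>\<open>F\<close> collects the syzygies over C[x,y] of the restricted triple. Saturation
  determines the dimension of \<open>F\<close>, and from degree r on it agrees with that of
  \<open>N\<close>. The growth relation makes x \<open>F j\<close> + y \<open>F j\<close> fill
  \<open>F (j + 1)\<close>, and a Nakayama step modulo z lifts this to S.\<close>

lemma syz_generation:
  assumes er: "e + 1 \<le> 2 * r" and eq: "A (r + e - 1) = tau" and j: "j \<ge> r"
  shows "syz g (j + 1) \<subseteq> L3 (syz g j)"
proof -
  note hj = syz_dim_diff[OF er eq]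
  define F where "F j = {w \<in> Rm j \<times> Rm j \<times> Rm j. lc (rho3 g) w = 0}" for j
  have fR: "fd (Rm j \<times> Rm j \<times> Rm j)" for j by (intro fd_Times fd_Rm)
  have fF: "fd (F j)" for j
    unfolding F_def by (rule fd_subset[OF subspace_ker[OF clinear_lc fd_subspace[OF fR]] fR]) auto
  have rho3_Rm: "rho3 v \<in> Rm j \<times> Rm j \<times> Rm j" if "v \<in> H3 j" for v j
    using that rho_Rm by (simp add: H3_def rho3_def mem_Times_iff)
  have lcR: "lc (rho3 g) w \<in> Rm (j + e)" if w: "w \<in> Rm j \<times> Rm j \<times> Rm j" for w j
    using Rm_mult[OF _ pq(1), of "fst w" j] Rm_mult[OF _ pq(2), of "fst (snd w)" j]
      Rm_mult[OF _ rho_Rm[OF T], of "snd (snd w)" j] w CV.subspace_add[OF subspace_Rm]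
    by (simp add: lc_def rho3_def mem_Times_iff)
  \<comment> \<open>The formula is needed one degree below r: for j = r the growth relation involves
    \<open>F (r - 1)\<close>, although \<open>N (r - 1)\<close> is zero.\<close>
  have dF: "dm (F j) = 2 * j - e + 2" if j: "j \<ge> r - 1" for j
  proof -
    have "Rm (j + e) \<subseteq> lc (rho3 g) ` (Rm j \<times> Rm j \<times> Rm j)"
    proof
      fix f assume f: "f \<in> Rm (j + e)"
      have "f \<in> ssum (J (j + e)) ((*) Z ` Hm (j + e - 1))"
        using saturated[OF er eq, of "j + e"] j Rm_Hm[OF f] by auto
      then obtain v u where vu: "f = v + Z * u" "v \<in> J (j + e)"
        unfolding ssum_def by blast
      then obtain w where w: "w \<in> H3 j" "v = lc g w" by (auto simp: jac_def)
      have "rho f = lc (rho3 g) (rho3 w)" by (simp only: vu(1) w(2) rhomD[OF rhom_rho] rho_lc) simp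
      then have "f = lc (rho3 g) (rho3 w)" using Rm_rho[OF f] by simp
      then show "f \<in> lc (rho3 g) ` (Rm j \<times> Rm j \<times> Rm j)" using rho3_Rm[OF w(1)] by (rule image_eqI)
    qed
    then have "lc (rho3 g) ` (Rm j \<times> Rm j \<times> Rm j) = Rm (j + e)" using lcR by blast
    then show ?thesis
      using rank_nullity[OF clinear_lc[of "rho3 g"] fR[of j]] dim_Rm[of j] dim_Rm[of "j + e"] j er e
      by (simp add: F_def dim_Times fd_Times fd_Rm)
  qed
  have NF: "N j \<subseteq> F j" for j
  proof
    fix w assume "w \<in> N j"
    then obtain v where v: "v \<in> H3 j" "lc g v = 0" "w = rho3 v" by (auto simp: syz_def)
    have "lc (rho3 g) w = 0" unfolding v(3) rho_lc[symmetric] by (simp add: v(2) rhomD[OF rhom_rho])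
    then show "w \<in> F j" using rho3_Rm[OF v(1)] v(3) by (simp add: F_def)
  qed
  have NF_eq: "N j = F j" if "j \<ge> r" for j
    by (rule fd_dim_eq[OF fF fd_subspace[OF fd_N] NF]) (use dim_rho3_syz[of g j] hj[OF that] dF[of j] that in simp)
  have F3: "scale3 s w \<in> F (j + 1)" if w: "w \<in> F j" and s: "s \<in> Rm 1" for s w j
    using w s Rm_mult[OF s, of _ j] by (simp add: F_def lc_scale3) (simp add: scale3_eq mem_Times_iff add.commute)
  let ?S = "ssum (scale3 X ` F j) (scale3 Y ` F j)"
  have fS: "fd ?S" by (intro fd_ssum fd_image clinear_scale3 fF)
  have "?S = F (j + 1)"
  proof (rule fd_dim_eq[OF fF fd_subspace[OF fS]])
    show "?S \<subseteq> F (j + 1)"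
      using F3[OF _ X_Rm] F3[OF _ Y_Rm] CV.subspace_add[OF fd_subspace[OF fF]] by (force simp: ssum_def)
    have "dm ?S \<ge> 2 * dm (F j) - dm (F (j - 1))"
    proof (rule dim_two_mult[OF clinear_scale3 clinear_scale3])
      fix u v assume uv: "u \<in> F j" "v \<in> F j" "scale3 X u = scale3 Y v"
      then obtain w where w: "u = scale3 Y w" "v = scale3 X w" using XY_relation3 by metis
      have "fst w \<in> Rm (j - 1)" "fst (snd w) \<in> Rm (j - 1)" "snd (snd w) \<in> Rm (j - 1)"
        using uv(1) Rm_cancel[OF _ Y_Rm, of _ j]
        by (simp_all add: w(1) F_def scale3_eq mult.commute[of Y])
      moreover have "lc (rho3 g) w = 0" using uv(1) by (simp add: w(1) F_def lc_scale3)
      ultimately show "\<exists>w\<in>F (j - 1). u = scale3 Y w"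
        using w(1) by (intro bexI[of _ w]) (simp_all add: F_def mem_Times_iff)
    qed (simp_all add: scale3_eq_0 fF)
    \<comment> \<open>The dimensions 2j - e + 2 are linear in \<open>j\<close>, so twice the value
      at j minus that at j - 1 is the value at j + 1.\<close>
    then show "CV.dim (F (j + 1)) \<le> CV.dim ?S" using dF[of j] dF[of "j - 1"] dF[of "j + 1"] j by simp
  qed
  show ?thesis
  proof
    fix v assume v: "v \<in> syz g (j + 1)"
    then have "rho3 v \<in> ?S" using NF[of "j + 1"] \<open>?S = F (j + 1)\<close> by blast
    then obtain f1 f2 where f: "rho3 v = scale3 X f1 + scale3 Y f2" "f1 \<in> N j" "f2 \<in> N j"
      unfolding NF_eq[OF j] ssum_def by blast
    then obtain m1 m2 where m: "m1 \<in> syz g j" "m2 \<in> syz g j" "f1 = rho3 m1" "f2 = rho3 m2" by blast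
    let ?d = "v - scale3 X m1 - scale3 Y m2"
    have "?d \<in> syz g (j + 1)"
      using v syz_scale3[OF X_Hm m(1)] syz_scale3[OF Y_Hm m(2)] CV.subspace_diff[OF sub_syz]
      by (simp add: add.commute)
    moreover have "rho3 ?d = 0" by (simp add: clinearD[OF clinear_rho3] rho3_scale3 f m(3,4))
    ultimately have "?d \<in> scale3 Z ` syz g j" using ker_rho3[of g "j + 1"] by auto
    then obtain m3 where m3: "m3 \<in> syz g j" "?d = scale3 Z m3" by blast
    have "v = scale3 X m1 + scale3 Y m2 + scale3 Z m3" using m3(2) by (simp add: algebra_simps)
    then show "v \<in> L3 (syz g j)" unfolding L3_def using m m3 by blast
  qed
qed

text \<open>Modulo \<open>z\<close> the dimensions of the syzygy spaces grow by at least \<open>2\<close> in each step: evaluation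
  at the point \<open>(0:1:0)\<close> kills \<open>x N j\<close>, and the Koszul syzygies show that its image has
  dimension at least \<open>2\<close>.\<close>

lemma adim_le_tau:
  assumes er: "r \<le> e" "r \<ge> 1" and hr: "h r = 2 * r - e + 2"
    and gen: "\<And>j. j \<ge> r \<Longrightarrow> syz g (j + 1) \<subseteq> L3 (syz g j)"
  shows "A (r + e - 1) \<le> tau"
proof -
  define pt :: "int \<Rightarrow> triple \<Rightarrow> complex \<times> complex \<times> complex" where
    "pt j v = (coeff3 (fst v) 0 (nat j) 0, coeff3 (fst (snd v)) 0 (nat j) 0, coeff3 (snd (snd v)) 0 (nat j) 0)"
    for j v
  have clpt: "clinear (pt j)" for j
    by (rule clinearI) (simp_all add: pt_def csc_prod_def csc_complex_def)
  have pt_rho3: "pt j (rho3 v) = pt j v" for j v by (simp add: pt_def rho3_def coeff3_rho)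
  have pt_XYZ: "pt (j + 1) (scale3 X v) = 0" "pt (j + 1) (scale3 Y v) = pt j v" "pt (j + 1) (scale3 Z v) = 0"
    if "j \<ge> 0" for j v
    using that by (simp_all add: pt_def scale3_eq coeff3_X coeff3_Y coeff3_Z zero_prod_def nat_add_distrib)
  define E where "E j = pt j ` syz g j" for j
  have fE: "fd (E j)" for j unfolding E_def by (rule fd_image[OF clpt fd_syz])
  \<comment> \<open>Of the three multiplications only that by y survives at (0:1:0), so generation
    makes the image independent of the degree.\<close>
  have E_step: "E (j + 1) = E j" if j: "j \<ge> r" for j
  proof
    have j0: "j \<ge> 0" using j er by simp
    show "E (j + 1) \<subseteq> E j"
    proof
      fix x assume "x \<in> E (j + 1)"
      then obtain v where v: "v \<in> syz g (j + 1)" "x = pt (j + 1) v" by (auto simp: E_def)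
      then have "v \<in> L3 (syz g j)" using gen[OF j] by blast
      then obtain a b c where "v = scale3 X a + scale3 Y b + scale3 Z c" "b \<in> syz g j"
        unfolding L3_def by blast
      then show "x \<in> E j" by (simp add: v(2) clinearD[OF clpt] pt_XYZ[OF j0] E_def)
    qed
    show "E j \<subseteq> E (j + 1)"
    proof
      fix x assume "x \<in> E j"
      then obtain v where v: "v \<in> syz g j" "x = pt j v" by (auto simp: E_def)
      have "scale3 Y v \<in> syz g (j + 1)" using syz_scale3[OF Y_Hm v(1)] by (simp add: add.commute)
      then show "x \<in> E (j + 1)" unfolding E_def v(2) pt_XYZ(2)[OF j0, symmetric] by blast
    qed
  qed
  have E_const: "E j = E r" if "j \<ge> r" for j
    using that by (induction j rule: int_ge_induct) (simp_all add: E_step)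
  have Er: "dm (E r) \<ge> 2"
  proof -
    define p0 q0 t0 where "p0 = coeff3 P 0 (nat e) 0" and "q0 = coeff3 Q 0 (nat e) 0" and "t0 = coeff3 T 0 (nat e) 0"
    have ker: "\<exists>w. rho f = X * w" if "f \<in> Hm e" "coeff3 f 0 (nat e) 0 = 0" for f
    proof -
      have "coeff3 (rho f) 0 j k = 0" for j k
      proof (rule ccontr)
        assume 0: "coeff3 (rho f) 0 j k \<noteq> 0"
        then have "k = 0" by (simp add: coeff3_rho split: if_splits)
        moreover have "int (0 + j + k) = e" using 0 rho_Hm[OF that(1)] unfolding Hm_def by blast
        then have "nat e = j" using \<open>k = 0\<close> by simp
        ultimately show False using 0 that(2) by (simp add: coeff3_rho)
      qed
      then show ?thesis by (rule X_dvdI) blast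
    qed
    have "p0 \<noteq> 0 \<or> q0 \<noteq> 0"
    proof (rule ccontr)
      assume "\<not> (p0 \<noteq> 0 \<or> q0 \<noteq> 0)"
      then have "X dvd p" "X dvd q" using ker[OF PQ(1)] ker[OF PQ(2)] by (auto simp: p0_def q0_def dvd_def)
      then have "is_unit X" using cop_rho coprime_common_divisor by blast
      then show False using unit_not_Hm[OF X_Hm] by simp
    qed
    \<comment> \<open>The Koszul syzygies have degree e \<ge> r, so their values at the point lie in
      the stable space \<open>E r\<close>. Two of them are independent as soon as \<open>p0\<close>
      or \<open>q0\<close> is nonzero.\<close>
    moreover have k: "(Q, - P, 0) \<in> syz g e" "(T, 0, - P) \<in> syz g e" "(0, T, - Q) \<in> syz g e"
      using PQ T Hm_uminus by (simp_all add: syz_def H3_def lc_def algebra_simps)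
    have "pt e (Q, - P, 0) \<in> E e" "pt e (T, 0, - P) \<in> E e" "pt e (0, T, - Q) \<in> E e"
      unfolding E_def using k by blast+
    then have E: "(q0, - p0, 0) \<in> E r" "(t0, 0, - p0) \<in> E r" "(0, t0, - q0) \<in> E r"
      using E_const[OF er(1)] by (simp_all add: pt_def p0_def q0_def t0_def)
    have ind2: "2 \<le> dm (E r)" if uv: "u \<in> E r" "v \<in> E r" "v \<noteq> 0" "\<And>s. u \<noteq> csc s v" for u v
    proof -
      have "CV.independent {v}" using uv(3) by simp
      moreover have "u \<notin> CV.span {v}" using uv(4) by (auto simp: CV.span_singleton)
      ultimately have ind: "CV.independent {u, v}" by (rule CV.independent_insertI[rotated])
      have "u \<noteq> v" using uv(4)[of 1] by simp
      then have "CV.dim {u, v} = 2" using CV.dim_eq_card_independent[OF ind] by simp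
      then show ?thesis using fd_dim_mono[OF fE[of r], of "{u, v}"] uv by simp
    qed
    ultimately show ?thesis
    proof (elim disjE)
      assume "p0 \<noteq> 0"
      then show ?thesis using ind2[OF E(1,2)] by (auto simp: csc_prod_def csc_complex_def zero_prod_def)
    next
      assume "q0 \<noteq> 0"
      then show ?thesis using ind2[OF E(1,3)] by (auto simp: csc_prod_def csc_complex_def zero_prod_def)
    qed
  qed
  have step: "dm (N (j + 1)) \<ge> dm (N j) + 2" if j: "j \<ge> r" for j
  proof -
    have j0: "j \<ge> 0" using j er by simp
    have "scale3 X ` N j \<subseteq> {v \<in> N (j + 1). pt (j + 1) v = 0}"
    proof
      fix x assume "x \<in> scale3 X ` N j"
      then obtain v where v: "v \<in> syz g j" "x = scale3 X (rho3 v)" by blast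
      have "scale3 X v \<in> syz g (j + 1)" using syz_scale3[OF X_Hm v(1)] by (simp add: add.commute)
      moreover have "x = rho3 (scale3 X v)" by (simp add: v rho3_scale3)
      ultimately have "x \<in> N (j + 1)" by blast
      then show "x \<in> {v \<in> N (j + 1). pt (j + 1) v = 0}" by (simp add: v(2) pt_XYZ(1)[OF j0])
    qed
    moreover have "fd {v \<in> N (j + 1). pt (j + 1) v = 0}"
      by (rule fd_subset[OF subspace_ker[OF clpt fd_subspace[OF fd_N]] fd_N]) auto
    ultimately have "dm (scale3 X ` N j) \<le> dm {v \<in> N (j + 1). pt (j + 1) v = 0}"
      by (intro of_nat_mono fd_dim_mono)
    moreover have "pt (j + 1) ` N (j + 1) = E r"
      using E_const[of "j + 1"] j by (simp add: image_image pt_rho3 E_def)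
    ultimately show ?thesis
      using rank_nullity[OF clpt fd_N, of "j + 1" "j + 1"] dim_scale3[OF _ fd_N, of X j] Er by simp
  qed
  have Nj: "dm (N j) \<ge> 2 * j - e + 2" if "j \<ge> r" for j
    using that
  proof (induction j rule: int_ge_induct)
    case base
    then show ?case using dim_rho3_syz[of g r] hr r[of "r - 1"] by simp
  next
    case (step j)
    then show ?case using \<open>\<And>j. j \<ge> r \<Longrightarrow> dm (N j) + 2 \<le> dm (N (j + 1))\<close>[of j] by simp
  qed
  \<comment> \<open>The increment of the Hilbert function is the dimension of
    \<open>N (j + 1)\<close> minus 2(j + 1) - e + 2, hence nonnegative by \<open>Nj\<close>.\<close>
  have "A (j + e) \<ge> A (r - 1 + e)" if "j \<ge> r - 1" for j
    using that
  proof (induction j rule: int_ge_induct)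
    case (step j)
    have "A (j + 1 + e) - A (j + e) \<ge> 0"
      using adim_h[of j] adim_h[of "j + 1"] dim_Hm_diff[of "j + 1"] dim_Hm_diff[of "j + 1 + e"]
        dim_rho3_syz[of g "j + 1"] Nj[of "j + 1"] step(1) er e by (simp add: algebra_simps)
    then show ?case using step by simp
  qed simp
  from this[of "2 * e - 2"] show ?thesis
    using er e by (cases "2 * e - 2 \<ge> r - 1") (simp_all add: tau_def algebra_simps)
qed

end

end

section \<open>Changes of coordinates\<close>

text \<open>Dimensions of the syzygy spaces and their generation in consecutive degrees are all that has
  to be compared between two triples of forms.\<close>

definition syz_equiv :: "triple \<Rightarrow> triple \<Rightarrow> bool" where
  "syz_equiv g g' \<longleftrightarrow> (\<forall>j. dm (syz g j) = dm (syz g' j)) \<and>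
     (\<forall>j. syz g (j + 1) \<subseteq> L3 (syz g j) \<longleftrightarrow> syz g' (j + 1) \<subseteq> L3 (syz g' j))"

lemma syz_equiv_refl: "syz_equiv g g"
  and syz_equiv_trans: "syz_equiv g g' \<Longrightarrow> syz_equiv g' g'' \<Longrightarrow> syz_equiv g g''"
  by (simp_all add: syz_equiv_def)

text \<open>Compatibility with \<open>L3\<close> is asked in place of linearity over S, because a
  coordinate change moves the variables themselves.\<close>

lemma syz_equivI:
  assumes cl: "clinear F" "clinear G" and inv: "\<And>v. F (G v) = v" "\<And>v. G (F v) = v"
    and im: "\<And>j v. v \<in> syz g j \<Longrightarrow> F v \<in> syz g' j" "\<And>j v. v \<in> syz g' j \<Longrightarrow> G v \<in> syz g j"
    and L: "\<And>V. CV.subspace V \<Longrightarrow> F ` L3 V \<subseteq> L3 (F ` V)" "\<And>V. CV.subspace V \<Longrightarrow> G ` L3 V \<subseteq> L3 (G ` V)"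
  shows "syz_equiv g g'"
proof -
  have F: "F ` syz g j = syz g' j" for j
    using im inv by (metis (no_types, lifting) image_eqI image_subsetI subsetI subset_antisym)
  have G: "G ` syz g' j = syz g j" for j
    using im inv by (metis (no_types, lifting) image_eqI image_subsetI subsetI subset_antisym)
  have "dm (F ` syz g j) = dm (syz g j)" for j
    by (rule dim_inj_image[OF cl(1) fd_syz]) (metis inv(2) clinearD(3)[OF cl(2)])
  moreover have "syz g' (j + 1) \<subseteq> L3 (syz g' j)" if "syz g (j + 1) \<subseteq> L3 (syz g j)" for j
    using image_mono[OF that, of F] L(1)[OF sub_syz, of g j] F by simp
  moreover have "syz g (j + 1) \<subseteq> L3 (syz g j)" if "syz g' (j + 1) \<subseteq> L3 (syz g' j)" for j
    using image_mono[OF that, of G] L(2)[OF sub_syz, of g' j] G by simp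
  ultimately show ?thesis unfolding syz_equiv_def F by metis
qed

lemma L3_scale3_commute:
  assumes "clinear F" "\<And>s v. F (scale3 s v) = scale3 s (F v)"
  shows "F ` L3 V \<subseteq> L3 (F ` V)"
proof
  fix x assume "x \<in> F ` L3 V"
  then obtain u v w where "u \<in> V" "v \<in> V" "w \<in> V" "x = F (scale3 X u + scale3 Y v + scale3 Z w)"
    unfolding L3_def by blast
  moreover from this have "x = scale3 X (F u) + scale3 Y (F v) + scale3 Z (F w)"
    by (simp add: clinearD[OF assms(1)] assms(2))
  ultimately show "x \<in> L3 (F ` V)" unfolding L3_def by blast
qed

lemma syz_equiv_swap12: "syz_equiv (a, b, c) (b, a, c)"
  and syz_equiv_swap13: "syz_equiv (a, b, c) (c, b, a)"
proof -
  let ?F = "\<lambda>v :: triple. (fst (snd v), fst v, snd (snd v))"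
  let ?G = "\<lambda>v :: triple. (snd (snd v), fst (snd v), fst v)"
  have cl: "clinear ?F" "clinear ?G" by (auto intro!: clinearI simp: csc_prod_def)
  show "syz_equiv (a, b, c) (b, a, c)"
    by (rule syz_equivI[OF cl(1,1)]; (rule L3_scale3_commute[OF cl(1)])?)
      (auto simp: syz_def H3_def lc_def scale3_eq algebra_simps)
  show "syz_equiv (a, b, c) (c, b, a)"
    by (rule syz_equivI[OF cl(2,2)]; (rule L3_scale3_commute[OF cl(2)])?)
      (auto simp: syz_def H3_def lc_def scale3_eq algebra_simps)
qed

lemma syz_equiv_add: "syz_equiv (a, b, c) (a, b + csc t c, c)"
proof -
  let ?F = "\<lambda>s (v :: triple). (fst v, fst (snd v), snd (snd v) - csc s (fst (snd v)))"
  have cl: "clinear (?F s)" for s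
    by (auto intro!: clinearI simp: csc_prod_def csc_add_right CV.scale_right_diff_distrib mult.commute)
  show ?thesis
    by (rule syz_equivI[OF cl[of t] cl[of "- t"]]; (rule L3_scale3_commute[OF cl])?)
      (auto simp: syz_def H3_def lc_def scale3_eq algebra_simps csc_mult_left csc_mult_right
        intro!: Hm_diff Hm_add Hm_csc)
qed

section \<open>Unipotent changes of coordinates\<close>

definition shear :: "complex \<Rightarrow> complex \<Rightarrow> complex \<Rightarrow> poly3 \<Rightarrow> poly3" where
  "shear b c t = ev3 C3 X (Y + C3 b * X) (Z + C3 c * X + C3 t * Y)"

lemma rhom_shear: "rhom (shear b c t)"
  and shear_simps [simp]: "shear b c t (C3 s) = C3 s" "shear b c t X = X" "shear b c t Y = Y + C3 b * X"
    "shear b c t Z = Z + C3 c * X + C3 t * Y"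
  unfolding shear_def by (simp_all add: ev3 rhom_C)

lemma C3_simps: "C3 (s + t) = C3 s + C3 t" "C3 (s * t) = C3 s * C3 t" "C3 (- t) = - C3 t" "C3 (s - t) = C3 s - C3 t"
  by (simp_all add: rhomD[OF rhom_C(2)])

text \<open>The parameter \<open>t * b - c\<close> arises because the inverse must also undo the
  multiple of x that enters the image of z through y.\<close>

lemma shear_inverse: "shear (- b) (t * b - c) (- t) (shear b c t f) = f"
  by (rule rhom_ext3[OF rhom_compose[OF rhom_shear rhom_shear] rhom_id])
    (simp_all add: rhomD[OF rhom_shear] C3_simps algebra_simps)

lemma shear_inverse': "shear b c t (shear (- b) (t * b - c) (- t) f) = f"
  using shear_inverse[of "- b" "- t" "t * b - c" f] by simp

lemma clinear_shear: "clinear (shear b c t)"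
  by (rule clinearI) (simp_all add: csc_poly3 rhomD[OF rhom_shear])

lemma heval_monom: "rhom h \<Longrightarrow> heval h x (monom a n) = h a * x ^ n"
  by (cases "a = 0") (simp_all add: heval_def map_poly_monom poly_monom rhomD)

text \<open>Evaluating the extra variable of \<open>grd\<close> at \<open>s\<close> multiplies each
  variable by \<open>s\<close>. This serves for the homogeneity of shears, for scaling a point, and
  for restricting a form in y, z to a line.\<close>

lemma graded_ext:
  assumes g: "rhom g" and h: "rhom h"
    and eq: "\<And>t. g (C3 t) = h (C3 t)" "g X = h X * s" "g Y = h Y * s" "g Z = h Z * s" and f: "f \<in> Hm (int n)"
  shows "g f = h f * s ^ n"
proof -
  have "g f = heval h s (grd f)"
  proof (rule rhom_ext3[OF g rhom_compose[OF rhom_heval[OF h] rhom_grd]])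
    show "g (C3 t) = heval h s (grd (C3 t))" for t
      by (simp add: grd_def ev3 rhom_C eq heval_const h)
  qed (simp_all add: grd_def ev3 rhom_C eq heval_monom h)
  then show ?thesis using f by (simp add: Hm_iff_grd heval_monom h)
qed

lemma shear_Hm: "f \<in> Hm n \<Longrightarrow> shear b c t f \<in> Hm n"
proof (cases "n < 0")
  case True
  then show "f \<in> Hm n \<Longrightarrow> ?thesis" by (simp add: Hm_neg rhomD[OF rhom_shear])
next
  case False
  then obtain m where m: "n = int m" by (metis nonneg_int_cases not_less)
  assume f: "f \<in> Hm n"
  have c: "rhom (\<lambda>p. [:p:] :: poly3 poly)" by (simp add: rhom_def flip: one_pCons)
  have v: "grd v = monom v 1" if "v \<in> Hm 1" for v using that Hm_iff_grd[of v 1] by simp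
  have c0: "grd (C3 t) = [:C3 t:]" for t using C3_Hm[of t] Hm_iff_grd[of "C3 t" 0] by (simp add: monom_0)
  have C: "C3 s * v \<in> Hm 1" if "v \<in> Hm 1" for s v using Hm_mult[OF C3_Hm that] by simp
  have lin: "shear b c t X \<in> Hm 1" "shear b c t Y \<in> Hm 1" "shear b c t Z \<in> Hm 1"
    by (simp_all add: X_Hm Y_Hm Z_Hm C Hm_add)
  have "grd (shear b c t f) = [:shear b c t f:] * (monom 1 1) ^ m"
    by (rule graded_ext[OF rhom_compose[OF rhom_grd rhom_shear] rhom_compose[OF c rhom_shear]])
      (use v[OF lin(1)] v[OF lin(2)] v[OF lin(3)] c0 f m in \<open>simp_all add: smult_monom\<close>)
  also have "\<dots> = monom (shear b c t f) m" by (simp add: smult_monom monom_power)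
  finally show "shear b c t f \<in> Hm n" using m Hm_iff_grd by blast
qed

lemma syz_equiv_shear: "syz_equiv (P, Q, T) (shear b c t P, shear b c t Q, shear b c t T)"
proof -
  let ?F = "\<lambda>b c t v. (shear b c t (fst v), shear b c t (fst (snd v)), shear b c t (snd (snd v)))"
  have cl: "clinear (?F b c t)" for b c t
    by (rule clinearI) (simp_all add: csc_prod_def clinearD[OF clinear_shear])
  have syz: "?F b c t v \<in> syz (?F b c t g) j" if "v \<in> syz g j" for b c t v g j
  proof -
    have "lc (?F b c t g) (?F b c t v) = shear b c t (lc g v)"
      by (simp add: lc_def rhomD[OF rhom_shear])
    then show ?thesis using that by (simp add: syz_def H3_def mem_Times_iff shear_Hm rhomD[OF rhom_shear])
  qed
  have L: "?F b c t ` L3 V \<subseteq> L3 (?F b c t ` V)" if V: "CV.subspace V" for b c t V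
  proof
    fix x assume "x \<in> ?F b c t ` L3 V"
    then obtain u v w where uvw: "u \<in> V" "v \<in> V" "w \<in> V"
      "x = ?F b c t (scale3 X u + scale3 Y v + scale3 Z w)" unfolding L3_def by blast
    \<comment> \<open>Expanding the images of y and z, all three summands contribute multiples of x,
      and two of them multiples of y.\<close>
    let ?u = "u + csc b v + csc c w" and ?v = "v + csc t w"
    have "?u \<in> V" "?v \<in> V"
      using uvw(1-3) CV.subspace_add[OF V] CV.subspace_scale[OF V] by blast+
    moreover have "x = scale3 X (?F b c t ?u) + scale3 Y (?F b c t ?v) + scale3 Z (?F b c t w)"
      unfolding uvw(4)
      by (simp add: scale3_eq rhomD[OF rhom_shear] csc_prod_def clinearD[OF clinear_shear] csc_poly3 algebra_simps)
    ultimately show "x \<in> L3 (?F b c t ` V)" unfolding L3_def using uvw(3) by blast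
  qed
  show ?thesis
  proof (rule syz_equivI[OF cl[of b c t] cl[of "- b" "t * b - c" "- t"]])
    show "?F (- b) (t * b - c) (- t) v \<in> syz (P, Q, T) j"
      if "v \<in> syz (shear b c t P, shear b c t Q, shear b c t T) j" for v j
      using syz[OF that, of "- b" "t * b - c" "- t"] by (simp add: shear_inverse)
    show "?F b c t v \<in> syz (shear b c t P, shear b c t Q, shear b c t T) j" if "v \<in> syz (P, Q, T) j" for v j
      using syz[OF that, of b c t] by simp
  qed (simp_all add: shear_inverse shear_inverse' L)
qed

section \<open>General position\<close>

definition evp :: "complex \<Rightarrow> complex \<Rightarrow> complex \<Rightarrow> poly3 \<Rightarrow> complex" where
  "evp a b c f = poly (poly (poly f [:[:c:]:]) [:b:]) a"

lemma rhom_evp: "rhom (evp a b c)"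
  by (simp add: rhom_def evp_def)

lemma evp_simps [simp]: "evp a b c (C3 t) = t" "evp a b c X = a" "evp a b c Y = b" "evp a b c Z = c"
  by (simp_all add: evp_def xyz_defs)

lemma poly_nonvanishing:
  fixes p :: "'a::idom poly" and h :: "complex \<Rightarrow> 'a"
  assumes "p \<noteq> 0" "inj h"
  obtains c where "poly p (h c) \<noteq> 0"
proof -
  have "finite (h -` {x. poly p x = 0})"
    by (rule finite_vimageI[OF poly_roots_finite[OF assms(1)] assms(2)])
  then have "h -` {x. poly p x = 0} \<noteq> UNIV" using infinite_UNIV_char_0 by metis
  then show ?thesis using that by blast
qed

lemma evp_nonvanishing:
  assumes "f \<noteq> 0"
  obtains a b c where "evp a b c f \<noteq> 0"
proof -
  obtain c where c: "poly f [:[:c:]:] \<noteq> 0"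
    by (rule poly_nonvanishing[OF assms, of "\<lambda>c. [:[:c:]:]"]) (simp_all add: inj_def)
  obtain b where b: "poly (poly f [:[:c:]:]) [:b:] \<noteq> 0"
    by (rule poly_nonvanishing[OF c, of "\<lambda>b. [:b:]"]) (simp_all add: inj_def)
  obtain a where a: "poly (poly (poly f [:[:c:]:]) [:b:]) a \<noteq> 0"
    by (rule poly_nonvanishing[OF b, of "\<lambda>a. a"]) (simp_all add: inj_def)
  then show ?thesis using that by (simp add: evp_def)
qed

lemma evp_scale: "f \<in> Hm (int n) \<Longrightarrow> evp (a * s) (b * s) (c * s) f = evp a b c f * s ^ n"
  by (rule graded_ext[OF rhom_evp rhom_evp]) simp_all

lemma evp_shear: "evp a b' c' (shear b c t f) = evp a (b' + b * a) (c' + c * a + t * b') f"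
  by (rule rhom_ext3[OF rhom_compose[OF rhom_evp rhom_shear] rhom_evp]) (simp_all add: rhomD[OF rhom_evp])

lemma evp_X: "f \<in> Hm (int n) \<Longrightarrow> evp 1 0 0 f = coeff3 f n 0 0"
proof -
  assume f: "f \<in> Hm (int n)"
  define p where "p = coeff (coeff f 0) 0"
  have "p = monom (coeff3 f n 0 0) n"
  proof (rule poly_eqI)
    fix i
    have "int (i + 0 + 0) = int n" if "coeff3 f i 0 0 \<noteq> 0" using f that unfolding Hm_def by blast
    then show "coeff p i = coeff (monom (coeff3 f n 0 0) n) i" by (auto simp: p_def coeff3_def)
  qed
  moreover have "evp 1 0 0 f = poly p 1" by (simp add: evp_def p_def poly_0_coeff_0)
  ultimately show ?thesis by (simp add: poly_monom)
qed

definition no_common :: "triple \<Rightarrow> bool" where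
  "no_common g \<longleftrightarrow> (\<forall>u. u dvd fst g \<and> u dvd fst (snd g) \<and> u dvd snd (snd g) \<longrightarrow> is_unit u)"

lemma shear_unit: "is_unit (shear b c t u) \<Longrightarrow> is_unit u"
  using rhom_dvd[OF rhom_shear, of "shear b c t u" 1 "- b" "t * b - c" "- t"]
  by (simp add: shear_inverse rhomD[OF rhom_shear])

lemma coprime_shear:
  assumes "coprime f g"
  shows "coprime (shear b c t f) (shear b c t g)"
proof (rule coprimeI)
  fix u assume u: "u dvd shear b c t f" "u dvd shear b c t g"
  let ?s = "shear (- b) (t * b - c) (- t)"
  have "?s u dvd f" "?s u dvd g"
    using rhom_dvd[OF rhom_shear u(1), of "- b" "t * b - c" "- t"]
      rhom_dvd[OF rhom_shear u(2), of "- b" "t * b - c" "- t"] by (simp_all add: shear_inverse)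
  then have "is_unit (?s u)" using assms coprime_common_divisor by blast
  then show "is_unit u" by (rule shear_unit)
qed

text \<open>A prime factor of \<open>f\<close> divides \<open>g + c h\<close> for at most one scalar \<open>c\<close>.\<close>

lemma coprime_combination:
  assumes nc: "no_common (f, g, h)" and f: "f \<noteq> 0"
  obtains c where "coprime f (g + csc c h)"
proof -
  have "\<exists>c. coprime f (g + csc c h)"
  proof (rule ccontr)
    assume neg: "\<nexists>c. coprime f (g + csc c h)"
    have "\<exists>u. u \<in> prime_factors f \<and> u dvd g + csc c h" for c
    proof -
      have "\<not> is_unit (gcd f (g + csc c h))" using neg by (simp add: coprime_iff_gcd_eq_1)
      moreover have "gcd f (g + csc c h) \<noteq> 0" using f by simp
      ultimately obtain u where "u dvd gcd f (g + csc c h)" "prime u"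
        using prime_divisor_exists by blast
      then show ?thesis using f by (intro exI[of _ u]) (simp add: in_prime_factors_iff)
    qed
    then obtain u where u: "\<And>c. u c \<in> prime_factors f" "\<And>c. u c dvd g + csc c h" by metis
    have "inj u"
    proof (rule injI, rule ccontr)
      fix c c' assume eq: "u c = u c'" and ne: "c \<noteq> c'"
      have "u c dvd (g + csc c h) - (g + csc c' h)" using u(2) eq by (metis dvd_diff)
      also have "(g + csc c h) - (g + csc c' h) = csc (c - c') h"
        by (simp add: CV.scale_left_diff_distrib)
      finally have "u c dvd C3 (inverse (c - c')) * csc (c - c') h" by (rule dvd_mult)
      also have "\<dots> = h" using ne by (simp flip: csc_poly3 add: csc_csc)
      finally have h: "u c dvd h" .
      then have "u c dvd csc c h" by (simp add: csc_poly3)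
      then have "u c dvd g" using u(2)[of c] by (simp add: dvd_add_left_iff)
      moreover have "u c dvd f" "prime (u c)" using u(1)[of c] by auto
      ultimately have "is_unit (u c)" using nc h unfolding no_common_def fst_conv snd_conv by blast
      then show False using \<open>prime (u c)\<close> not_prime_unit by blast
    qed
    then have "infinite (range u)" using finite_imageD infinite_UNIV_char_0 by blast
    then show False using u(1) finite_subset[of "range u" "prime_factors f"] by blast
  qed
  then show ?thesis using that by blast
qed

lemma supp_in_mono: "A \<subseteq> B \<Longrightarrow> supp_in A \<subseteq> supp_in B"
  unfolding supp_in_def by blast

text \<open>In degree \<open>n\<close> the ideal \<open>(P,Q)\<close> has codimension \<open>e\<^sup>2\<close>, whereas the forms in \<open>y, z\<close> have
  dimension \<open>n + 1\<close>.\<close>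

lemma elimination:
  assumes e: "e \<ge> 1" and PQ: "P \<in> Hm e" "Q \<in> Hm e" and cop: "coprime P Q" and nz: "P \<noteq> 0" "Q \<noteq> 0"
  obtains n R where "R \<in> supp_in {(i, j, k). i = 0 \<and> j + k = n}" "R \<in> ci Hm e P Q (int n)" "R \<noteq> 0"
proof -
  \<comment> \<open>The term e^2 makes n + 1 exceed the codimension of the ideal; 2e keeps n - 2e in
    the range of \<open>dim_Hm\<close>.\<close>
  define n where "n = nat (e * e + 2 * e)"
  have n: "int n = e * e + 2 * e" using e by (simp add: n_def)
  let ?I = "{(i, j, k). i = 0 \<and> j + k = n}"
  let ?V = "supp_in ?I" and ?C = "ci Hm e P Q (int n)"
  have I: "?I = (\<lambda>j. (0, j, n - j)) ` {..n}" by (auto simp: image_iff)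
  have "finite ?I" "card ?I = n + 1"
    unfolding I by (rule finite_imageI[OF finite_atMost], subst card_image) (auto simp: inj_on_def)
  note I2 = this
  note D = dim_supp_in[OF I2(1), unfolded I2(2)]
  have "fd ?V" by (rule conjunct1[OF D])
  moreover have "dm ?V = int n + 1" by (simp only: conjunct2[OF D])
  ultimately have V: "fd ?V" "dm ?V = int n + 1" .
  have C: "fd ?C" by (rule fd_ci[OF fd_Hm])
  have VH: "?V \<subseteq> Hm (int n)" unfolding Hm_supp_in by (rule supp_in_mono) auto
  have CH: "?C \<subseteq> Hm (int n)"
    unfolding ci_def using Hm_mult[OF _ PQ(1), of _ "int n - e"] Hm_mult[OF _ PQ(2), of _ "int n - e"]
    by (auto intro!: Hm_add)
  have "dm ?C = 2 * dm (Hm (int n - e)) - dm (Hm (int n - 2 * e))"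
    by (rule dim_ci(2)[OF fd_Hm cop nz]) (use Hm_mult PQ Hm_cancel[OF _ PQ(2) nz(2)] in auto)
  moreover have "- 2 \<le> int n" "- 2 \<le> int n - e" "- 2 \<le> int n - 2 * e"
    using n e zero_le_square[of e] by linarith+
  ultimately have "2 * dm (Hm (int n)) - 2 * dm ?C = 2 * e * e"
    using dim_Hm[of "int n"] dim_Hm[of "int n - e"] dim_Hm[of "int n - 2 * e"] n by (simp add: algebra_simps)
  moreover have "dm (ssum ?V ?C) \<le> dm (Hm (int n))"
  proof (intro of_nat_mono fd_dim_mono[OF fd_Hm] subsetI)
    fix x assume "x \<in> ssum ?V ?C"
    then obtain v w where "x = v + w" "v \<in> ?V" "w \<in> ?C" unfolding ssum_def by blast
    then show "x \<in> Hm (int n)" using subsetD[OF VH] subsetD[OF CH] Hm_add by blast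
  qed
  ultimately have "dm (?V \<inter> ?C) > 0" using dim_ssum[OF V(1) C] V(2) n e by (simp add: algebra_simps)
  then have "?V \<inter> ?C \<noteq> {0}" by auto
  moreover have "0 \<in> ?V \<inter> ?C"
    using CV.subspace_0[OF fd_subspace[OF V(1)]] CV.subspace_0[OF fd_subspace[OF C]] by blast
  ultimately show ?thesis using that by blast
qed

lemma prime_elem_Y: "prime_elem Y"
  unfolding Y_def by (simp add: prime_elem_const_poly_iff prime_elem_linear_poly)

definition sigma :: "poly3 \<Rightarrow> poly3" where "sigma = ev3 C3 0 Y Z"

lemma rhom_sigma: "rhom sigma"
  and sigma_simps [simp]: "sigma (C3 t) = C3 t" "sigma X = 0" "sigma Y = Y" "sigma Z = Z"
  unfolding sigma_def by (simp_all add: ev3 rhom_C)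

lemma coeff3_sigma: "coeff3 (sigma f) i j k = (if i = 0 then coeff3 f 0 j k else 0)"
proof -
  note h1 = rhom_C(2) and h2 = rhom_heval[OF rhom_C(2), of 0]
  note h3 = rhom_heval[OF h2, of Y]
  have 1: "heval C3 0 p = C3 (coeff p 0)" for p
    by (cases p) (simp add: heval_pCons[OF h1])
  have 2: "coeff3 (heval (heval C3 0) Y p) i j k = (if i = 0 \<and> k = 0 then coeff (coeff p j) 0 else 0)" for p i j k
    by (induction p arbitrary: j)
      (auto simp: heval_pCons[OF h2] 1 coeff3_C3 coeff3_Y coeff_pCons split: nat.splits)
  have "coeff3 (heval (heval (heval C3 0) Y) Z f) i j k = (if i = 0 then coeff (coeff (coeff f k) j) 0 else 0)"
    by (induction f arbitrary: k)
      (auto simp: heval_pCons[OF h3] 2 coeff3_Z coeff_pCons split: nat.splits)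
  then show ?thesis by (simp add: sigma_def ev3_def coeff3_def)
qed

lemma rho_C3 [simp]: "rho (C3 t) = C3 t"
  by (simp add: rho_def C3_def)

text \<open>Common factors on the line are controlled by elimination: the ideal of two of the forms
  contains a nonzero form R in y and z, and on a general line through (1:0:0) R restricts to a
  nonzero multiple of a power of y. A common prime factor could then only be y, which the nonzero
  value of P at (1:0:0) excludes.\<close>

lemma general_position:
  assumes e: "e \<ge> 1" and g: "g1 \<in> Hm e" "g2 \<in> Hm e" "g3 \<in> Hm e" and nc: "no_common (g1, g2, g3)"
  obtains P Q T where "plane_triple e P Q T" "syz_equiv (g1, g2, g3) (P, Q, T)"
proof -
  obtain m where m: "e = int m" using e nonneg_int_cases[of e] by auto
  obtain f1 f2 f3 where f: "f1 \<in> Hm e" "f2 \<in> Hm e" "f3 \<in> Hm e" "no_common (f1, f2, f3)" "f1 \<noteq> 0"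
    "syz_equiv (g1, g2, g3) (f1, f2, f3)"
  proof -
    have "\<not> (g1 = 0 \<and> g2 = 0 \<and> g3 = 0)" using nc by (auto simp: no_common_def dest: spec[of _ 0])
    then consider "g1 \<noteq> 0" | "g2 \<noteq> 0" | "g3 \<noteq> 0" by blast
    then show ?thesis
    proof cases
      case 1
      then show ?thesis using that[of g1 g2 g3] g nc syz_equiv_refl by blast
    next
      case 2
      have "no_common (g2, g1, g3)" using nc by (auto simp: no_common_def)
      then show ?thesis using that[of g2 g1 g3] g 2 syz_equiv_swap12 by blast
    next
      case 3
      have "no_common (g3, g2, g1)" using nc by (auto simp: no_common_def)
      then show ?thesis using that[of g3 g2 g1] g 3 syz_equiv_swap13 by blast
    qed
  qed
  obtain c where cop: "coprime f1 (f2 + csc c f3)" by (rule coprime_combination[OF f(4,5)])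
  define f2' where "f2' = f2 + csc c f3"
  have f2': "f2' \<in> Hm e" unfolding f2'_def using f Hm_add Hm_csc by blast
  \<comment> \<open>The factor \<open>X\<close> forces a point with nonzero first coordinate, which
    a shear can take to (1:0:0).\<close>
  have "X * f1 \<noteq> 0" using f(5) by simp
  then obtain a b0 c0 where "evp a b0 c0 (X * f1) \<noteq> 0" by (rule evp_nonvanishing)
  then have a: "a \<noteq> 0" "evp a b0 c0 f1 \<noteq> 0" by (simp_all add: rhomD[OF rhom_evp])
  have "evp a b0 c0 f1 = evp 1 (b0 / a) (c0 / a) f1 * a ^ m"
    using evp_scale[of f1 m 1 a "b0 / a" "c0 / a"] f(1) a m by simp
  then have ev: "evp 1 (b0 / a) (c0 / a) f1 \<noteq> 0" using a by auto
  let ?s = "shear (b0 / a) (c0 / a) 0"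
  define P0 Q0 T0 where "P0 = ?s f1" and "Q0 = ?s f2'" and "T0 = ?s f3"
  have H0: "P0 \<in> Hm e" "Q0 \<in> Hm e" "T0 \<in> Hm e"
    unfolding P0_def Q0_def T0_def using f f2' by (auto intro: shear_Hm)
  have cop0: "coprime P0 Q0" unfolding P0_def Q0_def f2'_def by (rule coprime_shear[OF cop])
  have ev0: "evp 1 0 0 P0 \<noteq> 0" unfolding P0_def evp_shear using ev by simp
  have nz: "P0 \<noteq> 0" "Q0 \<noteq> 0"
    using cop0 unit_not_Hm[OF H0(2) e] unit_not_Hm[OF H0(1) e] by auto
  obtain n R where R: "R \<in> supp_in {(i, j, k). i = 0 \<and> j + k = n}" "R \<in> ci Hm e P0 Q0 (int n)" "R \<noteq> 0"
    by (rule elimination[OF e H0(1,2) cop0 nz])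
  have RH: "R \<in> Hm (int n)"
    unfolding Hm_supp_in by (rule subsetD[OF supp_in_mono R(1)]) auto
  have sR: "sigma R = R"
    using R(1) by (intro poly3_eqI) (force simp: coeff3_sigma supp_in_def)
  \<comment> \<open>Likewise \<open>Y\<close> provides a point with nonzero second coordinate; its
    first coordinate may be replaced by 0, as R does not involve x.\<close>
  have "Y * R \<noteq> 0" using R(3) by simp
  then obtain a1 b1 c1 where "evp a1 b1 c1 (Y * R) \<noteq> 0" by (rule evp_nonvanishing)
  then have b1: "b1 \<noteq> 0" "evp a1 b1 c1 R \<noteq> 0" by (simp_all add: rhomD[OF rhom_evp])
  have "evp a1 b1 c1 (sigma R) = evp 0 b1 c1 R"
    by (rule rhom_ext3[OF rhom_compose[OF rhom_evp rhom_sigma] rhom_evp]) (simp_all add: rhomD[OF rhom_evp])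
  also have "\<dots> = evp 0 1 (c1 / b1) R * b1 ^ n"
    using evp_scale[OF RH, of 0 b1 1 "c1 / b1"] b1 by simp
  finally have tR: "evp 0 1 (c1 / b1) R \<noteq> 0" using b1 sR by auto
  let ?t = "shear 0 0 (c1 / b1)"
  define P Q T where "P = ?t P0" and "Q = ?t Q0" and "T = ?t T0"
  have H: "P \<in> Hm e" "Q \<in> Hm e" "T \<in> Hm e"
    unfolding P_def Q_def T_def using H0 by (auto intro: shear_Hm)
  \<comment> \<open>This last shear fixes (1:0:0), so the nonvanishing there survives.\<close>
  have evP: "evp 1 0 0 P \<noteq> 0" unfolding P_def evp_shear using ev0 by simp
  have rhoR: "rho (?t R) = C3 (evp 0 1 (c1 / b1) R) * Y ^ n"
  proof -
    \<comment> \<open>Composing with \<open>sigma\<close> sends x to 0, so that all three variables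
      go to scalar multiples of \<open>Y\<close>, as \<open>graded_ext\<close> requires.\<close>
    have "rho (?t (sigma R)) = C3 (evp 0 1 (c1 / b1) R) * Y ^ n"
      by (rule graded_ext[OF rhom_compose[OF rhom_rho rhom_compose[OF rhom_shear rhom_sigma]]
            rhom_compose[OF rhom_C(2) rhom_evp] _ _ _ _ RH])
        (simp_all add: rhomD[OF rhom_rho] rhomD[OF rhom_shear] rhomD[OF rhom_C(2)])
    then show ?thesis by (simp add: sR)
  qed
  obtain u v where uv: "R = u * P0 + v * Q0" using R(2) by (auto simp: ci_def)
  have rR: "rho (?t R) = rho (?t u) * rho P + rho (?t v) * rho Q"
    unfolding uv P_def Q_def by (simp add: rhomD[OF rhom_rho] rhomD[OF rhom_shear])
  have "coprime (rho P) (rho Q)"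
  proof (rule coprimeI, rule ccontr)
    fix w assume w: "w dvd rho P" "w dvd rho Q" "\<not> is_unit w"
    have "w dvd rho (?t R)" unfolding rR using w(1,2) by simp
    then have wY: "w dvd C3 (evp 0 1 (c1 / b1) R) * Y ^ n" by (simp add: rhoR)
    have "C3 (inverse (evp 0 1 (c1 / b1) R)) * (C3 (evp 0 1 (c1 / b1) R) * Y ^ n) = Y ^ n"
      using tR by (simp flip: csc_poly3 add: csc_csc)
    then have "w dvd Y ^ n" using dvd_mult[OF wY] by metis
    moreover have "w \<noteq> 0" using \<open>w dvd Y ^ n\<close> by auto
    ultimately obtain w0 where w0: "w0 dvd w" "prime w0" "w0 dvd Y ^ n"
      using prime_divisor_exists[of w] w(3) dvd_trans by blast
    then have "w0 dvd Y" using prime_dvd_power by blast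
    then have "Y dvd w0"
      using prime_elem_Y w0(2) by (metis irreducibleD' not_prime_unit prime_elem_imp_irreducible)
    then have "Y dvd rho P" using w0(1) w(1) dvd_trans by blast
    then obtain z where "rho P = Y * z" by auto
    then have "coeff3 P m 0 0 = 0" using coeff3_rho[of P m 0 0] by (simp add: coeff3_Y)
    then show False using evP evp_X H(1) m by simp
  qed
  moreover have "coprime P Q" unfolding P_def Q_def by (rule coprime_shear[OF cop0])
  ultimately have "plane_triple e P Q T" using e H by unfold_locales
  moreover have "syz_equiv (g1, g2, g3) (P, Q, T)"
    unfolding P_def Q_def T_def P0_def Q0_def T0_def f2'_def
    using f(6) syz_equiv_add[of f1 f2 f3 c] syz_equiv_shear syz_equiv_trans by meson
  ultimately show ?thesis by (rule that)
qed

section \<open>Jacobian ideals of reduced curves\<close>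

lemma map_poly_derivation:
  fixes D :: "'a::comm_ring_1 \<Rightarrow> 'a"
  assumes add: "\<And>a b. D (a + b) = D a + D b" and mult: "\<And>a b. D (a * b) = D a * b + a * D b"
  shows "map_poly D (p * q) = map_poly D p * q + p * map_poly D q"
proof (rule poly_eqI)
  have 0: "D 0 = 0" using add[of 0 0] by (metis add_cancel_right_right)
  have sum: "D (sum h A) = (\<Sum>a\<in>A. D (h a))" if "finite A" for h :: "nat \<Rightarrow> 'a" and A
    using that by (induction A) (simp_all add: 0 add)
  fix n
  show "coeff (map_poly D (p * q)) n = coeff (map_poly D p * q + p * map_poly D q) n"
    by (simp add: coeff_map_poly 0 coeff_mult sum mult sum.distrib)
qed

lemma map_poly_additive:
  fixes D :: "'a::comm_ring_1 \<Rightarrow> 'a"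
  assumes "\<And>a b. D (a + b) = D a + D b"
  shows "map_poly D (p + q) = map_poly D p + map_poly D q"
proof -
  have "D 0 = 0" using assms[of 0 0] by (metis add_cancel_right_right)
  then show ?thesis by (intro poly_eqI) (simp add: coeff_map_poly assms)
qed

lemma dx_mult: "dx (f * g) = dx f * g + f * dx g"
  and dy_mult: "dy (f * g) = dy f * g + f * dy g"
  and dz_mult: "dz (f * g) = dz f * g + f * dz g"
proof -
  have 0: "pderiv (p * q) = pderiv p * q + p * pderiv q" for p q :: "'a::idom poly"
    by (simp add: pderiv_mult algebra_simps)
  have 1: "map_poly pderiv (p * q) = map_poly pderiv p * q + p * map_poly pderiv q" for p q :: "'a::idom poly poly"
    by (rule map_poly_derivation) (simp_all add: pderiv_add 0)
  show "dx (f * g) = dx f * g + f * dx g"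
    unfolding dx_def by (rule map_poly_derivation) (simp_all add: map_poly_additive pderiv_add 1)
  show "dy (f * g) = dy f * g + f * dy g" unfolding dy_def by (rule 1)
  show "dz (f * g) = dz f * g + f * dz g" unfolding dz_def by (rule 0)
qed

lemma dx_Hm: "f \<in> Hm n \<Longrightarrow> dx f \<in> Hm (n - 1)"
  and dy_Hm: "f \<in> Hm n \<Longrightarrow> dy f \<in> Hm (n - 1)"
  and dz_Hm: "f \<in> Hm n \<Longrightarrow> dz f \<in> Hm (n - 1)"
proof -
  assume f: "f \<in> Hm n"
  then have deg: "int (i + j + k) = n" if "coeff3 f i j k \<noteq> 0" for i j k
    using that unfolding Hm_def by blast
  have 1: "int (i + j + k) = n - 1" if "coeff3 (dx f) i j k \<noteq> 0" for i j k
    using deg[of "Suc i" j k] that by (simp add: coeff3_dx)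
  have 2: "int (i + j + k) = n - 1" if "coeff3 (dy f) i j k \<noteq> 0" for i j k
    using deg[of i "Suc j" k] that by (simp add: coeff3_dy)
  have 3: "int (i + j + k) = n - 1" if "coeff3 (dz f) i j k \<noteq> 0" for i j k
    using deg[of i j "Suc k"] that by (simp add: coeff3_dz)
  show "dx f \<in> Hm (n - 1)" unfolding Hm_def using 1 by blast
  show "dy f \<in> Hm (n - 1)" unfolding Hm_def using 2 by blast
  show "dz f \<in> Hm (n - 1)" unfolding Hm_def using 3 by blast
qed

lemma euler:
  assumes "f \<in> Hm (int n)"
  shows "X * dx f + Y * dy f + Z * dz f = csc (of_nat n) f"
proof (rule poly3_eqI)
  fix i j k
  have "coeff3 (X * dx f + Y * dy f + Z * dz f) i j k = of_nat (i + j + k) * coeff3 f i j k"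
    by (auto simp: coeff3_X coeff3_Y coeff3_Z coeff3_dx coeff3_dy coeff3_dz algebra_simps split: nat.split)
  also have "\<dots> = of_nat n * coeff3 f i j k"
  proof (cases "coeff3 f i j k = 0")
    case False
    then have "int (i + j + k) = int n" using assms unfolding Hm_def by blast
    then show ?thesis by (simp only: of_nat_eq_iff)
  qed simp
  finally show "coeff3 (X * dx f + Y * dy f + Z * dz f) i j k = coeff3 (csc (of_nat n) f) i j k" by simp
qed

lemma dvd_pderiv:
  fixes p :: "'a::{idom,semiring_char_0} poly"
  assumes "p dvd pderiv p" "p \<noteq> 0"
  shows "degree p = 0"
proof (rule ccontr)
  assume "degree p \<noteq> 0"
  then have "pderiv p \<noteq> 0" by (simp add: pderiv_eq_0_iff)
  then have "degree p \<le> degree (pderiv p)" using assms(1) dvd_imp_degree_le by blast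
  then show False using \<open>degree p \<noteq> 0\<close> by (simp add: degree_pderiv)
qed

text \<open>In characteristic 0 a nonzero polynomial dividing its own derivative has degree 0;
  applied to z, y and x in turn, this leaves a constant.\<close>

lemma dvd_partials_unit:
  assumes "u dvd dx u" "u dvd dy u" "u dvd dz u" "u \<noteq> 0"
  shows "is_unit u"
proof -
  have "degree u = 0" using dvd_pderiv[of u] assms unfolding dz_def by blast
  then obtain v where v: "u = [:v:]" using degree_eq_zeroE by blast
  have "v dvd pderiv v" using assms(2) by (simp add: v dy_def map_poly_pCons)
  then have "degree v = 0" using dvd_pderiv[of v] assms(4) v by auto
  then obtain w where w: "v = [:w:]" using degree_eq_zeroE by blast
  have "w dvd pderiv w" using assms(1) by (simp add: v w dx_def map_poly_pCons)
  then have "degree w = 0" using dvd_pderiv[of w] assms(4) v w by auto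
  then obtain t where "w = [:t:]" using degree_eq_zeroE by blast
  then show ?thesis using v w assms(4) by (auto simp: is_unit_const_poly_iff dvd_field_iff)
qed

definition grad :: "poly3 \<Rightarrow> triple" where "grad f = (dx f, dy f, dz f)"

text \<open>By Euler's relation a prime \<open>w\<close> dividing all partial derivatives divides f
  = w h. The product rule makes \<open>w\<close> divide its own partial derivatives times h, and
  squarefreeness excludes \<open>w dvd h\<close>.\<close>

lemma squarefree_no_common:
  assumes f: "f \<in> Hm (int d)" "d \<ge> 1" and sf: "squarefree f"
  shows "no_common (grad f)"
  unfolding no_common_def
proof (intro allI impI)
  fix u assume "u dvd fst (grad f) \<and> u dvd fst (snd (grad f)) \<and> u dvd snd (snd (grad f))"
  then have u: "u dvd dx f" "u dvd dy f" "u dvd dz f" by (simp_all add: grad_def)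
  have div_f: "v dvd f" if v: "v dvd dx f" "v dvd dy f" "v dvd dz f" for v
  proof -
    have "v dvd csc (of_nat d) f" unfolding euler[OF f(1), symmetric] using v by simp
    then have "v dvd C3 (inverse (of_nat d)) * csc (of_nat d) f" by (rule dvd_mult)
    also have "\<dots> = f" using f(2) by (simp flip: csc_poly3 add: csc_csc)
    finally show ?thesis .
  qed
  have "f \<noteq> 0"
    using squarefreeD[OF sf, of X] unit_not_Hm[OF X_Hm] by auto
  show "is_unit u"
  proof (rule ccontr)
    assume nu: "\<not> is_unit u"
    have "u \<noteq> 0" using div_f[OF u] \<open>f \<noteq> 0\<close> by auto
    then obtain w where w: "w dvd u" "prime w" using prime_divisor_exists nu by blast
    have w0: "w \<noteq> 0" "\<not> is_unit w" using w(2) by auto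
    have wf: "w dvd dx f" "w dvd dy f" "w dvd dz f" using u w(1) dvd_trans by blast+
    obtain h where h: "f = w * h" using div_f[OF wf] by auto
    have nh: "\<not> w dvd h"
    proof
      assume "w dvd h"
      then have "w\<^sup>2 dvd f" by (simp add: h power2_eq_square)
      then show False using squarefreeD[OF sf] w0 by blast
    qed
    have "w dvd dx w * h" "w dvd dy w * h" "w dvd dz w * h"
      using wf unfolding h dx_mult dy_mult dz_mult by (simp_all add: dvd_add_left_iff)
    then have "w dvd dx w" "w dvd dy w" "w dvd dz w"
      using w(2) nh by (simp_all add: prime_dvd_mult_iff)
    then show False using dvd_partials_unit w0 by blast
  qed
qed

section \<open>Graded modules of syzygies\<close>

lemma AR_eq: "AR f = {v. lc (grad f) v = 0}"
  by (auto simp: AR_def lc_def grad_def)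

lemma homogeneous_triple_iff: "homogeneous_triple n v \<longleftrightarrow> v \<in> H3 (int n)"
  by (auto simp: homogeneous_triple_def homogeneous_iff H3_def split: prod.splits)

definition cmp3 :: "nat \<Rightarrow> triple \<Rightarrow> triple" where
  "cmp3 n v = (cmp n (fst v), cmp n (fst (snd v)), cmp n (snd (snd v)))"

lemma cmp3_H3: "cmp3 n v \<in> H3 (int n)"
  by (simp add: cmp3_def H3_def cmp_Hm)

lemma cmp3_of_H3: "v \<in> H3 m \<Longrightarrow> cmp3 n v = (if int n = m then v else 0)"
  by (cases v) (auto simp: cmp3_def H3_def cmp_of_Hm zero_prod_def)

lemma cmp3_sum: "cmp3 n (sum h A) = (\<Sum>a\<in>A. cmp3 n (h a))"
proof -
  have "cmp3 n (a + b) = cmp3 n a + cmp3 n b" "cmp3 n 0 = 0" for a b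
    by (simp_all add: cmp3_def cmp_linear zero_prod_def)
  then show ?thesis by (induction A rule: infinite_finite_induct) simp_all
qed

lemma cmp3_scale3:
  assumes "v \<in> H3 (int m)"
  shows "cmp3 n (scale3 s v) = (if m \<le> n then scale3 (cmp (n - m) s) v else 0)"
  using assms by (simp add: cmp3_def scale3_eq H3_def mem_Times_iff cmp_mult[where e = m] zero_prod_def)

lemma sum_cmp3:
  obtains N where "v = (\<Sum>n\<le>N. cmp3 n v)"
proof -
  obtain N1 where N1: "\<And>M. M \<ge> N1 \<Longrightarrow> fst v = (\<Sum>n\<le>M. cmp n (fst v))" by (rule sum_cmp[of "fst v"]) blast
  obtain N2 where N2: "\<And>M. M \<ge> N2 \<Longrightarrow> fst (snd v) = (\<Sum>n\<le>M. cmp n (fst (snd v)))"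
    by (rule sum_cmp[of "fst (snd v)"]) blast
  obtain N3 where N3: "\<And>M. M \<ge> N3 \<Longrightarrow> snd (snd v) = (\<Sum>n\<le>M. cmp n (snd (snd v)))"
    by (rule sum_cmp[of "snd (snd v)"]) blast
  have sum_pair: "(\<Sum>n\<le>M. (a n, b n, c n)) = (\<Sum>n\<le>M. a n, \<Sum>n\<le>M. b n, \<Sum>n\<le>M. c n)"
    for M and a b c :: "nat \<Rightarrow> poly3"
    by (induction M) simp_all
  let ?N = "max N1 (max N2 N3)"
  have "v = (\<Sum>n\<le>?N. cmp3 n v)"
    unfolding cmp3_def sum_pair using N1[of ?N] N2[of ?N] N3[of ?N] by (simp add: prod_eq_iff)
  then show ?thesis by (rule that)
qed

lemma cmp3_syz:
  assumes g: "g \<in> H3 (int e)" and v: "lc g v = 0"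
  shows "cmp3 n v \<in> syz g (int n)"
proof -
  have "lc g (cmp3 n v) = cmp (n + e) (lc g v)"
    using g by (simp add: lc_def cmp3_def cmp_linear H3_def mem_Times_iff cmp_mult[where e = e])
  then show ?thesis using v cmp3_H3 by (simp add: syz_def cmp_linear)
qed

subsection \<open>The Tjurina number\<close>

text \<open>\<open>SOME\<close> selects an unknown quotient basis, so one must exist and all must
  have this cardinality: joined to a basis of \<open>W\<close>, each becomes a basis of
  \<open>V\<close>.\<close>

lemma quotient_dim:
  assumes V: "fd V" and W: "CV.subspace W" "W \<subseteq> V"
  shows "int (quotient_dim V W) = dm V - dm W"
proof -
  have card: "int (card B) = dm V - dm W" if B: "quotient_basis V W B" for B
  proof -
    have B1: "B \<subseteq> V" "V \<subseteq> CV.span (W \<union> B)" "\<And>b. b \<in> B \<Longrightarrow> b \<notin> CV.span (W \<union> (B - {b}))"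
      using B unfolding quotient_basis_def cscale_eq_csc by blast+
    obtain W0 where W0: "W0 \<subseteq> W" "finite W0" "CV.independent W0" "CV.span W0 = W" "card W0 = CV.dim W"
      by (rule fd_basis[OF fd_subset[OF W(1) V W(2)]])
    \<comment> \<open>Finite parts are treated first: \<open>B\<close> is not yet known to be
      finite, and an infinite set would have \<open>card\<close> 0.\<close>
    have ind: "finite B' \<Longrightarrow> B' \<subseteq> B \<Longrightarrow> CV.independent (W0 \<union> B') \<and> W0 \<inter> B' = {}" for B'
    proof (induction B' rule: finite_induct)
      case (insert b B')
      have "W0 \<union> B' \<subseteq> W \<union> (B - {b})" using W0(1) insert by blast
      then have "b \<notin> CV.span (W0 \<union> B')" using B1(3)[of b] insert.prems CV.span_mono by blast
      moreover from this have "b \<notin> W0" using CV.span_base by blast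
      ultimately show ?case using insert CV.independent_insertI[of b "W0 \<union> B'"] by simp
    qed (simp add: W0)
    have fin: "finite B"
    proof (rule ccontr)
      assume "infinite B"
      then obtain B' where B': "B' \<subseteq> B" "finite B'" "card B' = CV.dim V + 1"
        using infinite_arbitrarily_large by blast
      have "CV.independent B'" using ind[OF B'(2,1)] CV.independent_mono by blast
      then have "CV.dim B' = CV.dim V + 1" using CV.dim_eq_card_independent B'(3) by metis
      moreover have "CV.dim B' \<le> CV.dim V" using B' B1(1) by (intro fd_dim_mono[OF V]) blast
      ultimately show False by simp
    qed
    have i: "CV.independent (W0 \<union> B)" "W0 \<inter> B = {}" using ind[OF fin] by auto
    have "W \<union> B \<subseteq> CV.span (W0 \<union> B)"
      using W0(4) CV.span_mono[of W0 "W0 \<union> B"] CV.span_superset[of "W0 \<union> B"] by blast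
    then have "V \<subseteq> CV.span (W0 \<union> B)" using B1(2) CV.span_minimal[OF _ CV.subspace_span] by blast
    moreover have "W0 \<union> B \<subseteq> V" using W0(1) W(2) B1(1) by blast
    ultimately have "card (W0 \<union> B) = CV.dim V" using CV.basis_card_eq_dim i(1) by blast
    then show ?thesis using card_Un_disjoint[OF W0(2) fin i(2)] W0(5) by simp
  qed
  have "\<exists>B. quotient_basis V W B"
  proof -
    obtain B C where BC: "finite B" "finite C" "B \<inter> C = {}" "CV.independent (B \<union> C)"
      "CV.span B = W" "CV.span (B \<union> C) = V" "card B = CV.dim W" "card C = CV.dim V - CV.dim W" "C \<subseteq> V"
      by (rule fd_extend_basis[OF V W])
    have "V \<subseteq> CV.span (W \<union> C)"
      using BC(6) CV.span_mono[of "B \<union> C" "W \<union> C"] CV.span_superset[of B] BC(5) by blast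
    moreover have "c \<notin> CV.span (W \<union> (C - {c}))" if c: "c \<in> C" for c
    proof
      assume "c \<in> CV.span (W \<union> (C - {c}))"
      moreover have "W \<union> (C - {c}) \<subseteq> CV.span ((B \<union> C) - {c})"
        using BC(3,5) c CV.span_mono[of B "(B \<union> C) - {c}"] CV.span_superset[of "(B \<union> C) - {c}"] by blast
      ultimately have "c \<in> CV.span ((B \<union> C) - {c})"
        using CV.span_minimal[OF _ CV.subspace_span] by blast
      then show False using BC(4) c unfolding CV.dependent_def by blast
    qed
    ultimately show ?thesis using BC(9) unfolding quotient_basis_def cscale_eq_csc by blast
  qed
  then have "quotient_basis V W (SOME B. quotient_basis V W B)" by (rule someI_ex)
  then show ?thesis unfolding quotient_dim_def by (rule card)
qed

lemma milnor_hilbert_eq: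
  assumes g: "grad f \<in> H3 (int e)"
  shows "int (milnor_hilbert f k) = adim (grad f) (int e) (int k)"
proof -
  have H: "dx f \<in> Hm (int e)" "dy f \<in> Hm (int e)" "dz f \<in> Hm (int e)"
    using g by (simp_all add: grad_def H3_def)
  have "{p \<in> Hm (int k). p \<in> jacobian_ideal f} = jac (grad f) (int e) (int k)"
  proof (intro subset_antisym subsetI)
    fix p assume "p \<in> {p \<in> Hm (int k). p \<in> jacobian_ideal f}"
    then obtain a b c where p: "p \<in> Hm (int k)" "p = a * dx f + b * dy f + c * dz f"
      by (auto simp: jacobian_ideal_def)
    \<comment> \<open>The coefficients of an element of \<open>jacobian_ideal\<close> need not be
      homogeneous; their components of degree k - e already represent \<open>p\<close>.\<close>
    have eq: "p = cmp k (a * dx f) + cmp k (b * dy f) + cmp k (c * dz f)"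
      using cmp_of_Hm[OF p(1), of k] by (simp add: p(2) cmp_linear)
    show "p \<in> jac (grad f) (int e) (int k)"
    proof (cases "e \<le> k")
      case True
      let ?v = "(cmp (k - e) a, cmp (k - e) b, cmp (k - e) c)"
      have "p = lc (grad f) ?v"
        using eq True by (simp add: cmp_mult[OF H(1)] cmp_mult[OF H(2)] cmp_mult[OF H(3)] lc_def grad_def)
      moreover have "?v \<in> H3 (int k - int e)"
        using cmp_Hm[of "k - e"] True by (simp add: H3_def of_nat_diff)
      ultimately show ?thesis unfolding jac_def by blast
    next
      case False
      then have "p = 0"
        using eq by (simp add: cmp_mult[OF H(1)] cmp_mult[OF H(2)] cmp_mult[OF H(3)])
      then show ?thesis using CV.subspace_0[OF sub_jac] by metis
    qed
  next
    fix p assume "p \<in> jac (grad f) (int e) (int k)"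
    then obtain a b c where v: "a \<in> Hm (int k - int e)" "b \<in> Hm (int k - int e)" "c \<in> Hm (int k - int e)"
      "p = a * dx f + b * dy f + c * dz f"
      by (auto simp: jac_def H3_def lc_def grad_def)
    have "p \<in> Hm (int k)"
      using Hm_mult[OF v(1) H(1)] Hm_mult[OF v(2) H(2)] Hm_mult[OF v(3) H(3)] Hm_add v(4) by simp
    then show "p \<in> {p \<in> Hm (int k). p \<in> jacobian_ideal f}" using v(4) by (auto simp: jacobian_ideal_def)
  qed
  moreover from this have "jac (grad f) (int e) (int k) \<subseteq> Hm (int k)" by blast
  ultimately show ?thesis
    unfolding milnor_hilbert_def homogeneous_iff adim_def
    using quotient_dim[OF fd_Hm sub_jac, of "grad f" "int e" "int k"  "int k"] by simp
qed

lemma tjurina_eqI: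
  assumes "grad f \<in> H3 (int e)" "\<And>k. k \<ge> N \<Longrightarrow> adim (grad f) (int e) k = t"
  shows "int (tjurina f) = t"
proof -
  have ev: "\<forall>\<^sub>F k in sequentially. milnor_hilbert f k = nat t"
  proof (rule eventually_sequentiallyI)
    fix k assume "k \<ge> nat N"
    then show "milnor_hilbert f k = nat t" using milnor_hilbert_eq[OF assms(1), of k] assms(2)[of "int k"] by simp
  qed
  have "t \<ge> 0" using milnor_hilbert_eq[OF assms(1), of "nat N"] assms(2)[of "int (nat N)"] by simp
  have "tjurina f = nat t"
    unfolding tjurina_def
  proof (rule the_equality)
    show "\<forall>\<^sub>F k in sequentially. milnor_hilbert f k = nat t" by (rule ev)
    fix s assume "\<forall>\<^sub>F k in sequentially. milnor_hilbert f k = s"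
    with ev have "\<forall>\<^sub>F k in sequentially. s = nat t" by eventually_elim simp
    then show "s = nat t" by simp
  qed
  then show ?thesis using \<open>t \<ge> 0\<close> by simp
qed

section \<open>Linear resolutions\<close>

text \<open>Common ground of both directions: these hypotheses follow from extremal tau as well as
  from a minimal generating set in degree r. Nothing is assumed on the position of z, so
  \<open>g\<close> may be the original gradient.\<close>

locale linear_syzygies =
  fixes g :: triple and e r m :: nat and bs :: "triple list"
  assumes g: "g \<in> H3 (int e)"
    and low: "\<And>i. i < int r \<Longrightarrow> syz g i = {0}"
    and gen: "\<And>j. j \<ge> int r \<Longrightarrow> syz g (j + 1) \<subseteq> L3 (syz g j)"
    and bs: "distinct bs" "length bs = m" "CV.independent (set bs)" "CV.span (set bs) = syz g (int r)"
begin

abbreviation "h j \<equiv> dm (syz g j)"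

definition G :: "(nat \<Rightarrow> poly3) \<Rightarrow> triple" where
  "G u = (\<Sum>i<m. scale3 (u i) (bs ! i))"

lemma bs_syz: "i < m \<Longrightarrow> bs ! i \<in> syz g (int r)"
  using bs CV.span_base[of "bs ! i" "set bs"] by simp

lemma dim_syz_r: "h (int r) = int m"
  using CV.dim_eq_card_independent[OF bs(3)] CV.dim_span[of "set bs"] bs distinct_card by metis

lemma scale3_csc: "scale3 (csc t s) v = csc t (scale3 s v)"
  by (simp add: scale3_eq csc_prod_def csc_mult_left)

lemma clinear_G: "clinear G"
proof (rule clinearI)
  show "G (u + v) = G u + G v" for u v
    by (simp add: G_def S3.scale_left_distrib sum.distrib)
  show "G (csc t u) = csc t (G u)" for t u
    by (simp add: G_def csc_fun_def scale3_csc CV.scale_sum_right)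
qed

lemma G_mult: "G (\<lambda>i. s * u i) = scale3 s (G u)"
  by (simp add: G_def S3.scale_sum_right S3.scale_scale)

abbreviation "U n \<equiv> tuples m (Hm n)"

lemma fd_U: "fd (U n)" and dim_U: "dm (U n) = int m * dm (Hm n)"
  using dim_tuples[OF fd_Hm] by blast+

lemma U_mult: "s \<in> Hm a \<Longrightarrow> u \<in> U b \<Longrightarrow> (\<lambda>i. s * u i) \<in> U (a + b)"
  by (simp add: tuples_def Hm_mult)

lemma G_U: "u \<in> U n \<Longrightarrow> G u \<in> syz g (int r + n)"
  unfolding G_def by (intro CV.subspace_sum[OF sub_syz])
    (simp add: tuples_def syz_scale3[OF _ bs_syz] add.commute[of _ n])

lemma G_onto: "syz g (int r + n) \<subseteq> G ` U n"
proof (cases "n < 0")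
  case True
  have "0 \<in> G ` U n"
    using CV.subspace_0[OF fd_subspace[OF fd_U]] clinearD(3)[OF clinear_G] by (metis image_eqI)
  then show ?thesis using low[of "int r + n"] True by simp
next
  case False
  then have "n \<ge> 0" by simp
  then show ?thesis
  proof (induction n rule: int_ge_induct)
    case base
    show ?case
    proof
      fix v assume "v \<in> syz g (int r + 0)"
      then have "v \<in> CV.span (set bs)" using bs(4) by simp
      then obtain c where "v = (\<Sum>w\<in>set bs. csc (c w) w)"
        using CV.span_finite[of "set bs"] by auto
      also have "\<dots> = (\<Sum>i<m. csc (c (bs ! i)) (bs ! i))"
        using bs(1,2) by (intro sum.reindex_bij_betw[symmetric] bij_betw_nth) auto
      also have "\<dots> = G (\<lambda>i. if i < m then C3 (c (bs ! i)) else 0)"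
        unfolding G_def by (intro sum.cong) (simp_all add: scale3_eq csc_prod_def csc_poly3)
      finally have "v = G (\<lambda>i. if i < m then C3 (c (bs ! i)) else 0)" .
      moreover have "(\<lambda>i. if i < m then C3 (c (bs ! i)) else 0) \<in> U 0" by (simp add: tuples_def C3_Hm)
      ultimately show "v \<in> G ` U 0" by blast
    qed
  next
    case (step n)
    show ?case
    proof
      fix v assume "v \<in> syz g (int r + (n + 1))"
      then have "v \<in> L3 (syz g (int r + n))"
        using gen[of "int r + n"] step(1) by (auto simp: add.assoc)
      then obtain a b c where abc: "v = scale3 X a + scale3 Y b + scale3 Z c"
        "a \<in> syz g (int r + n)" "b \<in> syz g (int r + n)" "c \<in> syz g (int r + n)"
        unfolding L3_def by blast
      obtain a' where a': "a' \<in> U n" "a = G a'" using subsetD[OF step(2) abc(2)] by (rule imageE)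
      obtain b' where b': "b' \<in> U n" "b = G b'" using subsetD[OF step(2) abc(3)] by (rule imageE)
      obtain c' where c': "c' \<in> U n" "c = G c'" using subsetD[OF step(2) abc(4)] by (rule imageE)
      let ?u = "(\<lambda>i. X * a' i) + (\<lambda>i. Y * b' i) + (\<lambda>i. Z * c' i)"
      have "v = G ?u" by (simp add: abc(1) a' b' c' G_mult clinearD[OF clinear_G])
      moreover have "?u \<in> U (n + 1)"
        using U_mult[OF X_Hm a'(1)] U_mult[OF Y_Hm b'(1)] U_mult[OF Z_Hm c'(1)]
          CV.subspace_add[OF fd_subspace[OF fd_U]] by (simp only: add.commute[of 1])
      ultimately show "v \<in> G ` U (n + 1)" by blast
    qed
  qed
qed

lemma G_image: "G ` U n = syz g (int r + n)"
  using G_U G_onto by blast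

lemma range_G: "range G = {v. lc g v = 0}"
proof (intro subset_antisym subsetI)
  fix v assume "v \<in> range G"
  then obtain u where u: "v = G u" by blast
  have "lc g (bs ! i) = 0" if "i < m" for i using bs_syz[OF that] by (simp add: syz_def)
  then have "lc g (G u) = 0"
    unfolding G_def CVP.linear_sum[OF clinear_lc] by (simp add: lc_scale3)
  then show "v \<in> {v. lc g v = 0}" using u by simp
next
  fix v assume v: "v \<in> {v. lc g v = 0}"
  obtain M where M: "v = (\<Sum>n\<le>M. cmp3 n v)" by (rule sum_cmp3)
  have "cmp3 n v \<in> G ` U (int n - int r)" for n
    using cmp3_syz[OF g, of v n] v G_onto[of "int n - int r"] by auto
  then have "\<exists>u. cmp3 n v = G u" for n by blast
  then obtain u where "\<And>n. cmp3 n v = G (u n)" by metis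
  then have "v = G (\<Sum>n\<le>M. u n)" using M by (simp add: CVP.linear_sum[OF clinear_G])
  then show "v \<in> range G" by blast
qed

section \<open>Second syzygies\<close>

definition Pk :: "int \<Rightarrow> (nat \<Rightarrow> poly3) set" where
  "Pk n = {u \<in> U n. G u = 0}"

lemma sub_Pk: "CV.subspace (Pk n)"
  unfolding Pk_def by (rule subspace_ker[OF clinear_G fd_subspace[OF fd_U]])

lemma fd_Pk: "fd (Pk n)"
  by (rule fd_subset[OF sub_Pk fd_U]) (auto simp: Pk_def)

lemma dim_Pk_h: "dm (Pk n) = int m * dm (Hm n) - h (int r + n)"
  using rank_nullity[OF clinear_G fd_U[of n]] by (simp add: G_image dim_U Pk_def)

lemma Pk_mult: "s \<in> Hm a \<Longrightarrow> u \<in> Pk n \<Longrightarrow> (\<lambda>i. s * u i) \<in> Pk (n + a)"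
  using U_mult[of s a u n] by (simp add: Pk_def G_mult add.commute)

definition rhoT :: "(nat \<Rightarrow> poly3) \<Rightarrow> nat \<Rightarrow> poly3" where "rhoT u = (\<lambda>i. rho (u i))"

lemma clinear_rhoT: "clinear rhoT"
  by (rule clinearI) (auto simp: rhoT_def csc_fun_def clinearD[OF clinear_rho])

lemma clinear_multT: "clinear (\<lambda>(u :: nat \<Rightarrow> poly3) i. s * u i)"
  by (rule clinearI) (auto simp: csc_fun_def csc_mult_right algebra_simps)

lemma rho_tuple_0:
  assumes "u \<in> U n" "rhoT u = 0"
  obtains w where "w \<in> U (n - 1)" "u = (\<lambda>i. Z * w i)"
proof -
  have "\<exists>w. w \<in> Hm (n - 1) \<and> u i = Z * w" if "i < m" for i
  proof -
    have "u i \<in> Hm n" using assms(1) that by (simp add: tuples_def)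
    moreover have "rho (u i) = 0" using fun_cong[OF assms(2), of i] by (simp add: rhoT_def)
    ultimately show ?thesis by (metis rho_eq_0_Hm)
  qed
  then obtain w where w: "\<And>i. i < m \<Longrightarrow> w i \<in> Hm (n - 1) \<and> u i = Z * w i" by metis
  show ?thesis
  proof (rule that[of "\<lambda>i. if i < m then w i else 0"])
    show "(\<lambda>i. if i < m then w i else 0) \<in> U (n - 1)" using w by (simp add: tuples_def)
    show "u = (\<lambda>i. Z * (if i < m then w i else 0))"
      using w assms(1) by (auto simp: tuples_def fun_eq_iff)
  qed
qed

lemma ker_rhoT: "{u \<in> Pk n. rhoT u = 0} = (\<lambda>u i. Z * u i) ` Pk (n - 1)"
proof (intro subset_antisym subsetI)
  fix u assume u: "u \<in> {u \<in> Pk n. rhoT u = 0}"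
  then obtain w where w: "w \<in> U (n - 1)" "u = (\<lambda>i. Z * w i)"
    using rho_tuple_0[of u n] by (auto simp: Pk_def)
  have "scale3 Z (G w) = 0" using u by (simp add: Pk_def w(2) G_mult)
  then have "w \<in> Pk (n - 1)" using w(1) by (simp add: Pk_def scale3_eq_0)
  then show "u \<in> (\<lambda>u i. Z * u i) ` Pk (n - 1)" using w(2) by blast
next
  fix u assume "u \<in> (\<lambda>u i. Z * u i) ` Pk (n - 1)"
  then obtain w where w: "w \<in> Pk (n - 1)" "u = (\<lambda>i. Z * w i)" by blast
  then show "u \<in> {u \<in> Pk n. rhoT u = 0}"
    using Pk_mult[OF Z_Hm w(1)] by (auto simp: rhoT_def rhomD[OF rhom_rho])
qed

abbreviation "Qk n \<equiv> rhoT ` Pk n"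

lemma fd_Qk: "fd (Qk n)"
  by (rule fd_image[OF clinear_rhoT fd_Pk])

lemma dim_Qk_Pk: "dm (Qk n) = dm (Pk n) - dm (Pk (n - 1))"
proof -
  have "dm ((\<lambda>u i. Z * u i) ` Pk (n - 1)) = dm (Pk (n - 1))"
    by (rule dim_inj_image[OF clinear_multT fd_Pk]) (auto simp: fun_eq_iff)
  then show ?thesis using rank_nullity[OF clinear_rhoT fd_Pk[of n]] by (simp add: ker_rhoT)
qed

context
  assumes hdiff: "\<And>j. j \<ge> int r \<Longrightarrow> h j - h (j - 1) = 2 * j - int e + 2"
begin

lemma m_eq: "int m = 2 * int r - int e + 2"
  using hdiff[of "int r"] low[of "int r - 1"] dim_syz_r by simp

lemma dim_Qk: "n \<ge> 0 \<Longrightarrow> dm (Qk n) = (int m - 2) * n"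
proof -
  assume n: "n \<ge> 0"
  have "2 * (dm (Hm n) - dm (Hm (n - 1))) = 2 * (n + 1)"
    using dim_Hm[of n] dim_Hm[of "n - 1"] n by (simp add: algebra_simps)
  then have 1: "int m * (dm (Hm n) - dm (Hm (n - 1))) = int m * (n + 1)" by simp
  have r: "int r + (n - 1) = int r + n - 1" by simp
  have 2: "h (int r + n) - h (int r + (n - 1)) = int m + 2 * n"
    unfolding r using hdiff[of "int r + n"] m_eq n by simp
  have "dm (Qk n) = int m * (dm (Hm n) - dm (Hm (n - 1))) - (h (int r + n) - h (int r + (n - 1)))"
    using dim_Qk_Pk[of n] dim_Pk_h[of n] dim_Pk_h[of "n - 1"] by (simp only: right_diff_distrib)
  then show ?thesis unfolding 1 2 by (simp add: algebra_simps)
qed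

text \<open>These are the dimensions of m - 2 free summands generated in degree 1, as the resolution
  predicts. Summing \<open>dim_Qk\<close> starts at -1, where both sides are 0.\<close>

lemma dim_Pk: "n \<ge> -1 \<Longrightarrow> dm (Pk n) = (int m - 2) * dm (Hm (n - 1))"
proof (induction n rule: int_ge_induct)
  case base
  have "Pk (-1) \<subseteq> {0}" by (auto simp: Pk_def tuples_def Hm_neg fun_eq_iff) (metis not_less)
  then have "Pk (-1) = {0}" using CV.subspace_0[OF sub_Pk] by blast
  then show ?case by (simp add: Hm_neg)
next
  case (step n)
  have "dm (Hm n) - dm (Hm (n - 1)) = n + 1"
    using dim_Hm[of n] dim_Hm[of "n - 1"] step(1) by (simp add: algebra_simps)
  then have "(int m - 2) * dm (Hm n) = (int m - 2) * (dm (Hm (n - 1)) + n + 1)" by simp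
  then show ?case using dim_Qk_Pk[of "n + 1"] dim_Qk[of "n + 1"] step by (simp add: algebra_simps)
qed

text \<open>Division by y first yields only a tuple \<open>w\<close> of forms in x, y.
  \<open>G w\<close> is a syzygy vanishing on z = 0, hence z times some \<open>G w'\<close>;
  subtracting z times \<open>w'\<close> turns \<open>w\<close> into a relation with the same
  restriction.\<close>

lemma Qk_relation:
  assumes u: "u \<in> Qk n" "v \<in> Qk n" "(\<lambda>i. X * u i) = (\<lambda>i. Y * v i)"
  shows "\<exists>w\<in>Qk (n - 1). u = (\<lambda>i. Y * w i)"
proof -
  have "\<exists>w. v i = X * w \<and> u i = Y * w" for i
    using XY_relation[of "v i" "u i"] fun_cong[OF u(3), of i] by metis
  then obtain w where w: "\<And>i. u i = Y * w i" by metis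
  obtain \<pi> where \<pi>: "\<pi> \<in> U n" "G \<pi> = 0" "u = rhoT \<pi>" using u(1) by (auto simp: Pk_def)
  have rw: "rho (\<pi> i) = Y * w i" for i using fun_cong[OF \<pi>(3), of i] w by (simp add: rhoT_def)
  have wH: "w \<in> U (n - 1)"
  proof -
    have "w i \<in> Hm (n - 1)" if "i < m" for i
    proof -
      have "w i * Y \<in> Hm n" using rho_Hm[of "\<pi> i" n] \<pi>(1) that rw by (simp add: tuples_def mult.commute)
      then show ?thesis by (rule Hm_cancel[OF _ Y_Hm]) simp
    qed
    moreover have "w i = 0" if "i \<ge> m" for i using rw[of i] \<pi>(1) that by (simp add: tuples_def rhomD[OF rhom_rho])
    ultimately show ?thesis by (simp add: tuples_def)
  qed
  have rww: "rho (w i) = w i" for i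
  proof -
    have "Y * rho (w i) = rho (Y * w i)" by (simp add: rhomD[OF rhom_rho])
    also have "\<dots> = Y * w i" unfolding rw[symmetric] by simp
    finally show ?thesis by simp
  qed
  let ?d = "\<pi> - (\<lambda>i. Y * w i)"
  have "?d \<in> U n" using \<pi>(1) U_mult[OF Y_Hm wH] CV.subspace_diff[OF fd_subspace[OF fd_U]] by simp
  moreover have "rhoT ?d = 0" by (simp add: rhoT_def fun_eq_iff rhomD[OF rhom_rho] rw rww)
  ultimately obtain s where s: "s \<in> U (n - 1)" "?d = (\<lambda>i. Z * s i)" by (rule rho_tuple_0)
  have "- scale3 Y (G w) = scale3 Z (G s)"
    using arg_cong[OF s(2), of G] by (simp add: clinearD[OF clinear_G] G_mult \<pi>(2))
  then have "rho3 (scale3 Y (G w)) = rho3 (- scale3 Z (G s))" by (metis minus_minus)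
  then have "scale3 Y (rho3 (G w)) = 0"
    by (simp add: rho3_scale3 clinearD[OF clinear_rho3] scale3_eq_0)
  then have "rho3 (G w) = 0" by (simp add: scale3_eq_0)
  then have "G w \<in> scale3 Z ` syz g (int r + (n - 1) - 1)"
    unfolding ker_rho3[symmetric] using G_U[OF wH] by simp
  then obtain q where q: "q \<in> syz g (int r + (n - 1) - 1)" "G w = scale3 Z q" by blast
  have "int r + (n - 1) - 1 = int r + (n - 2)" by simp
  then obtain w' where w': "w' \<in> U (n - 2)" "q = G w'" using q(1) G_image[of "n - 2"] by (metis imageE)
  let ?w = "w - (\<lambda>i. Z * w' i)"
  have "?w \<in> U (n - 1)" using wH U_mult[OF Z_Hm w'(1)] CV.subspace_diff[OF fd_subspace[OF fd_U]] by simp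
  moreover have "G ?w = 0" using q(2) w'(2) by (simp add: clinearD[OF clinear_G] G_mult)
  moreover have "rhoT ?w = w" by (simp add: rhoT_def fun_eq_iff rhomD[OF rhom_rho] rww)
  ultimately have "w \<in> Qk (n - 1)" unfolding Pk_def by (metis (mono_tags, lifting) image_eqI mem_Collect_eq)
  then show ?thesis using w by blast
qed

text \<open>The dimensions (m - 2) n are linear in \<open>n\<close>, so by the growth relation x
  \<open>Qk n\<close> + y \<open>Qk n\<close> fills \<open>Qk (n + 1)\<close>; the kernel of
  restriction to z = 0 supplies the multiples of z.\<close>

lemma Pk_generation:
  assumes n: "n \<ge> 1" and u: "u \<in> Pk (n + 1)"
  obtains a b c where "a \<in> Pk n" "b \<in> Pk n" "c \<in> Pk n"
    "u = (\<lambda>i. X * a i) + (\<lambda>i. Y * b i) + (\<lambda>i. Z * c i)"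
proof -
  let ?X = "\<lambda>(u :: nat \<Rightarrow> poly3) i. X * u i" and ?Y = "\<lambda>(u :: nat \<Rightarrow> poly3) i. Y * u i"
  let ?S = "ssum (?X ` Qk n) (?Y ` Qk n)"
  have fS: "fd ?S" by (intro fd_ssum fd_image clinear_multT fd_Pk clinear_rhoT)
  have Qm: "(\<lambda>i. s * u i) \<in> Qk (n + 1)" if us: "u \<in> Qk n" "s \<in> Rm 1" for u s
  proof -
    obtain w where w: "w \<in> Pk n" "u = rhoT w" using us(1) by blast
    have "(\<lambda>i. s * u i) = rhoT (\<lambda>i. s * w i)"
      using us(2) by (simp add: w(2) rhoT_def rhomD[OF rhom_rho] Rm_rho)
    then show ?thesis using Pk_mult[OF Rm_Hm[OF us(2)] w(1)] by blast
  qed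
  have "?S = Qk (n + 1)"
  proof (rule fd_dim_eq[OF fd_Qk fd_subspace[OF fS]])
    show "?S \<subseteq> Qk (n + 1)"
    proof
      fix x assume "x \<in> ?S"
      then obtain a b where "x = ?X a + ?Y b" "a \<in> Qk n" "b \<in> Qk n" unfolding ssum_def by blast
      then show "x \<in> Qk (n + 1)"
        using Qm[OF _ X_Rm] Qm[OF _ Y_Rm] CV.subspace_add[OF fd_subspace[OF fd_Qk]] by simp
    qed
    have "dm ?S \<ge> 2 * dm (Qk n) - dm (Qk (n - 1))"
    proof (rule dim_two_mult[OF clinear_multT clinear_multT _ _ fd_Qk fd_Qk])
      fix u v assume "u \<in> Qk n" "v \<in> Qk n" "(\<lambda>i. X * u i) = (\<lambda>i. Y * v i)"
      then show "\<exists>w\<in>Qk (n - 1). u = (\<lambda>i. Y * w i)" by (rule Qk_relation)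
    qed (auto simp: fun_eq_iff)
    then show "CV.dim (Qk (n + 1)) \<le> CV.dim ?S"
      using dim_Qk[of n] dim_Qk[of "n - 1"] dim_Qk[of "n + 1"] n by (simp add: algebra_simps)
  qed
  then have "rhoT u \<in> ?S" using u by blast
  then obtain a b where ab: "a \<in> Pk n" "b \<in> Pk n" "rhoT u = ?X (rhoT a) + ?Y (rhoT b)"
    unfolding ssum_def by blast
  let ?d = "u - ?X a - ?Y b"
  have "?d \<in> Pk (n + 1)"
    using u Pk_mult[OF X_Hm ab(1)] Pk_mult[OF Y_Hm ab(2)] CV.subspace_diff[OF sub_Pk] by simp
  moreover have "rhoT ?d = 0"
    using fun_cong[OF ab(3)] by (simp add: fun_eq_iff rhoT_def rhomD[OF rhom_rho])
  ultimately obtain c where "c \<in> Pk n" "?d = (\<lambda>i. Z * c i)"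
    using ker_rhoT[of "n + 1"] by auto
  then show ?thesis using that[OF ab(1,2), of c] by (simp add: algebra_simps)
qed

text \<open>The columns of \<open>N\<close> are a basis of the linear relations \<open>Pk 1\<close>
  and generate all relations. Freeness is a dimension count: \<open>K\<close> maps k copies of
  \<open>Hm n\<close> onto \<open>Pk (n + 1)\<close>, which has the same dimension.\<close>

lemma linear_resolution:
  assumes m2: "m \<ge> 2"
  obtains N where "minimal_graded_free_resolution {v. lc g v = 0}
    (replicate m r) (replicate (m - 2) (r + 1)) (\<lambda>i. bs ! i) N"
proof -
  define k where "k = m - 2"
  have mk: "int m - 2 = int k" using m2 by (simp add: k_def)
  have dPk: "dm (Pk n) = int k * dm (Hm (n - 1))" if "n \<ge> -1" for n
    using dim_Pk[OF that] mk by simp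
  have Pk_0: "Pk n = {0}" if n: "n < 1" for n
  proof (cases "n < 0")
    case True
    have "u = 0" if "u \<in> Pk n" for u
    proof
      fix i show "u i = 0 i"
        using that Hm_neg[OF True] by (cases "i < m") (simp_all add: Pk_def tuples_def)
    qed
    then show ?thesis using CV.subspace_0[OF sub_Pk] by blast
  next
    case False
    then have "CV.dim (Pk n) = 0" using dPk[of n] n by (simp add: Hm_neg)
    then have "{0} = Pk n"
      using fd_dim_eq[OF fd_Pk CV.subspace_single_0] CV.subspace_0[OF sub_Pk] by simp
    then show ?thesis by simp
  qed
  obtain B where B: "B \<subseteq> Pk 1" "finite B" "CV.span B = Pk 1" "card B = CV.dim (Pk 1)"
    by (rule fd_basis[OF fd_Pk])
  obtain cs where cs: "set cs = B" "distinct cs" using finite_distinct_list[OF B(2)] by blast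
  have len: "length cs = k"
    using distinct_card[OF cs(2)] cs(1) B(4) dPk[of 1] dim_Hm[of 0] by simp
  have csP: "cs ! j \<in> Pk 1" if "j < k" for j
    using B(1) cs(1) len that nth_mem by blast
  have cs1: "(cs ! j) i \<in> Hm 1" if "j < k" for i j
    using csP[OF that] by (cases "i < m") (simp_all add: Pk_def tuples_def)
  define K :: "(nat \<Rightarrow> poly3) \<Rightarrow> nat \<Rightarrow> poly3" where "K v = (\<lambda>i. \<Sum>j<k. (cs ! j) i * v j)" for v
  have cK: "clinear K"
    by (rule clinearI)
      (auto simp: K_def csc_fun_def csc_mult_right CV.scale_sum_right sum.distrib algebra_simps)
  have K_sum: "K v = (\<Sum>j<k. (\<lambda>i. v j * (cs ! j) i))" for v
  proof
    fix i
    have "(\<Sum>j\<in>A. (\<lambda>i. v j * (cs ! j) i)) i = (\<Sum>j\<in>A. v j * (cs ! j) i)" if "finite A" for A :: "nat set"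
      using that by (induction A) simp_all
    then show "K v i = (\<Sum>j<k. (\<lambda>i. v j * (cs ! j) i)) i" by (simp add: K_def mult.commute)
  qed
  have K_mult: "K (\<lambda>j. s * v j) = (\<lambda>i. s * K v i)" for s v
    by (simp add: K_def sum_distrib_left ac_simps)
  let ?V = "\<lambda>n. tuples k (Hm n)"
  have KP: "K v \<in> Pk n" if "v \<in> ?V (n - 1)" for v n
    unfolding K_sum
  proof (rule CV.subspace_sum[OF sub_Pk])
    fix j assume "j \<in> {..<k}"
    then show "(\<lambda>i. v j * (cs ! j) i) \<in> Pk n"
      using Pk_mult[of "v j" "n - 1" "cs ! j" 1] csP that by (simp add: tuples_def)
  qed
  have PK1: "Pk n \<subseteq> K ` ?V (n - 1)" if "n \<ge> 1" for n
    using that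
  proof (induction n rule: int_ge_induct)
    case base
    show ?case
    proof
      fix u assume "u \<in> Pk 1"
      then obtain c where "u = (\<Sum>w\<in>B. csc (c w) w)" using B(3) CV.span_finite[OF B(2)] by auto
      also have "\<dots> = (\<Sum>j<k. csc (c (cs ! j)) (cs ! j))"
        using cs len by (intro sum.reindex_bij_betw[symmetric] bij_betw_nth) auto
      also have "\<dots> = K (\<lambda>j. if j < k then C3 (c (cs ! j)) else 0)"
        unfolding K_sum by (intro sum.cong) (simp_all add: csc_fun_def csc_poly3)
      finally have "u = K (\<lambda>j. if j < k then C3 (c (cs ! j)) else 0)" .
      moreover have "(\<lambda>j. if j < k then C3 (c (cs ! j)) else 0) \<in> ?V (1 - 1)"
        by (simp add: tuples_def C3_Hm)
      ultimately show "u \<in> K ` ?V (1 - 1)" by blast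
    qed
  next
    case (step n)
    show ?case
    proof
      fix u assume "u \<in> Pk (n + 1)"
      then obtain a b c where abc: "a \<in> Pk n" "b \<in> Pk n" "c \<in> Pk n"
        "u = (\<lambda>i. X * a i) + (\<lambda>i. Y * b i) + (\<lambda>i. Z * c i)"
        by (rule Pk_generation[OF step(1)])
      obtain a' where a': "a' \<in> ?V (n - 1)" "a = K a'" using subsetD[OF step(2) abc(1)] by (rule imageE)
      obtain b' where b': "b' \<in> ?V (n - 1)" "b = K b'" using subsetD[OF step(2) abc(2)] by (rule imageE)
      obtain c' where c': "c' \<in> ?V (n - 1)" "c = K c'" using subsetD[OF step(2) abc(3)] by (rule imageE)
      let ?v = "(\<lambda>i. X * a' i) + (\<lambda>i. Y * b' i) + (\<lambda>i. Z * c' i)"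
      have "u = K ?v" by (simp add: abc(4) a' b' c' K_mult clinearD[OF cK])
      have Vm: "(\<lambda>i. s * w i) \<in> ?V n" if "s \<in> Hm 1" "w \<in> ?V (n - 1)" for s w
        using that Hm_mult[OF that(1), of _ "n - 1"] by (simp add: tuples_def)
      have "CV.subspace (?V n)" by (rule fd_subspace[OF conjunct1[OF dim_tuples[OF fd_Hm]]])
      then have "?v \<in> ?V n"
        by (intro CV.subspace_add Vm[OF X_Hm a'(1)] Vm[OF Y_Hm b'(1)] Vm[OF Z_Hm c'(1)])
      then show "u \<in> K ` ?V (n + 1 - 1)" using \<open>u = K ?v\<close> by simp
    qed
  qed
  have PK: "Pk n \<subseteq> K ` ?V (n - 1)" for n
  proof (cases "n \<ge> 1")
    case False
    have "0 \<in> ?V (n - 1)" by (simp add: tuples_def)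
    then have "K 0 \<in> K ` ?V (n - 1)" by blast
    then show ?thesis using Pk_0[of n] False clinearD(3)[OF cK] by simp
  qed (rule PK1)
  have K_inj: "v = 0" if v: "v \<in> ?V n" "K v = 0" for v n
  proof (cases "n < 0")
    case True
    show ?thesis
    proof
      fix i show "v i = 0 i" using v(1) Hm_neg[OF True] by (cases "i < k") (simp_all add: tuples_def)
    qed
  next
    case False
    note V = dim_tuples[OF fd_Hm, of k n]
    let ?ker = "{v \<in> ?V n. K v = 0}"
    have "K ` ?V n = Pk (n + 1)" using KP[of _ "n + 1"] PK[of "n + 1"] by auto
    then have "dm ?ker = 0"
      using rank_nullity[OF cK conjunct1[OF V]] conjunct2[OF V] dPk[of "n + 1"] False by simp
    moreover have "fd ?ker"
      by (rule fd_subset[OF subspace_ker[OF cK fd_subspace[OF conjunct1[OF V]]] conjunct1[OF V]]) auto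
    moreover have "0 \<in> ?ker" by (simp add: tuples_def clinearD[OF cK])
    ultimately have "{0} = ?ker" using fd_dim_eq[OF _ CV.subspace_single_0, of ?ker] by simp
    then show ?thesis using v by blast
  qed
  have comps: "\<exists>M. \<forall>i<l. u i = (\<Sum>n\<le>M. cmp n (u i))" for u :: "nat \<Rightarrow> poly3" and l
  proof -
    have "\<exists>M0. \<forall>M\<ge>M0. u i = (\<Sum>n\<le>M. cmp n (u i))" for i by (metis sum_cmp)
    then obtain M0 where M0: "\<And>i M. M \<ge> M0 i \<Longrightarrow> u i = (\<Sum>n\<le>M. cmp n (u i))" by metis
    have "u i = (\<Sum>n\<le>Max (M0 ` {..<l}). cmp n (u i))" if "i < l" for i
      using that by (intro M0 Max_ge) auto
    then show ?thesis by blast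
  qed
  have sum_app: "(\<Sum>n\<in>A. w n) i = (\<Sum>n\<in>A. w n i)" for A :: "nat set" and w :: "nat \<Rightarrow> nat \<Rightarrow> poly3" and i
    by (induction A rule: infinite_finite_induct) simp_all
  define N where "N i j = (cs ! j) i" for i j
  have G_csj: "G (cs ! j) = 0" if "j < k" for j using csP[OF that] by (simp add: Pk_def)
  have ker_G: "G u = 0 \<longleftrightarrow> (\<exists>v. \<forall>i<m. u i = (\<Sum>j<k. N i j * v j))" for u
  proof
    assume u: "G u = 0"
    \<comment> \<open>A resolution leaves the values from \<open>m\<close> on arbitrary, while
      \<open>Pk\<close> demands zeros there.\<close>
    define u' where "u' i = (if i < m then u i else 0)" for i
    have "G u' = 0" using u by (simp add: G_def u'_def)
    have P: "(\<lambda>i. cmp n (u' i)) \<in> Pk (int n)" for n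
    proof -
      have "G (\<lambda>i. cmp n (u' i)) = cmp3 (n + r) (G u')"
        unfolding G_def cmp3_sum
      proof (intro sum.cong refl)
        fix i assume "i \<in> {..<m}"
        then have "bs ! i \<in> H3 (int r)" using bs_syz by (simp add: syz_def)
        then show "scale3 (cmp n (u' i)) (bs ! i) = cmp3 (n + r) (scale3 (u' i) (bs ! i))"
          by (simp add: cmp3_scale3)
      qed
      also have "\<dots> = 0" by (simp add: \<open>G u' = 0\<close> cmp3_def cmp_linear zero_prod_def)
      finally show ?thesis by (simp add: Pk_def tuples_def cmp_Hm u'_def cmp_linear)
    qed
    have "\<exists>v. (\<lambda>i. cmp n (u' i)) = K v" for n using PK P[of n] by blast
    then obtain v where v: "\<And>n. (\<lambda>i. cmp n (u' i)) = K (v n)" by metis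
    obtain M where M: "\<forall>i<m. u' i = (\<Sum>n\<le>M. cmp n (u' i))" using comps by blast
    have "u i = K (\<Sum>n\<le>M. v n) i" if "i < m" for i
    proof -
      have "u i = (\<Sum>n\<le>M. cmp n (u' i))" using M that by (simp add: u'_def)
      also have "\<dots> = (\<Sum>n\<le>M. K (v n) i)" using fun_cong[OF v] by simp
      also have "\<dots> = K (\<Sum>n\<le>M. v n) i" by (simp add: CVP.linear_sum[OF cK] sum_app)
      finally show ?thesis .
    qed
    then show "\<exists>v. \<forall>i<m. u i = (\<Sum>j<k. N i j * v j)" unfolding K_def N_def by blast
  next
    assume "\<exists>v. \<forall>i<m. u i = (\<Sum>j<k. N i j * v j)"
    then obtain v where "\<And>i. i < m \<Longrightarrow> u i = K v i" unfolding K_def N_def by blast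
    then have "G u = G (K v)" by (simp add: G_def)
    also have "\<dots> = 0" unfolding K_sum CVP.linear_sum[OF clinear_G] by (simp add: G_mult G_csj)
    finally show "G u = 0" .
  qed
  have inj: "v j = 0" if v: "\<forall>i<m. (\<Sum>j<k. N i j * v j) = 0" and j: "j < k" for v j
  proof -
    define v' where "v' i = (if i < k then v i else 0)" for i
    have Kv': "K v' i = 0" for i
    proof (cases "i < m")
      case True
      then show ?thesis using v by (simp add: K_def N_def v'_def)
    next
      case False
      then have "(cs ! j) i = 0" if "j < k" for j using csP[OF that] by (simp add: Pk_def tuples_def)
      then show ?thesis by (simp add: K_def)
    qed
    have "(\<lambda>j. cmp n (v' j)) = 0" for n
    proof (rule K_inj)
      show "(\<lambda>j. cmp n (v' j)) \<in> ?V (int n)" by (simp add: tuples_def cmp_Hm v'_def cmp_linear)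
      have "K (\<lambda>j. cmp n (v' j)) i = cmp (n + 1) (K v' i)" for i
        unfolding K_def cmp_linear
      proof (intro sum.cong refl)
        fix j assume "j \<in> {..<k}"
        then have "(cs ! j) i \<in> Hm (int 1)" using cs1 by simp
        then show "(cs ! j) i * cmp n (v' j) = cmp (n + 1) ((cs ! j) i * v' j)"
          using cmp_mult[of "(cs ! j) i" 1 "n + 1" "v' j"] by (simp add: mult.commute)
      qed
      then show "K (\<lambda>j. cmp n (v' j)) = 0" by (simp add: fun_eq_iff Kv' cmp_linear)
    qed
    then have "cmp n (v' j) = 0" for n by (metis zero_fun_apply)
    moreover obtain M where "v' j = (\<Sum>n\<le>M. cmp n (v' j))" using comps[of "Suc j" v'] by blast
    ultimately have "v' j = 0" by simp
    then show ?thesis using j by (simp add: v'_def)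
  qed
  have "minimal_graded_free_resolution {v. lc g v = 0} (replicate m r) (replicate k (r + 1)) (\<lambda>i. bs ! i) N"
    unfolding minimal_graded_free_resolution_def graded_free_resolution_def length_replicate
  proof (intro conjI)
    show "\<forall>i<m. homogeneous_triple (replicate m r ! i) (bs ! i)"
      using bs_syz by (simp add: homogeneous_triple_iff syz_def)
    show "\<forall>i<m. \<forall>j<k. if replicate m r ! i \<le> replicate k (r + 1) ! j
      then homogeneous (replicate k (r + 1) ! j - replicate m r ! i) (N i j) else N i j = 0"
      using cs1 by (simp add: homogeneous_iff N_def)
    show "range (\<lambda>u. \<Sum>i<m. scale3 (u i) (bs ! i)) = {v. lc g v = 0}"
      using range_G by (simp add: G_def[abs_def])
    show "\<forall>u. ((\<Sum>i<m. scale3 (u i) (bs ! i)) = 0) = (\<exists>v. \<forall>i<m. u i = (\<Sum>j<k. N i j * v j))"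
      using ker_G by (simp add: G_def)
    show "\<forall>v. (\<forall>i<m. (\<Sum>j<k. N i j * v j) = 0) \<longrightarrow> (\<forall>j<k. v j = 0)"
      using inj by blast
    show "\<forall>i<m. \<forall>j<k. coeff3 (N i j) 0 0 0 = 0"
      using cs1 unfolding N_def Hm_def by fastforce
  qed
  then show ?thesis using that by (simp add: k_def)
qed

end

end

section \<open>Minimal generators\<close>

lemma CV_span_S3_span: "CV.span H \<subseteq> S3.span H"
proof (rule CV.span_minimal[OF S3.span_superset])
  have "csc t v = scale3 (C3 t) v" for t and v :: triple
    by (simp add: scale3_eq csc_prod_def csc_poly3)
  then show "CV.subspace (S3.span H)"
    unfolding CV.subspace_def by (auto simp: S3.span_zero intro: S3.span_add S3.span_scale)
qed

lemma S3_subspace_ker: "S3.subspace {v. lc g v = 0}"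
  unfolding S3.subspace_def by (auto simp: clinearD[OF clinear_lc] lc_scale3)

text \<open>The graded Nakayama argument: generators of degree above \<open>r\<close> do not contribute in degree \<open>r\<close>.\<close>

lemma span_degree_part:
  assumes H: "\<And>a. a \<in> H \<Longrightarrow> \<exists>n\<ge>r. a \<in> H3 (int n)" and v: "v \<in> S3.span H" "v \<in> H3 (int r)"
  shows "v \<in> CV.span (H \<inter> H3 (int r))"
proof -
  obtain t c where t: "finite t" "t \<subseteq> H" "v = (\<Sum>a\<in>t. scale3 (c a) a)"
    using v(1) unfolding S3.span_explicit by blast
  have "v = cmp3 r v" using cmp3_of_H3[OF v(2), of r] by simp
  also have "\<dots> = (\<Sum>a\<in>t. cmp3 r (scale3 (c a) a))" by (simp only: t(3) cmp3_sum)
  also have "\<dots> \<in> CV.span (H \<inter> H3 (int r))"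
  proof (rule CV.span_sum)
    fix a assume "a \<in> t"
    then obtain n where n: "n \<ge> r" "a \<in> H3 (int n)" using t(2) H by blast
    show "cmp3 r (scale3 (c a) a) \<in> CV.span (H \<inter> H3 (int r))"
    proof (cases "n = r")
      case True
      have "cmp 0 (c a) = C3 (coeff3 (c a) 0 0 0)"
        by (rule poly3_eqI) (auto simp: coeff3_cmp coeff3_C3)
      then have "cmp3 r (scale3 (c a) a) = csc (coeff3 (c a) 0 0 0) a"
        using cmp3_scale3[OF n(2), of r "c a"] True by (simp add: scale3_eq csc_prod_def csc_poly3)
      moreover have "a \<in> H \<inter> H3 (int r)" using \<open>a \<in> t\<close> t(2) n(2) True by blast
      ultimately show ?thesis by (simp add: CV.span_base CV.span_scale)
    next
      case False
      then show ?thesis using cmp3_scale3[OF n(2), of r "c a"] n(1) CV.span_zero by simp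
    qed
  qed
  finally show ?thesis .
qed

lemma minimal_generators_independent:
  assumes "minimal_homogeneous_generators M H"
  shows "CV.independent H"
proof
  assume "CV.dependent H"
  then obtain a where a: "a \<in> H" "a \<in> CV.span (H - {a})" unfolding CV.dependent_def by blast
  have "H \<subseteq> S3.span (H - {a})"
    using a CV_span_S3_span[of "H - {a}"] S3.span_superset[of "H - {a}"] by blast
  then have "S3.span H \<subseteq> S3.span (H - {a})" by (rule S3.span_minimal) (rule S3.subspace_span)
  moreover have "S3.span (H - {a}) \<subseteq> S3.span H" by (rule S3.span_mono) blast
  moreover have "H - {a} \<subset> H" using a(1) by blast
  ultimately show False using assms unfolding minimal_homogeneous_generators_def by blast
qed

context linear_syzygies
begin

lemma span_basis:
  assumes "CV.span H = syz g (int r)"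
  shows "S3.span H = {v. lc g v = 0}"
proof
  have "H \<subseteq> {v. lc g v = 0}" using CV.span_superset[of H] assms by (auto simp: syz_def)
  then show "S3.span H \<subseteq> {v. lc g v = 0}" by (rule S3.span_minimal) (rule S3_subspace_ker)
  have "bs ! i \<in> S3.span H" if "i < m" for i
    using bs_syz[OF that] CV_span_S3_span[of H] assms by blast
  then have "G u \<in> S3.span H" for u
    unfolding G_def by (intro S3.span_sum S3.span_scale) simp
  then show "{v. lc g v = 0} \<subseteq> S3.span H" unfolding range_G[symmetric] by blast
qed

text \<open>Generators of degree r already span \<open>syz g (int r)\<close>, hence generate the
  module, and minimality leaves no others. Conversely, a proper subset of a basis fails to generate,
  as comparison in degree r shows.\<close>

lemma minimal_generators_iff:
  "minimal_homogeneous_generators {v. lc g v = 0} H \<longleftrightarrow> CV.independent H \<and> CV.span H = syz g (int r)"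
proof
  assume H: "minimal_homogeneous_generators {v. lc g v = 0} H"
  have ind: "CV.independent H" by (rule minimal_generators_independent[OF H])
  have HS: "S3.span H = {v. lc g v = 0}" using H by (simp add: minimal_homogeneous_generators_def)
  have "\<exists>n\<ge>r. a \<in> H3 (int n)" if a: "a \<in> H" for a
  proof -
    obtain n where n: "a \<in> H3 (int n)"
      using H a by (auto simp: minimal_homogeneous_generators_def homogeneous_triple_iff)
    have "a \<in> syz g (int n)" using n S3.span_base[OF a] HS by (simp add: syz_def)
    moreover have "a \<noteq> 0" using ind a CV.dependent_zero by blast
    ultimately have "n \<ge> r" using low[of "int n"] by force
    then show ?thesis using n by blast
  qed
  then have part: "v \<in> CV.span (H \<inter> H3 (int r))" if "v \<in> syz g (int r)" for v
    using span_degree_part[of H r v] that HS by (simp add: syz_def)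
  have "H \<inter> H3 (int r) \<subseteq> syz g (int r)"
    using S3.span_superset[of H] HS by (auto simp: syz_def)
  then have eq: "CV.span (H \<inter> H3 (int r)) = syz g (int r)"
    using part CV.span_minimal[OF _ sub_syz] by blast
  then have "S3.span (H \<inter> H3 (int r)) = {v. lc g v = 0}" by (rule span_basis)
  then have "H \<inter> H3 (int r) = H"
    using H unfolding minimal_homogeneous_generators_def by blast
  then show "CV.independent H \<and> CV.span H = syz g (int r)" using ind eq by simp
next
  assume H: "CV.independent H \<and> CV.span H = syz g (int r)"
  then have HH: "H \<subseteq> H3 (int r)" using CV.span_superset[of H] by (auto simp: syz_def)
  show "minimal_homogeneous_generators {v. lc g v = 0} H"
    unfolding minimal_homogeneous_generators_def homogeneous_triple_iff
  proof (intro conjI allI impI notI)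
    show "\<forall>g\<in>H. \<exists>n. g \<in> H3 (int n)" using HH by blast
    show "S3.span H = {v. lc g v = 0}" using span_basis H by blast
    fix H' assume H': "H' \<subset> H" "S3.span H' = {v. lc g v = 0}"
    then obtain a where a: "a \<in> H" "a \<notin> H'" by blast
    have "a \<in> syz g (int r)" using a(1) H CV.span_base by blast
    then have "a \<in> CV.span (H' \<inter> H3 (int r))"
      using span_degree_part[of H' r a] H' HH by (auto simp: syz_def)
    moreover have "H' \<inter> H3 (int r) \<subseteq> H - {a}" using H'(1) a by blast
    ultimately have "a \<in> CV.span (H - {a})" using CV.span_mono by blast
    then show False using H a(1) unfolding CV.dependent_def by blast
  qed
qed

lemma minimal_generators_card:
  assumes "minimal_homogeneous_generators {v. lc g v = 0} H"
  shows "finite H \<and> card H = m"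
proof -
  have H: "CV.independent H" "CV.span H = syz g (int r)" using assms minimal_generators_iff by blast+
  have "finite H" using fd_finite_independent[OF fd_syz _ H(1)] H(2) CV.span_superset by blast
  moreover have "card H = m"
    using CV.dim_span_eq_card_independent[OF H(1)] H(2) dim_syz_r by simp
  ultimately show ?thesis ..
qed

end

lemma subspace_L3:
  assumes "CV.subspace V"
  shows "CV.subspace (L3 V)"
proof -
  let ?F = "\<lambda>x. scale3 X (fst x) + scale3 Y (fst (snd x)) + scale3 Z (snd (snd x))"
  have "L3 V = ?F ` (V \<times> V \<times> V)" unfolding L3_def by force
  moreover have "clinear ?F"
    by (intro clinear_add clinear_compose[OF clinear_scale3] clinear_pairs clinear_compose[OF clinear_pairs(3)]
        clinear_compose[OF clinear_pairs(4)])
  ultimately show ?thesis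
    using clinear_subspace_image[OF _ subspace_Times[OF assms subspace_Times[OF assms assms]], of ?F] by simp
qed

lemma linear_syzygiesI:
  assumes g: "g \<in> H3 (int e)" and gs: "distinct gs" "\<And>x. x \<in> set gs \<Longrightarrow> x \<in> H3 (int r)"
    and min: "minimal_homogeneous_generators {v. lc g v = 0} (set gs)"
  shows "linear_syzygies g e r (length gs) gs"
proof
  have span: "S3.span (set gs) = {v. lc g v = 0}"
    using min by (simp add: minimal_homogeneous_generators_def)
  have gs_syz: "set gs \<subseteq> syz g (int r)"
    using gs(2) S3.span_superset[of "set gs"] span by (auto simp: syz_def)
  have expl: "\<exists>c. v = (\<Sum>a\<in>set gs. scale3 (c a) a)" if v: "v \<in> syz g n" for v n
  proof -
    have "v \<in> S3.span (set gs)" using v span by (simp add: syz_def)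
    then show ?thesis using S3.span_finite[of "set gs"] by auto
  qed
  show "g \<in> H3 (int e)" "distinct gs" "length gs = length gs" by (simp_all add: g gs)
  show "CV.independent (set gs)" by (rule minimal_generators_independent[OF min])
  show "CV.span (set gs) = syz g (int r)"
  proof
    show "CV.span (set gs) \<subseteq> syz g (int r)" by (rule CV.span_minimal[OF gs_syz sub_syz])
    show "syz g (int r) \<subseteq> CV.span (set gs)"
    proof
      fix v assume v: "v \<in> syz g (int r)"
      have "v \<in> CV.span (set gs \<inter> H3 (int r))"
        by (rule span_degree_part) (use gs(2) v span in \<open>auto simp: syz_def\<close>)
      then show "v \<in> CV.span (set gs)" using CV.span_mono[of "set gs \<inter> H3 (int r)" "set gs"] by blast
    qed
  qed
  show "syz g i = {0}" if i: "i < int r" for i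
  proof -
    have "v = 0" if v: "v \<in> syz g i" for v
    proof (cases "i < 0")
      case True
      then show ?thesis using v syz_neg by blast
    next
      case False
      then obtain n where n: "i = int n" by (metis nonneg_int_cases not_less)
      obtain c where c: "v = (\<Sum>a\<in>set gs. scale3 (c a) a)" using expl[OF v] by blast
      have "v = cmp3 n v" using v n cmp3_of_H3[of v i n] by (simp add: syz_def)
      also have "\<dots> = (\<Sum>a\<in>set gs. cmp3 n (scale3 (c a) a))" by (simp only: c cmp3_sum)
      also have "\<dots> = 0" using i n by (intro sum.neutral) (simp add: cmp3_scale3[OF gs(2)])
      finally show ?thesis .
    qed
    then show ?thesis using CV.subspace_0[OF sub_syz] by blast
  qed
  show "syz g (j + 1) \<subseteq> L3 (syz g j)" if j: "j \<ge> int r" for j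
  proof
    fix v assume v: "v \<in> syz g (j + 1)"
    obtain n where n: "j = int n" "n \<ge> r" using j by (metis nat_int_comparison(3) nonneg_int_cases of_nat_0_le_iff order_trans)
    obtain c where c: "v = (\<Sum>a\<in>set gs. scale3 (c a) a)" using expl[OF v] by blast
    have "v = cmp3 (n + 1) v" using v n cmp3_of_H3[of v "j + 1" "n + 1"] by (simp add: syz_def)
    also have "\<dots> = (\<Sum>a\<in>set gs. cmp3 (n + 1) (scale3 (c a) a))" by (simp only: c cmp3_sum)
    also have "\<dots> \<in> L3 (syz g j)"
    proof (rule CV.subspace_sum[OF subspace_L3[OF sub_syz]])
      fix a assume a: "a \<in> set gs"
      have nr: "int (n + 1 - r) = (int n - int r) + 1" using n(2) by simp
      have c0: "int n - int r \<ge> 0" using n(2) by simp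
      \<comment> \<open>In degree j + 1 > r every generator carries a coefficient of positive
        degree, from which a variable can be split off.\<close>
      have cH: "cmp (n + 1 - r) (c a) \<in> Hm ((int n - int r) + 1)" 
        using cmp_Hm[of "n + 1 - r" "c a"] unfolding nr .
      obtain p q s where pqs: "p \<in> Hm (int n - int r)" "q \<in> Hm (int n - int r)" "s \<in> Hm (int n - int r)"
        "cmp (n + 1 - r) (c a) = X * p + Y * q + Z * s"
        by (rule Hm_decomp[OF cH c0])
      have mem: "scale3 w a \<in> syz g j" if "w \<in> Hm (int n - int r)" for w
        using syz_scale3[OF that, of a g "int r"] a gs_syz n(1) by auto
      have "cmp3 (n + 1) (scale3 (c a) a) = scale3 X (scale3 p a) + scale3 Y (scale3 q a) + scale3 Z (scale3 s a)"
      proof -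
        have "cmp3 (n + 1) (scale3 (c a) a) = scale3 (cmp (n + 1 - r) (c a)) a"
          using n(2) by (simp add: cmp3_scale3[OF gs(2)[OF a]])
        then show ?thesis unfolding pqs(4) by (simp add: S3.scale_left_distrib S3.scale_scale)
      qed
      then show "cmp3 (n + 1) (scale3 (c a) a) \<in> L3 (syz g j)"
        unfolding L3_def using mem pqs(1-3) by blast
    qed
    finally show "v \<in> L3 (syz g j)" .
  qed
qed

section \<open>Maximal Tjurina curves\<close>

lemma tau_max_eq:
  assumes "d = e + 1" "d \<le> 2 * r" "r \<le> e"
  shows "tau_max d r = dm (Hm (int r + int e - 1)) - 3 * dm (Hm (int r - 1))"
proof -
  have ch: "2 * (n choose 2) = n * (n - 1)" for n :: nat
  proof -
    have "even (n * (n - 1))" by (cases n) simp_all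
    then show ?thesis unfolding choose_two by (rule dvd_mult_div_cancel)
  qed
  let ?n = "2 * r + 2 - d"
  have "2 * int (?n choose 2) = int ?n * (int ?n - 1)"
    using arg_cong[OF ch[of ?n], of int] assms by (simp add: of_nat_diff)
  moreover have "int ?n = 2 * int r + 1 - int e" using assms by (simp add: of_nat_diff)
  ultimately have "2 * int (?n choose 2) = (2 * int r + 1 - int e) * (2 * int r - int e)" by simp
  then have "2 * tau_max d r = 2 * dm (Hm (int r + int e - 1)) - 6 * dm (Hm (int r - 1))"
    using dim_Hm[of "int r + int e - 1"] dim_Hm[of "int r - 1"] assms(1)
    by (simp add: tau_max_def power2_eq_square algebra_simps)
  then show ?thesis by simp
qed

lemma mdr_low:
  assumes "i < int (mdr f)"
  shows "syz (grad f) i = {0}"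
proof -
  have "v = 0" if v: "v \<in> syz (grad f) i" for v
  proof (cases "i < 0")
    case True
    then show ?thesis using v syz_neg by blast
  next
    case False
    then obtain n where n: "i = int n" by (metis nonneg_int_cases not_less)
    then have "\<not> (\<exists>v\<in>AR f. v \<noteq> 0 \<and> homogeneous_triple n v)"
      using assms unfolding mdr_def by (intro not_less_Least) simp
    then show ?thesis using v n unfolding AR_eq syz_def homogeneous_triple_iff by blast
  qed
  then show ?thesis using CV.subspace_0[OF sub_syz] by blast
qed

lemma mdr_eqI:
  assumes "\<And>i. i < int r \<Longrightarrow> syz (grad f) i = {0}" "syz (grad f) (int r) \<noteq> {0}"
  shows "mdr f = r"
  unfolding mdr_def
proof (rule Least_equality)
  have "0 \<in> syz (grad f) (int r)" by (rule CV.subspace_0[OF sub_syz])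
  then obtain v where "v \<in> syz (grad f) (int r)" "v \<noteq> 0" using assms(2) by blast
  then show "\<exists>v\<in>AR f. v \<noteq> 0 \<and> homogeneous_triple r v"
    unfolding AR_eq syz_def homogeneous_triple_iff by blast
next
  fix n assume "\<exists>v\<in>AR f. v \<noteq> 0 \<and> homogeneous_triple n v"
  then have "syz (grad f) (int n) \<noteq> {0}" unfolding AR_eq syz_def homogeneous_triple_iff by blast
  then show "r \<le> n" using assms(1)[of "int n"] by (meson not_less of_nat_less_iff)
qed

lemma syz_zero_iff: "syz g i = {0} \<longleftrightarrow> dm (syz g i) = 0"
proof
  assume 0: "dm (syz g i) = 0"
  have "{0} = syz g i"
    by (rule fd_dim_eq[OF fd_syz CV.subspace_single_0]) (use 0 CV.subspace_0[OF sub_syz] in auto)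
  then show "syz g i = {0}" by simp
qed simp

lemma reduced_curve_general_position:
  assumes f: "reduced_plane_curve d f" and d: "d = e + 1" "e \<ge> 1"
  obtains P Q T where "plane_triple (int e) P Q T" "syz_equiv (grad f) (P, Q, T)" "grad f \<in> H3 (int e)"
    "int (tjurina f) = plane_triple.tau (int e) P Q T"
proof -
  have f': "f \<in> Hm (int d)" "squarefree f" using f by (simp_all add: reduced_plane_curve_def homogeneous_iff)
  have "dx f \<in> Hm (int e)" "dy f \<in> Hm (int e)" "dz f \<in> Hm (int e)"
    using dx_Hm[OF f'(1)] dy_Hm[OF f'(1)] dz_Hm[OF f'(1)] d by simp_all
  then have H: "grad f \<in> H3 (int e)" by (simp add: grad_def H3_def)
  have "no_common (grad f)" using squarefree_no_common[OF f'(1) _ f'(2)] d by simp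
  then obtain P Q T where PQT: "plane_triple (int e) P Q T" "syz_equiv (grad f) (P, Q, T)"
    using general_position[of "int e" "dx f" "dy f" "dz f"] d H by (auto simp: grad_def H3_def)
  interpret plane_triple "int e" P Q T by (rule PQT(1))
  have "adim (grad f) (int e) k = A k" for k
    using PQT(2) by (simp add: adim_syz syz_equiv_def)
  then have "int (tjurina f) = tau"
    using tjurina_eqI[OF H, of "3 * int e - 2" tau] adim_eq_tau by simp
  then show ?thesis using that PQT H by blast
qed

text \<open>Dimensions and generation are established in general position and carried back to
  \<open>grad f\<close>, whose resolution is wanted. The first differences accompany the basis since
  the count of second syzygies needs them.\<close>

lemma tjurina_bound:
  assumes f: "reduced_plane_curve d f" and d: "d = e + 1" and r: "r = mdr f" "d \<le> 2 * r" "r \<le> e"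
  shows "int (tjurina f) \<le> tau_max d r"
    and "int (tjurina f) = tau_max d r \<Longrightarrow> \<exists>bs. linear_syzygies (grad f) e r (2 * r + 3 - d) bs \<and>
      (\<forall>j\<ge>int r. dm (syz (grad f) j) - dm (syz (grad f) (j - 1)) = 2 * j - int e + 2)"
proof -
  have e: "e \<ge> 1" using r d by auto
  obtain P Q T where PQT: "plane_triple (int e) P Q T" "syz_equiv (grad f) (P, Q, T)" "grad f \<in> H3 (int e)"
    "int (tjurina f) = plane_triple.tau (int e) P Q T"
    by (rule reduced_curve_general_position[OF f d e])
  interpret plane_triple "int e" P Q T by (rule PQT(1))
  have dims: "dm (syz (grad f) j) = h j" for j using PQT(2) by (simp add: syz_equiv_def)
  have low: "syz (P, Q, T) i = {0}" if "i < int r" for i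
    using mdr_low[of i f] that r(1) dims[of i] by (simp add: syz_zero_iff)
  have A: "A (int r + int e - 1) = tau_max d r"
    using adim_h[of "int r - 1"] low[of "int r - 1"] tau_max_eq[OF d r(2,3)]
    by (simp add: algebra_simps)
  have "tau \<le> A (int r + int e - 1)"
    by (rule tau_le[of "int r"]) (use low r(2) d e in auto)
  then show "int (tjurina f) \<le> tau_max d r" using A PQT(4) by simp
  assume "int (tjurina f) = tau_max d r"
  then have eq: "A (int r + int e - 1) = tau" using A PQT(4) by simp
  have er: "int e + 1 \<le> 2 * int r" using r(2) d by simp
  have gen: "syz (P, Q, T) (j + 1) \<subseteq> L3 (syz (P, Q, T) j)" if "j \<ge> int r" for j
    by (rule syz_generation[of "int r"]) (use low er eq that in auto)
  have diff: "h j - h (j - 1) = 2 * j - int e + 2" if "j \<ge> int r" for j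
    by (rule syz_dim_diff[of "int r"]) (use low er eq that in auto)
  obtain B where B: "B \<subseteq> syz (grad f) (int r)" "finite B" "CV.independent B" "CV.span B = syz (grad f) (int r)"
    "card B = CV.dim (syz (grad f) (int r))"
    by (rule fd_basis[OF fd_syz])
  obtain bs where bs: "set bs = B" "distinct bs" using finite_distinct_list[OF B(2)] by blast
  have "int (card B) = 2 * int r - int e + 2"
    using B(5) dims[of "int r"] diff[of "int r"] low[of "int r - 1"] by simp
  then have len: "length bs = 2 * r + 3 - d"
    using distinct_card[OF bs(2)] bs(1) d r(2) by simp
  have "linear_syzygies (grad f) e r (2 * r + 3 - d) bs"
  proof
    show "syz (grad f) i = {0}" if "i < int r" for i using mdr_low[of i f] that r(1) by simp
    show "syz (grad f) (j + 1) \<subseteq> L3 (syz (grad f) j)" if "j \<ge> int r" for j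
      using gen[OF that] PQT(2) unfolding syz_equiv_def by blast
  qed (use PQT(3) bs len B in auto)
  moreover have "dm (syz (grad f) j) - dm (syz (grad f) (j - 1)) = 2 * j - int e + 2" if "j \<ge> int r" for j
    using diff[OF that] dims by simp
  ultimately show "\<exists>bs. linear_syzygies (grad f) e r (2 * r + 3 - d) bs \<and>
      (\<forall>j\<ge>int r. dm (syz (grad f) j) - dm (syz (grad f) (j - 1)) = 2 * j - int e + 2)"
    by blast
qed

text \<open>Two bounds meet in degree r + e - 1: \<open>tau_le\<close> uses that there are no
  syzygies below r, \<open>adim_le_tau\<close> the number and degree of the generators.\<close>

lemma linear_syzygies_maximal:
  assumes f: "reduced_plane_curve d f" and d: "d = e + 1" and r: "d \<le> 2 * r" "r \<le> e"
    and lin: "linear_syzygies (grad f) e r (2 * r + 3 - d) bs"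
  shows "maximal_tjurina_curve d r f"
proof -
  interpret L: linear_syzygies "grad f" e r "2 * r + 3 - d" bs by (rule lin)
  have e: "e \<ge> 1" using r d by auto
  obtain P Q T where PQT: "plane_triple (int e) P Q T" "syz_equiv (grad f) (P, Q, T)" "grad f \<in> H3 (int e)"
    "int (tjurina f) = plane_triple.tau (int e) P Q T"
    by (rule reduced_curve_general_position[OF f d e])
  interpret plane_triple "int e" P Q T by (rule PQT(1))
  have dims: "dm (syz (grad f) j) = h j" for j using PQT(2) by (simp add: syz_equiv_def)
  have low: "syz (P, Q, T) i = {0}" if "i < int r" for i
    using L.low[OF that] dims[of i] by (simp add: syz_zero_iff)
  have gen: "syz (P, Q, T) (j + 1) \<subseteq> L3 (syz (P, Q, T) j)" if "j \<ge> int r" for j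
    using L.gen[OF that] PQT(2) unfolding syz_equiv_def by blast
  have A: "A (int r + int e - 1) = tau_max d r"
    using adim_h[of "int r - 1"] low[of "int r - 1"] tau_max_eq[OF d r]
    by (simp add: algebra_simps)
  have "tau \<le> A (int r + int e - 1)"
    by (rule tau_le[of "int r"]) (use low r d e in auto)
  moreover have hr: "h (int r) = 2 * int r - int e + 2"
    using L.dim_syz_r dims[of "int r"] d r(1) by simp
  have "A (int r + int e - 1) \<le> tau"
    by (rule adim_le_tau[of "int r"]) (use low gen hr r d e in auto)
  ultimately have "int (tjurina f) = tau_max d r" using A PQT(4) by simp
  moreover have "mdr f = r"
  proof (rule mdr_eqI)
    show "syz (grad f) (int r) \<noteq> {0}" using L.dim_syz_r r d by (auto simp: syz_zero_iff)
  qed (rule L.low)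
  ultimately show ?thesis unfolding maximal_tjurina_curve_def using f r d by simp
qed

text \<open>Minimal generators form a basis of the degree r part, and a nonzero triple has only one
  degree.\<close>

lemma exponents_replicate:
  assumes lin: "linear_syzygies (grad f) e r m bs"
  shows "exponents f (replicate m r)" and "exponents f ds \<Longrightarrow> ds = replicate m r"
proof -
  interpret linear_syzygies "grad f" e r m bs by (rule lin)
  have hom: "x \<in> H3 (int r)" if "x \<in> syz (grad f) (int r)" for x using that by (simp add: syz_def)
  have "minimal_homogeneous_generators (AR f) (set bs)"
    unfolding AR_eq minimal_generators_iff using bs by simp
  moreover have "list_all2 homogeneous_triple (replicate m r) bs"
    using bs(2) bs_syz hom by (simp add: list_all2_conv_all_nth homogeneous_triple_iff)
  ultimately show "exponents f (replicate m r)"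
    unfolding exponents_def using bs(1) by (auto simp: sorted_replicate)
  assume "exponents f ds"
  then obtain gs where gs: "distinct gs" "minimal_homogeneous_generators {v. lc (grad f) v = 0} (set gs)"
    "list_all2 homogeneous_triple ds gs"
    unfolding exponents_def AR_eq by blast
  have len: "length gs = m" using minimal_generators_card[OF gs(2)] distinct_card[OF gs(1)] by simp
  have ind: "CV.independent (set gs)" "CV.span (set gs) = syz (grad f) (int r)"
    using gs(2) minimal_generators_iff by blast+
  show "ds = replicate m r"
  proof (rule nth_equalityI)
    show "length ds = length (replicate m r)" using gs(3) len by (simp add: list_all2_lengthD)
    fix i assume "i < length ds"
    then have i: "i < length gs" "homogeneous_triple (ds ! i) (gs ! i)"
      using gs(3) by (auto simp: list_all2_conv_all_nth)
    have gsi: "gs ! i \<in> set gs" using i(1) by simp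
    have "gs ! i \<in> H3 (int r)" using hom CV.span_base[OF gsi] ind(2) by simp
    moreover have "gs ! i \<noteq> 0" using gsi ind(1) CV.dependent_zero[of "set gs"] by metis
    ultimately have "ds ! i = r" using i(2) cmp3_of_H3[of "gs ! i" "int r" "ds ! i"]
        cmp3_of_H3[of "gs ! i" "int (ds ! i)" "ds ! i"] by (auto simp: homogeneous_triple_iff split: if_splits)
    then show "ds ! i = replicate m r ! i" using i(1) len by simp
  qed
qed

theorem theorem3p1:
  fixes f :: poly3 and d :: nat
  assumes "reduced_plane_curve d f"
  shows "(\<forall>r m. r = mdr f \<and> d \<le> 2 * r \<and> r \<le> d - 1 \<and> m = 2 * r + 3 - d \<longrightarrow>
            int (tjurina f) \<le> tau_max d r \<and>
            (int (tjurina f) = tau_max d r \<longrightarrow>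
               (\<exists>g N. minimal_graded_free_resolution (AR f)
                        (replicate m r) (replicate (m - 2) (r + 1)) g N) \<and>
               (\<exists>G. minimal_homogeneous_generators (AR f) G) \<and>
               (\<forall>G. minimal_homogeneous_generators (AR f) G \<longrightarrow> finite G \<and> card G = m) \<and>
               exponents f (replicate m r) \<and>
               (\<forall>ds. exponents f ds \<longrightarrow> ds = replicate m r)))
       \<and> (\<forall>r m. d \<le> 2 * r \<and> r \<le> d - 1 \<and> m = 2 * r + 3 - d \<and> exponents f (replicate m r) \<longrightarrow>
            maximal_tjurina_curve d r f)"
proof -
  define e where "e = d - 1"
  have e: "d = e + 1" using assms by (simp add: e_def reduced_plane_curve_def)
  show ?thesis
    unfolding e_def[symmetric]
  proof (rule conjI; intro allI impI; elim conjE)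
    fix r m assume r: "r = mdr f" "d \<le> 2 * r" "r \<le> e" and m: "m = 2 * r + 3 - d"
    show "int (tjurina f) \<le> tau_max d r \<and> (int (tjurina f) = tau_max d r \<longrightarrow>
               (\<exists>g N. minimal_graded_free_resolution (AR f) (replicate m r) (replicate (m - 2) (r + 1)) g N) \<and>
               (\<exists>G. minimal_homogeneous_generators (AR f) G) \<and>
               (\<forall>G. minimal_homogeneous_generators (AR f) G \<longrightarrow> finite G \<and> card G = m) \<and>
               exponents f (replicate m r) \<and>
               (\<forall>ds. exponents f ds \<longrightarrow> ds = replicate m r))"
    proof (rule conjI[OF tjurina_bound(1)[OF assms e r] impI])
      assume eq: "int (tjurina f) = tau_max d r"
      obtain bs where lin: "linear_syzygies (grad f) e r m bs" and
        diff: "\<And>j. j \<ge> int r \<Longrightarrow> dm (syz (grad f) j) - dm (syz (grad f) (j - 1)) = 2 * j - int e + 2"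
        using tjurina_bound(2)[OF assms e r eq] unfolding m by blast
      interpret linear_syzygies "grad f" e r m bs by (rule lin)
      have m2: "m \<ge> 2" using m r(2) by simp
      obtain N where "minimal_graded_free_resolution {v. lc (grad f) v = 0}
          (replicate m r) (replicate (m - 2) (r + 1)) (\<lambda>i. bs ! i) N"
        by (rule linear_resolution[OF diff m2])
      moreover have "minimal_homogeneous_generators {v. lc (grad f) v = 0} (set bs)"
        unfolding minimal_generators_iff using bs by simp
      ultimately show "(\<exists>g N. minimal_graded_free_resolution (AR f) (replicate m r) (replicate (m - 2) (r + 1)) g N) \<and>
               (\<exists>G. minimal_homogeneous_generators (AR f) G) \<and>
               (\<forall>G. minimal_homogeneous_generators (AR f) G \<longrightarrow> finite G \<and> card G = m) \<and>
               exponents f (replicate m r) \<and>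
               (\<forall>ds. exponents f ds \<longrightarrow> ds = replicate m r)"
        using minimal_generators_card exponents_replicate[OF lin] unfolding AR_eq by blast
    qed
  next
    fix r m assume r: "d \<le> 2 * r" "r \<le> e" and m: "m = 2 * r + 3 - d" and ex: "exponents f (replicate m r)"
    obtain gs where gs: "distinct gs" "minimal_homogeneous_generators {v. lc (grad f) v = 0} (set gs)"
      "list_all2 homogeneous_triple (replicate m r) gs"
      using ex unfolding exponents_def AR_eq by blast
    have len: "length gs = m" using gs(3) by (simp add: list_all2_lengthD[symmetric])
    have hom: "x \<in> H3 (int r)" if "x \<in> set gs" for x
      using gs(3) that len by (auto simp: list_all2_conv_all_nth in_set_conv_nth homogeneous_triple_iff)
    \<comment> \<open>The range d/2 \<le> r \<le> d - 1 excludes lines.\<close>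
    have "1 \<le> e" using r e by simp
    then obtain P Q T where "grad f \<in> H3 (int e)" by (rule reduced_curve_general_position[OF assms e])
    then have "linear_syzygies (grad f) e r (length gs) gs" by (rule linear_syzygiesI[OF _ gs(1) hom gs(2)])
    then show "maximal_tjurina_curve d r f"
      using linear_syzygies_maximal[OF assms e r] len m by simp
  qed
qed

end
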